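(* Let $n\ge 1$, let $L=K_1\cup K_2\cup\cdots\cup K_n$ be a non-split link diagram in $\mathbb{R}^2$ with $n$ components, and let $Q$ be a set of crossing points of $L$. Let $G(L;Q)$ be the multigraph with vertices $v_1,\dots,v_n$ (with $v_i$ corresponding to the component $K_i$) having, for each crossing point in $Q$ between two distinct components $K_i$ and $K_j$, one edge joining $v_i$ and $v_j$ (self-crossings of components contribute no edges). Then $Q$ is region crossing change admissible on $L$ if and only if every vertex of $G(L;Q)$ has even valency.
   Context: A link diagram in $\mathbb{R}^2$ with its crossing information forgotten is a planar 4-valent graph (possibly with circle components having no vertices). A diagram is non-split if this underlying planar projection is connected. The regions of a diagram are the connected components of the complement in $\mathbb{R}^2$ of the projection (including the unbounded one). A region crossing change at a region $R$ performs a crossing change (exchange of over- and under-strand) at every crossing point on the boundary of $R$, each such crossing being changed exactly once; no Reidemeister moves are allowed. A set $Q$ of crossing points of a diagram $D$ is region crossing change admissible on $D$ if there is a finite sequence of region crossing changes transforming $D$ into the diagram obtained from $D$ by changing exactly the crossings in $Q$. *)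

theory Defs
  imports "HOL-Analysis.Analysis"
begin

section \<open>Link diagrams in the plane\<close>

text \<open>
  The plane is the type of complex numbers, and the model circle is the unit circle in it.  Component
  number \<open>i < num_components D\<close> of a diagram \<open>D\<close> is the closed curve \<open>curve D i\<close>, a map on the
  unit circle; its values elsewhere, and those of the curves with larger index, are irrelevant.
  The diagram is thus parametrised by the pairs \<open>(i, z)\<close> in \<open>params D\<close>.
  The crossing information at a crossing point \<open>c\<close> is \<open>over D c\<close>, the one of the two parameters
  over \<open>c\<close> at which the over-strand passes through \<open>c\<close>.
\<close>

record diagram_data =
  num_components :: nat
  curve :: "nat \<Rightarrow> complex \<Rightarrow> complex"
  over :: "complex \<Rightarrow> nat \<times> complex"

definition params :: "diagram_data \<Rightarrow> (nat \<times> complex) set" where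
  "params D = {..<num_components D} \<times> sphere 0 1"

definition point_at :: "diagram_data \<Rightarrow> nat \<times> complex \<Rightarrow> complex" where
  "point_at D p = curve D (fst p) (snd p)"

definition projection :: "diagram_data \<Rightarrow> complex set" where
  "projection D = point_at D ` params D"

definition fibre :: "diagram_data \<Rightarrow> complex \<Rightarrow> (nat \<times> complex) set" where
  "fibre D c = {p \<in> params D. point_at D p = c}"

definition crossings :: "diagram_data \<Rightarrow> complex set" where
  "crossings D = {c. \<exists>p\<in>fibre D c. \<exists>q\<in>fibre D c. p \<noteq> q}"

definition chart_at :: "complex \<Rightarrow> complex set \<Rightarrow> (complex \<Rightarrow> complex) \<Rightarrow> bool" where
  "chart_at c U h \<longleftrightarrow> open U \<and> c \<in> U \<and> h c = 0 \<and> (\<exists>V k. open V \<and> homeomorphism U V h k)"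

definition runs_along ::
  "diagram_data \<Rightarrow> (complex \<Rightarrow> complex) \<Rightarrow> nat \<times> complex \<Rightarrow> complex set \<Rightarrow> bool" where
  "runs_along D h p S \<longleftrightarrow>
     (\<forall>\<^sub>F u in at (snd p) within sphere 0 1. h (curve D (fst p) u) \<in> S)"

text \<open>
  A diagram is a generic immersion of circles together with crossing information.  The category is
  that of locally flat topological curves, which contains the smooth and the piecewise linear
  diagrams: near every parameter the curve is a straight line in a suitable chart, and at a crossing
  point there is one chart in which the two strands are the two coordinate axes.  This is
  transversality, and it excludes two strands that merely touch.  (As only finitely many parameters
  lie over crossing points, the curves are locally injective, so a strand that runs along an axis
  of a chart passes through the origin.)
\<close>

definition locally_flat :: "diagram_data \<Rightarrow> nat \<times> complex \<Rightarrow> bool" where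
  "locally_flat D p \<longleftrightarrow>
     (\<exists>U h. chart_at (point_at D p) U h \<and> runs_along D h p {w. Im w = 0})"

definition transverse_double_point :: "diagram_data \<Rightarrow> complex \<Rightarrow> bool" where
  "transverse_double_point D c \<longleftrightarrow>
     (\<exists>p q U h. p \<noteq> q \<and> fibre D c = {p, q} \<and> chart_at c U h \<and>
        runs_along D h p {w. Im w = 0} \<and> runs_along D h q {w. Re w = 0})"

definition link_diagram :: "diagram_data \<Rightarrow> bool" where
  "link_diagram D \<longleftrightarrow>
     (\<forall>i<num_components D. continuous_on (sphere 0 1) (curve D i)) \<and>
     (\<forall>p\<in>params D. locally_flat D p) \<and>
     finite (crossings D) \<and>
     (\<forall>c\<in>crossings D. transverse_double_point D c \<and> over D c \<in> fibre D c)"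

definition non_split :: "diagram_data \<Rightarrow> bool" where
  "non_split D \<longleftrightarrow> connected (projection D)"

definition regions :: "diagram_data \<Rightarrow> complex set set" where
  "regions D = components (- projection D)"

section \<open>Region crossing changes\<close>

definition other_strand :: "diagram_data \<Rightarrow> complex \<Rightarrow> nat \<times> complex \<Rightarrow> nat \<times> complex" where
  "other_strand D c p = (THE q. q \<in> fibre D c \<and> q \<noteq> p)"

definition crossing_change :: "diagram_data \<Rightarrow> complex set \<Rightarrow> diagram_data" where
  "crossing_change D S =
     D\<lparr>over := (\<lambda>c. if c \<in> S \<inter> crossings D then other_strand D c (over D c) else over D c)\<rparr>"

definition region_crossing_change :: "diagram_data \<Rightarrow> complex set \<Rightarrow> diagram_data" where
  "region_crossing_change D R = crossing_change D (crossings D \<inter> frontier R)"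

definition rcc_step :: "diagram_data \<Rightarrow> diagram_data \<Rightarrow> bool" where
  "rcc_step D D' \<longleftrightarrow> (\<exists>R\<in>regions D. D' = region_crossing_change D R)"

definition rcc_admissible :: "diagram_data \<Rightarrow> complex set \<Rightarrow> bool" where
  "rcc_admissible D Q \<longleftrightarrow> rcc_step\<^sup>*\<^sup>* D (crossing_change D Q)"

section \<open>Multigraphs\<close>

text \<open>The set \<open>mends G e\<close> consists of the two ends of the edge \<open>e\<close>; it is a singleton for a loop.\<close>

record ('v, 'e) multigraph =
  mverts :: "'v set"
  medges :: "'e set"
  mends :: "'e \<Rightarrow> 'v set"

definition valency :: "('v, 'e) multigraph \<Rightarrow> 'v \<Rightarrow> nat" where
  "valency G v = card {e \<in> medges G. v \<in> mends G e} + card {e \<in> medges G. mends G e = {v}}"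

definition components_through :: "diagram_data \<Rightarrow> complex \<Rightarrow> nat set" where
  "components_through D c = fst ` fibre D c"

definition crossing_graph :: "diagram_data \<Rightarrow> complex set \<Rightarrow> (nat, complex) multigraph" where
  "crossing_graph D Q =
     \<lparr>mverts = {..<num_components D},
      medges = {c \<in> Q. \<exists>i j. i \<noteq> j \<and> components_through D c = {i, j}},
      mends = components_through D\<rparr>"

end

theory Submission
  imports Defs
begin

text \<open>
  Crossing sets are vectors over the field with two elements, and \<open>Q\<close> is admissible iff it is a sum
  of the sets of crossings on the boundary of a region.  A function \<open>f\<close> on the regions is the same as
  the set of arcs across which it flips, and along each strand this flipping behaviour switches at a
  crossing \<open>c\<close> iff \<open>f\<close> holds in an odd number of the four corners at \<open>c\<close>.  Conversely, every
  marking of the arcs that is a cycle modulo 2 comes from such an \<open>f\<close>: local solutions are glued, box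
  by box, over the plane.

  Hence \<open>f\<close> with prescribed odd corner sums exactly on \<open>Q\<close> exists iff every component passes
  through \<open>Q\<close> an even number of times, which is the condition on the valencies as self-crossings are
  passed twice.  Corner sums and boundary sums differ only at reducible crossings, which one region
  meets in two opposite corners.  Such crossings are never between distinct components, and
  each of them is admissible on its own: inside a Jordan curve through \<open>c\<close> and the doubled region,
  add up all regions whose checkerboard colour is opposite to that of the doubled one; this changes
  \<open>c\<close> and some reducible crossings strictly inside the curve, so one can induct.
\<close>

section \<open>Charts\<close>

text \<open>Regions are never enumerated and no planar graph is built: a choice of regions is a
  Boolean function on the plane that is locally constant off the projection, and all that is asked
  of it at an arc is whether it agrees on both sides. A marking of the arcs comes from such a
  function iff at every crossing an even number of the four rays is marked; that this local
  condition suffices is the vanishing of the first cohomology of the plane modulo 2. Three markings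
  are used. Marking all arcs gives the checkerboard colouring, so neighbouring corners never share a
  region. Marking the arcs of one component gives a function that separates opposite corners at its
  crossings with other components, which is why those crossings are not reducible. Marking by the
  parity of the passages through \<open>Q\<close> gives the prescribed corner sums; it closes up
  along a component exactly because the number of passages is even.\<close>

definition disc_chart :: "complex \<Rightarrow> real \<Rightarrow> (complex \<Rightarrow> complex) \<Rightarrow> bool" where
  "disc_chart m r k \<longleftrightarrow> 0 < r \<and> k 0 = m \<and> continuous_on (ball 0 r) k \<and> inj_on k (ball 0 r)"

definition arc_chart :: "complex set \<Rightarrow> complex \<Rightarrow> real \<Rightarrow> (complex \<Rightarrow> complex) \<Rightarrow> bool" where
  "arc_chart P m r k \<longleftrightarrow> disc_chart m r k \<and> (\<forall>w\<in>ball 0 r. k w \<in> P \<longleftrightarrow> Im w = 0)"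

definition cross_chart :: "complex set \<Rightarrow> complex \<Rightarrow> real \<Rightarrow> (complex \<Rightarrow> complex) \<Rightarrow> bool" where
  "cross_chart P c r k \<longleftrightarrow> disc_chart c r k \<and> (\<forall>w\<in>ball 0 r. k w \<in> P \<longleftrightarrow> Re w = 0 \<or> Im w = 0)"

text \<open>At a point on an arc of \<open>P\<close> this says that \<open>f\<close> agrees on the two sides of the arc.\<close>

definition const_near :: "complex set \<Rightarrow> (complex \<Rightarrow> bool) \<Rightarrow> complex \<Rightarrow> bool" where
  "const_near P f m \<longleftrightarrow> (\<exists>T s. open T \<and> m \<in> T \<and> (\<forall>w\<in>T - P. f w = s))"

text \<open>Invariance of domain. It is the reason why \<open>disc_chart\<close> can be stated by
  continuity and injectivity alone. These charts run from a disc into the plane, opposite to the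
  \<open>h\<close> of a diagram.\<close>

lemma open_chart_image:
  assumes "disc_chart m r k" "open A" "A \<subseteq> ball 0 r"
  shows "open (k ` A)"
  using assms unfolding disc_chart_def
  by (intro invariance_of_domain) (auto intro: continuous_on_subset inj_on_subset)

lemma disc_chart_mono: "disc_chart m r k \<Longrightarrow> 0 < s \<Longrightarrow> s \<le> r \<Longrightarrow> disc_chart m s k"
  unfolding disc_chart_def by (meson continuous_on_subset inj_on_subset subset_ball)

lemma arc_chart_mono: "arc_chart P m r k \<Longrightarrow> 0 < s \<Longrightarrow> s \<le> r \<Longrightarrow> arc_chart P m s k"
  unfolding arc_chart_def using disc_chart_mono by auto

lemma cross_chart_mono: "cross_chart P m r k \<Longrightarrow> 0 < s \<Longrightarrow> s \<le> r \<Longrightarrow> cross_chart P m s k"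
  unfolding cross_chart_def using disc_chart_mono by auto

lemma chart_ball_within:
  assumes k: "disc_chart m r k" and "w \<in> ball 0 r" "open U" "k w \<in> U"
  obtains e where "e > 0" "ball w e \<subseteq> ball 0 r" "k ` ball w e \<subseteq> U"
proof -
  have "open (ball 0 r \<inter> k -` U)"
    using k \<open>open U\<close> unfolding disc_chart_def
    by (intro continuous_open_preimage) auto
  then obtain e where "e > 0" "ball w e \<subseteq> ball 0 r \<inter> k -` U"
    using assms by (metis IntI open_contains_ball vimageI)
  then show ?thesis using that by blast
qed

lemma disc_chart_small:
  assumes k: "disc_chart m r k" and U: "open U" "m \<in> U"
  obtains s where "0 < s" "s \<le> r" "k ` ball 0 s \<subseteq> U"
proof -
  have r: "0 \<in> ball (0::complex) r" and k0: "k 0 \<in> U" using k U by (auto simp: disc_chart_def)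
  obtain e where e: "e > 0" "k ` ball 0 e \<subseteq> U"
    by (rule chart_ball_within[OF k r U(1) k0])
  have "ball 0 (min e r) \<subseteq> ball (0::complex) e" by auto
  then have "k ` ball 0 (min e r) \<subseteq> U" using e(2) by blast
  then show ?thesis using e(1) r by (intro that[of "min e r"]) auto
qed

lemma const_nearI: "open T \<Longrightarrow> m \<in> T \<Longrightarrow> (\<And>w. w \<in> T \<Longrightarrow> w \<notin> P \<Longrightarrow> f w = s) \<Longrightarrow> const_near P f m"
  unfolding const_near_def by (intro exI[of _ T] exI[of _ s]) auto

lemma const_near_chart:
  assumes k: "disc_chart m r k" and S: "open S" "S \<subseteq> ball 0 r" "v \<in> S"
    and f: "\<And>u. u \<in> S \<Longrightarrow> f (k u) = f (k v)"
  shows "const_near P f (k v)"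
proof (rule const_nearI[where s = "f (k v)"])
  show "open (k ` S)" by (rule open_chart_image[OF k S(1,2)])
  show "k v \<in> k ` S" using S(3) by (rule imageI)
  show "f w = f (k v)" if "w \<in> k ` S" for w using that f by blast
qed

lemma const_near_mono:
  assumes "const_near P f m" "open U" "m \<in> U"
  obtains T s where "open T" "m \<in> T" "T \<subseteq> U" "\<And>w. w \<in> T \<Longrightarrow> w \<notin> P \<Longrightarrow> f w = s"
proof -
  obtain T s where "open T" "m \<in> T" "\<forall>w\<in>T - P. f w = s" using assms by (auto simp: const_near_def)
  then show ?thesis using assms by (intro that[of "T \<inter> U" s]) auto
qed

lemma const_near_cong:
  assumes "open U" "m \<in> U" "\<And>w. w \<in> U \<Longrightarrow> w \<notin> P \<Longrightarrow> f w = g w"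
  shows "const_near P f m \<longleftrightarrow> const_near P g m"
proof -
  have "const_near P g m" if cf: "const_near P f m" and fg: "\<And>w. w \<in> U \<Longrightarrow> w \<notin> P \<Longrightarrow> f w = g w" for f g
  proof -
    obtain T s where T: "open T" "m \<in> T" "T \<subseteq> U" "\<And>w. w \<in> T \<Longrightarrow> w \<notin> P \<Longrightarrow> f w = s"
      using const_near_mono[OF cf assms(1,2)] by metis
    show ?thesis
    proof (rule const_nearI[OF T(1,2)])
      show "g w = s" if "w \<in> T" "w \<notin> P" for w using T(3) T(4)[OF that] fg[of w] that by auto
    qed
  qed
  then show ?thesis using assms(3) by metis
qed

lemma const_on_connected:
  assumes "connected A" "A \<inter> P = {}" "\<And>w. w \<in> A \<Longrightarrow> const_near P f w" "x \<in> A" "y \<in> A"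
  shows "f x = f y"
proof (rule connected_local_const[where A = A])
  show "\<forall>a\<in>A. \<forall>\<^sub>F b in at a within A. f a = f b"
  proof
    fix a assume "a \<in> A"
    then obtain T s where "open T" "a \<in> T" "\<forall>w\<in>T - P. f w = s"
      using assms(3)[OF \<open>a \<in> A\<close>] unfolding const_near_def by blast
    then show "\<forall>\<^sub>F b in at a within A. f a = f b"
      unfolding eventually_at_topological using assms(2) \<open>a \<in> A\<close> by (intro exI[of _ T]) auto
  qed
qed (use assms in auto)

text \<open>The values above and below the arc. The last clause makes flipping a property of the
  whole piece of arc in the chart, not of a single point.\<close>

definition chart_sides :: "complex set \<Rightarrow> real \<Rightarrow> (complex \<Rightarrow> complex) \<Rightarrow> (complex \<Rightarrow> bool) \<Rightarrow> bool \<Rightarrow> bool \<Rightarrow> bool" where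
  "chart_sides P r k f a b \<longleftrightarrow> (\<forall>w\<in>ball 0 r. (Im w > 0 \<longrightarrow> f (k w) = a) \<and> (Im w < 0 \<longrightarrow> f (k w) = b) \<and>
    (Im w = 0 \<longrightarrow> (const_near P f (k w) \<longleftrightarrow> a = b)))"

lemma chart_sidesD:
  assumes "chart_sides P r k f a b" "w \<in> ball 0 r"
  shows "Im w > 0 \<Longrightarrow> f (k w) = a" "Im w < 0 \<Longrightarrow> f (k w) = b"
    "Im w = 0 \<Longrightarrow> const_near P f (k w) \<longleftrightarrow> a = b"
  using assms unfolding chart_sides_def by blast+

text \<open>Both half discs are convex and their images miss \<open>P\<close>, so \<open>f\<close>
  is constant on each image. Every neighbourhood of a point of the axis meets both, so agreement
  there means \<open>a = b\<close>.\<close>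

lemma arc_chart_sides:
  assumes k: "arc_chart P m r k" and f: "\<And>w. w \<in> k ` ball 0 r \<Longrightarrow> w \<notin> P \<Longrightarrow> const_near P f w"
  shows "\<exists>a b. chart_sides P r k f a b"
proof -
  have dk: "disc_chart m r k" and onP: "\<And>w. w \<in> ball 0 r \<Longrightarrow> k w \<in> P \<longleftrightarrow> Im w = 0"
    using k by (auto simp: arc_chart_def)
  have r: "r > 0" and ck: "continuous_on (ball 0 r) k" using dk by (auto simp: disc_chart_def)
  let ?A = "ball 0 r \<inter> {w. Im w > 0}" and ?B = "ball 0 r \<inter> {w. Im w < 0}"
  have side: "f (k x) = f (k y)" if "convex S" "S \<subseteq> ball 0 r" "\<And>w. w \<in> S \<Longrightarrow> Im w \<noteq> 0" "x \<in> S" "y \<in> S" for S x y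
  proof (rule const_on_connected[where A = "k ` S" and P = P])
    show "connected (k ` S)"
      using that ck by (meson connected_continuous_image continuous_on_subset convex_connected)
    show "k ` S \<inter> P = {}" using that onP by blast
    then show "const_near P f w" if "w \<in> k ` S" for w using f that \<open>S \<subseteq> ball 0 r\<close> by blast
  qed (use that in auto)
  have cA: "convex ?A" "convex ?B"
    by (auto intro!: convex_Int simp: convex_halfspace_Im_gt convex_halfspace_Im_lt)
  define a where "a = f (k (Complex 0 (r/2)))"
  define b where "b = f (k (Complex 0 (-r/2)))"
  have A: "f (k w) = a" if "w \<in> ball 0 r" "Im w > 0" for w
    unfolding a_def using r that by (intro side[OF cA(1)]) (auto simp: cmod_def)
  have B: "f (k w) = b" if "w \<in> ball 0 r" "Im w < 0" for w
    unfolding b_def using r that by (intro side[OF cA(2)]) (auto simp: cmod_def)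
  have C: "const_near P f (k w) \<longleftrightarrow> a = b" if w: "w \<in> ball 0 r" "Im w = 0" for w
  proof
    assume "const_near P f (k w)"
    then obtain T s where T: "open T" "k w \<in> T" "\<forall>w\<in>T - P. f w = s" by (auto simp: const_near_def)
    then obtain e where e: "e > 0" "ball w e \<subseteq> ball 0 r" "k ` ball w e \<subseteq> T"
      using chart_ball_within[OF dk] w by metis
    have *: "w + Complex 0 (e/2) \<in> ball w e" "w + Complex 0 (-e/2) \<in> ball w e"
      using e by (auto simp: dist_norm cmod_def)
    then have in_ball: "w + Complex 0 (e/2) \<in> ball 0 r" "w + Complex 0 (-e/2) \<in> ball 0 r"
      using e by blast+
    have "f (k u) = s" if "u \<in> ball w e" "Im u \<noteq> 0" for u
    proof -
      have "k u \<in> T" "k u \<notin> P" using that e onP by blast+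
      then show ?thesis using T by blast
    qed
    then have "f (k (w + Complex 0 (e/2))) = s" "f (k (w + Complex 0 (-e/2))) = s"
      using * e w by auto
    then show "a = b" using A[OF in_ball(1)] B[OF in_ball(2)] e w by simp
  next
    assume "a = b"
    have "open (k ` ball 0 r)" using open_chart_image[OF dk] by auto
    moreover have "k w \<in> k ` ball 0 r" using w(1) by (rule imageI)
    moreover have "f v = a" if v: "v \<in> k ` ball 0 r" "v \<notin> P" for v
    proof -
      obtain u where u: "v = k u" "u \<in> ball 0 r" using v by blast
      then have "Im u \<noteq> 0" using v onP by blast
      then show ?thesis using A[of u] B[of u] u \<open>a = b\<close> by (cases "Im u > 0") auto
    qed
    ultimately show "const_near P f (k w)" by (rule const_nearI)
  qed
  show ?thesis using A B C unfolding chart_sides_def by (intro exI[of _ a] exI[of _ b]) simp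
qed

section \<open>Quadrants and rays of a chart at a crossing\<close>

abbreviation quadrant :: "real \<Rightarrow> complex set" where
  "quadrant r \<equiv> ball 0 r \<inter> {v. Re v > 0} \<inter> {v. Im v > 0}"

text \<open>Powers of \<i> name the quadrants, so that statements about all four reduce to the open
  first quadrant.\<close>

lemma quarter_turn:
  fixes w :: complex
  assumes "Re w \<noteq> 0" "Im w \<noteq> 0"
  obtains j v where "j < 4" "w = v * \<i> ^ j" "Re v > 0" "Im v > 0"
proof -
  consider "Re w > 0" "Im w > 0" | "Re w < 0" "Im w > 0" | "Re w < 0" "Im w < 0" | "Re w > 0" "Im w < 0"
    using assms by linarith
  then show ?thesis
  proof cases
    case 1 then show ?thesis by (intro that[of 0 w]) auto
  next
    case 2 then show ?thesis by (intro that[of 1 "- \<i> * w"]) (auto simp: complex_eq_iff)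
  next
    case 3 then show ?thesis by (intro that[of 2 "- w"]) auto
  next
    case 4 then show ?thesis by (intro that[of 3 "\<i> * w"]) (auto simp: numeral_3_eq_3 complex_eq_iff)
  qed
qed

text \<open>A sample point on the diagonal of quadrant \<open>j\<close>, at distance
  \<open>r / sqrt 2\<close> from the origin and hence in the disc. The index may exceed 3 and
  matters only modulo 4.\<close>

definition quadrant_point :: "(complex \<Rightarrow> complex) \<Rightarrow> real \<Rightarrow> nat \<Rightarrow> complex" where
  "quadrant_point k r j = k (of_real (r / 2) * (1 + \<i>) * \<i> ^ j)"

lemma norm_quadrant_point: "r > 0 \<Longrightarrow> cmod (of_real (r / 2) * (1 + \<i>) * \<i> ^ j) < r"
proof -
  assume "r > 0"
  have "cmod (1 + \<i>) < 2" by (simp add: cmod_def sqrt2_less_2)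
  then show ?thesis using \<open>r > 0\<close> by (simp add: norm_mult norm_power)
qed

lemma norm_times_i_power [simp]: "cmod (v * \<i> ^ j) = cmod v"
  by (simp add: norm_mult norm_power)

lemma i_power_axes: "Re (v * \<i> ^ j) = 0 \<or> Im (v * \<i> ^ j) = 0 \<longleftrightarrow> Re v = 0 \<or> Im v = 0"
  by (induction j) (auto simp: power_Suc2 simp flip: mult.assoc simp del: power_Suc)

text \<open>Quarter turns permute the half axes. Hence only the first quadrant and the positive real
  ray have to be treated explicitly.\<close>

lemma cross_chart_turn:
  assumes "cross_chart P c r k"
  shows "cross_chart P c r (\<lambda>w. k (w * \<i> ^ j))"
proof -
  have k: "0 < r" "k 0 = c" "continuous_on (ball 0 r) k" "inj_on k (ball 0 r)"
    "\<And>w. w \<in> ball 0 r \<Longrightarrow> k w \<in> P \<longleftrightarrow> Re w = 0 \<or> Im w = 0"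
    using assms by (auto simp: cross_chart_def disc_chart_def)
  have b: "w * \<i> ^ j \<in> ball 0 r" if "w \<in> ball 0 r" for w using that by simp
  have "continuous_on (ball 0 r) (\<lambda>w. k (w * \<i> ^ j))"
    by (rule continuous_on_compose2[OF k(3)]) (auto intro!: continuous_intros)
  moreover have "inj_on (\<lambda>w. k (w * \<i> ^ j)) (ball 0 r)"
  proof (rule inj_onI)
    fix x y assume "x \<in> ball 0 r" "y \<in> ball 0 r" "k (x * \<i> ^ j) = k (y * \<i> ^ j)"
    then have "x * \<i> ^ j = y * \<i> ^ j" using inj_onD[OF k(4)] b by metis
    then show "x = y" by simp
  qed
  moreover have "k (w * \<i> ^ j) \<in> P \<longleftrightarrow> Re w = 0 \<or> Im w = 0" if "w \<in> ball 0 r" for w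
    using k(5)[OF b[OF that]] i_power_axes by simp
  ultimately show ?thesis using k(1,2) unfolding cross_chart_def disc_chart_def by simp
qed

text \<open>A crossing chart recentred at a point of its positive real ray: the radius
  \<open>s\<close> keeps clear of the imaginary axis, and \<open>r - s\<close> stays inside the
  disc.\<close>

lemma ray_chart:
  assumes "cross_chart P c r k" and s: "0 < s" "s < r"
  shows "arc_chart P (k (of_real s)) (min s (r - s)) (\<lambda>w. k (of_real s + w))"
proof -
  have k: "continuous_on (ball 0 r) k" "inj_on k (ball 0 r)"
    "\<And>w. w \<in> ball 0 r \<Longrightarrow> k w \<in> P \<longleftrightarrow> Re w = 0 \<or> Im w = 0"
    using assms(1) by (auto simp: cross_chart_def disc_chart_def)
  have sub: "of_real s + w \<in> ball 0 r" "Re (of_real s + w) > 0" if "w \<in> ball 0 (min s (r - s))" for w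
  proof -
    show "of_real s + w \<in> ball 0 r"
      using that s norm_triangle_ineq[of "of_real s" w] by simp
    show "Re (of_real s + w) > 0" using that s abs_Re_le_cmod[of w] by (simp, linarith)
  qed
  have "continuous_on (ball 0 (min s (r - s))) (\<lambda>w. k (of_real s + w))"
  proof (rule continuous_on_compose2[OF k(1)])
    show "(\<lambda>w. complex_of_real s + w) ` ball 0 (min s (r - s)) \<subseteq> ball 0 r" using sub(1) by blast
  qed (intro continuous_intros)
  moreover have "inj_on (\<lambda>w. k (of_real s + w)) (ball 0 (min s (r - s)))"
  proof (rule inj_onI)
    fix x y assume "x \<in> ball 0 (min s (r - s))" "y \<in> ball 0 (min s (r - s))"
      "k (of_real s + x) = k (of_real s + y)"
    then have "of_real s + x = of_real s + y" using inj_onD[OF k(2)] sub(1) by metis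
    then show "x = y" by simp
  qed
  moreover have "k (of_real s + w) \<in> P \<longleftrightarrow> Im w = 0" if "w \<in> ball 0 (min s (r - s))" for w
    using k(3)[OF sub(1)[OF that]] sub(2)[OF that] by simp
  ultimately show ?thesis using s unfolding arc_chart_def disc_chart_def by simp
qed

lemma quadrant_off_axes:
  assumes "cross_chart P c r k" "v \<in> ball 0 r" "Re v > 0" "Im v > 0"
  shows "k (v * \<i> ^ j) \<notin> P"
  using assms cross_chart_turn[OF assms(1), of j] by (auto simp: cross_chart_def)

lemma connected_quadrant:
  assumes k: "cross_chart P c r k"
  shows "connected ((\<lambda>v. k (v * \<i> ^ j)) ` quadrant r)"
proof (rule connected_continuous_image)
  show "continuous_on (quadrant r) (\<lambda>v. k (v * \<i> ^ j))"
    using cross_chart_turn[OF k, of j] unfolding cross_chart_def disc_chart_def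
    by (blast intro: continuous_on_subset)
  show "connected (quadrant r)"
    by (intro convex_connected convex_Int convex_ball convex_halfspace_Im_gt convex_halfspace_Re_gt)
qed

lemma cross_chart_quadrant:
  assumes k: "cross_chart P c r k" and f: "\<And>w. w \<in> k ` ball 0 r \<Longrightarrow> w \<notin> P \<Longrightarrow> const_near P f w"
    and v: "v \<in> ball 0 r" "Re v > 0" "Im v > 0"
  shows "f (k (v * \<i> ^ j)) = f (quadrant_point k r j)"
proof (rule const_on_connected[OF connected_quadrant[OF k, of j], of P])
  have r: "r > 0" using k by (simp add: cross_chart_def disc_chart_def)
  show "k (v * \<i> ^ j) \<in> (\<lambda>v. k (v * \<i> ^ j)) ` quadrant r"
    using v by blast
  show "quadrant_point k r j \<in> (\<lambda>v. k (v * \<i> ^ j)) ` quadrant r"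
    unfolding quadrant_point_def using r norm_quadrant_point[OF r, of 0]
    by (intro image_eqI[where x = "of_real (r / 2) * (1 + \<i>)"]) auto
  show disj: "(\<lambda>v. k (v * \<i> ^ j)) ` quadrant r \<inter> P = {}"
    using quadrant_off_axes[OF k] by blast
  show "const_near P f w" if w: "w \<in> (\<lambda>v. k (v * \<i> ^ j)) ` quadrant r" for w
  proof (rule f)
    obtain v where v: "v \<in> ball 0 r" "w = k (v * \<i> ^ j)" using w by blast
    show "w \<in> k ` ball 0 r" unfolding v(2) using v(1) by (intro imageI) simp
    show "w \<notin> P" using w disj by blast
  qed
qed

text \<open>Ray \<open>j\<close> is the common border of the quadrants \<open>j\<close> and
  \<open>j - 1\<close>; the latter is written \<open>j + 3\<close> because the indices are natural
  numbers read modulo 4.\<close>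

lemma cross_chart_ray:
  assumes k: "cross_chart P c r k" and f: "\<And>w. w \<in> k ` ball 0 r \<Longrightarrow> w \<notin> P \<Longrightarrow> const_near P f w"
    and s: "0 < s" "s < r"
  shows "const_near P f (k (of_real s * \<i> ^ j)) \<longleftrightarrow>
    f (quadrant_point k r j) = f (quadrant_point k r (j + 3))"
proof -
  let ?k = "\<lambda>w. k (w * \<i> ^ j)"
  let ?e = "min s (r - s)"
  have c: "cross_chart P c r ?k" by (rule cross_chart_turn[OF k])
  have arc: "arc_chart P (?k (of_real s)) ?e (\<lambda>w. ?k (of_real s + w))"
    by (rule ray_chart[OF c s])
  have inb: "complex_of_real s + w \<in> ball 0 r" if "w \<in> ball 0 ?e" for w
    using that s norm_triangle_ineq[of "of_real s" w] by auto
  have cn: "const_near P f w" if w: "w \<in> (\<lambda>w. ?k (of_real s + w)) ` ball 0 ?e" "w \<notin> P" for w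
  proof (rule f)
    obtain u where u: "u \<in> ball 0 ?e" "w = ?k (of_real s + u)" using w(1) by blast
    show "w \<in> k ` ball 0 r"
      unfolding u(2) using inb[OF u(1)] by (intro imageI) (simp add: norm_mult norm_power)
  qed fact
  obtain a b where ab: "chart_sides P ?e (\<lambda>w. ?k (of_real s + w)) f a b"
    using arc_chart_sides[OF arc cn] by metis
  have e: "?e > 0" using s by auto
  let ?u = "Complex 0 (?e/2)"
  have u: "?u \<in> ball 0 ?e" "- ?u \<in> ball 0 ?e" using e by (auto simp: cmod_def)
  have "a = f (?k (of_real s + ?u))" using chart_sidesD(1)[OF ab u(1)] e by simp
  also have "\<dots> = f (quadrant_point k r j)"
    using cross_chart_quadrant[OF k f inb[OF u(1)]] e s by auto
  finally have a: "a = f (quadrant_point k r j)" .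
  \<comment> \<open>A point just below the positive real axis is brought into the first quadrant by
    \<i>, which three further quarter turns undo.\<close>
  have turn: "x * \<i> ^ j = (\<i> * x) * \<i> ^ (j + 3)" for x
  proof -
    have "\<i> ^ (j + 3) = - \<i> * \<i> ^ j" by (simp add: power_add numeral_3_eq_3)
    then have "(\<i> * x) * \<i> ^ (j + 3) = - (\<i> * \<i>) * (x * \<i> ^ j)" by (simp only: mult_ac mult_minus_left mult_minus_right)
    moreover have "- (\<i> * \<i>) = 1" by simp
    ultimately show ?thesis by (simp only: mult_1_left)
  qed
  have "b = f (?k (of_real s + - ?u))" using chart_sidesD(2)[OF ab u(2)] e by simp
  also have "\<dots> = f (quadrant_point k r (j + 3))"
    using inb[OF u(2)] e s by (subst turn, intro cross_chart_quadrant[OF k f]) (auto simp: norm_mult)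
  finally have b: "b = f (quadrant_point k r (j + 3))" .
  show ?thesis using chart_sidesD(3)[OF ab, of 0] e a b by auto
qed

lemma quadrant_point_mod: "quadrant_point k r (j + 4) = quadrant_point k r j"
  by (simp add: quadrant_point_def power_add)

section \<open>Functions with prescribed flips\<close>

lemma const_near_xor: "const_near P (\<lambda>w. f w \<noteq> s) m \<longleftrightarrow> const_near P f m"
proof -
  have "const_near P (\<lambda>w. f w \<noteq> s) m" if cn: "const_near P f m" for f
  proof -
    obtain T u where T: "open T" "m \<in> T" "\<forall>w\<in>T - P. f w = u" using cn unfolding const_near_def by auto
    show ?thesis by (rule const_nearI[OF T(1,2), where s = "u \<noteq> s"]) (use T(3) in auto)
  qed
  from this[of f] this[of "\<lambda>w. f w \<noteq> s"] show ?thesis by (cases s) auto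
qed

text \<open>Separates the planar topology of the projection from its parametrisation. The charts at
  crossings are fixed, so that the corners become functions of the crossing, and
  \<open>isolated\<close> keeps other crossings out of them.\<close>

locale crossed_set =
  fixes P C :: "complex set" and \<rho> :: "complex \<Rightarrow> real" and \<kappa> :: "complex \<Rightarrow> complex \<Rightarrow> complex"
  assumes bounded_P: "bounded P" and closed_P: "closed P" and C_sub: "C \<subseteq> P"
    and arcs: "\<And>m. m \<in> P \<Longrightarrow> m \<notin> C \<Longrightarrow> \<exists>r k. arc_chart P m r k"
    and crosses: "\<And>c. c \<in> C \<Longrightarrow> cross_chart P c (\<rho> c) (\<kappa> c)"
    and isolated: "\<And>c w. c \<in> C \<Longrightarrow> w \<in> ball 0 (\<rho> c) \<Longrightarrow> w \<noteq> 0 \<Longrightarrow> \<kappa> c w \<notin> C"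
begin

lemma \<rho>_pos: "c \<in> C \<Longrightarrow> \<rho> c > 0"
  using crosses by (simp add: cross_chart_def disc_chart_def)

lemma crosses_disc: "c \<in> C \<Longrightarrow> disc_chart c (\<rho> c) (\<kappa> c)"
  using crosses by (simp add: cross_chart_def)

text \<open>Makes the value of a function near a point unambiguous, as two neighbourhoods of a point
  always meet off \<open>P\<close>. The diagonal point of a chart lies off both axes and so serves
  arcs and crossings alike.\<close>

lemma complement_dense:
  assumes T: "open T" "m \<in> T"
  shows "\<exists>w\<in>T. w \<notin> P"
proof (cases "m \<in> P")
  case False
  then show ?thesis using T by blast
next
  case mP: True
  obtain r k where k: "disc_chart m r k" "arc_chart P m r k \<or> cross_chart P m r k"
  proof (cases "m \<in> C")
    case True
    then show thesis using that crosses crosses_disc by metis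
  next
    case False
    then show thesis using that arcs[OF mP] unfolding arc_chart_def by metis
  qed
  obtain s where s: "0 < s" "s \<le> r" "k ` ball 0 s \<subseteq> T" by (rule disc_chart_small[OF k(1) T])
  let ?u = "of_real (s / 2) * (1 + \<i>)"
  have u: "?u \<in> ball 0 s" using norm_quadrant_point[OF s(1), of 0] by simp
  moreover have "?u \<in> ball 0 r" using u s(2) by simp
  ultimately have "k ?u \<in> T" "k ?u \<notin> P"
    using s k(2) unfolding arc_chart_def cross_chart_def by auto
  then show ?thesis by blast
qed

text \<open>The difference of two functions with the same flips extends over \<open>P\<close>. On an
  arc the flips cancel. At a crossing, points of the four rays lie on arcs, so neighbouring
  quadrants agree across each ray and all four values coincide.\<close>

lemma xor_const_near:
  assumes U: "open U" "m \<in> U"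
    and f: "\<And>w. w \<in> U \<Longrightarrow> w \<notin> P \<Longrightarrow> const_near P f w"
    and g: "\<And>w. w \<in> U \<Longrightarrow> w \<notin> P \<Longrightarrow> const_near P g w"
    and fg: "\<And>w. w \<in> U \<Longrightarrow> w \<in> P \<Longrightarrow> w \<notin> C \<Longrightarrow> const_near P f w \<longleftrightarrow> const_near P g w"
  shows "const_near P (\<lambda>w. f w \<noteq> g w) m"
proof -
  let ?h = "\<lambda>w. f w \<noteq> g w"
  have off: "const_near P ?h w" if w: "w \<in> U" "w \<notin> P" for w
  proof -
    obtain S a where S: "open S" "w \<in> S" "\<And>v. v \<in> S \<Longrightarrow> v \<notin> P \<Longrightarrow> f v = a"
      using const_near_mono[OF f[OF w] U(1) w(1)] by metis
    obtain T b where T: "open T" "w \<in> T" "\<And>v. v \<in> T \<Longrightarrow> v \<notin> P \<Longrightarrow> g v = b"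
      using const_near_mono[OF g[OF w] U(1) w(1)] by metis
    show ?thesis
      by (rule const_nearI[where T = "S \<inter> T" and s = "a \<noteq> b"]) (use S T in auto)
  qed
  have arc: "const_near P ?h w" if w: "w \<in> U" "w \<in> P" "w \<notin> C" for w
  proof -
    obtain r0 k where k0: "arc_chart P w r0 k" using arcs w by metis
    then have "disc_chart w r0 k" by (simp add: arc_chart_def)
    then obtain r where r: "0 < r" "r \<le> r0" "k ` ball 0 r \<subseteq> U" by (rule disc_chart_small[OF _ U(1) w(1)])
    have k: "arc_chart P w r k" by (rule arc_chart_mono[OF k0 r(1,2)])
    have dk: "disc_chart w r k" and kP: "\<And>v. v \<in> ball 0 r \<Longrightarrow> k v \<in> P \<longleftrightarrow> Im v = 0"
      using k by (auto simp: arc_chart_def)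
    obtain a b where ab: "chart_sides P r k f a b"
      using arc_chart_sides[OF k, of f] f r(3) by blast
    obtain a' b' where ab': "chart_sides P r k g a' b'"
      using arc_chart_sides[OF k, of g] g r(3) by blast
    have k0: "k 0 = w" using dk by (simp add: disc_chart_def)
    have "0 \<in> ball (0::complex) r" using r by simp
    then have eq: "a = b \<longleftrightarrow> a' = b'"
      using chart_sidesD(3)[OF ab, of 0] chart_sidesD(3)[OF ab', of 0] fg[OF w] k0 by simp
    show ?thesis
    proof (rule const_nearI[where s = "a \<noteq> a'"])
      show "open (k ` ball 0 r)" using open_chart_image[OF dk] by auto
      show "w \<in> k ` ball 0 r" using \<open>0 \<in> ball 0 r\<close> k0 by (metis imageI)
      fix v assume v: "v \<in> k ` ball 0 r" "v \<notin> P"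
      then obtain u where u: "u \<in> ball 0 r" "v = k u" by blast
      then have "Im u \<noteq> 0" using v kP by blast
      then show "?h v = (a \<noteq> a')"
        using chart_sidesD[OF ab u(1)] chart_sidesD[OF ab' u(1)] u(2) eq by (cases "Im u > 0") auto
    qed
  qed
  consider "m \<notin> P" | "m \<in> P" "m \<notin> C" | "m \<in> C" by blast
  then show ?thesis
  proof cases
    case 1 then show ?thesis using off U by simp
  next
    case 2 then show ?thesis using arc U by simp
  next
    case 3
    obtain r where r: "0 < r" "r \<le> \<rho> m" "\<kappa> m ` ball 0 r \<subseteq> U"
      by (rule disc_chart_small[OF crosses_disc[OF 3] U])
    define k where "k = \<kappa> m"
    have k: "cross_chart P m r k" unfolding k_def by (rule cross_chart_mono[OF crosses[OF 3] r(1,2)])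
    have dk: "disc_chart m r k" and kP: "\<And>v. v \<in> ball 0 r \<Longrightarrow> k v \<in> P \<longleftrightarrow> Re v = 0 \<or> Im v = 0"
      using k by (auto simp: cross_chart_def)
    have h: "const_near P ?h w" if "w \<in> k ` ball 0 r" "w \<notin> P" for w
      using off that r(3) unfolding k_def by blast
    have step: "?h (quadrant_point k r j) = ?h (quadrant_point k r (j + 3))" for j
    proof -
      let ?u = "of_real (r/2) * \<i> ^ j"
      have u: "?u \<in> ball 0 r" "?u \<noteq> 0" using r(1) by (auto simp: norm_mult norm_power)
      have "Re ?u = 0 \<or> Im ?u = 0" using i_power_axes[of "of_real (r/2)" j] by simp
      then have "k ?u \<in> P" using kP u by blast
      moreover have "?u \<in> ball 0 (\<rho> m)" using u(1) r(2) by simp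
      then have "k ?u \<notin> C" unfolding k_def using isolated 3 u(2) by blast
      moreover have "k ?u \<in> U" using u(1) r(3) k_def by blast
      ultimately have "const_near P ?h (k ?u)" using arc by blast
      then show ?thesis using cross_chart_ray[OF k h, of "r/2" j] r(1) by simp
    qed
    define s where "s = ?h (quadrant_point k r 0)"
    have all: "?h (quadrant_point k r j) = s" if "j < 4" for j
    proof -
      have "?h (quadrant_point k r 3) = s" using step[of 0] s_def by simp
      moreover have "?h (quadrant_point k r 1) = s"
        using step[of 1] quadrant_point_mod[of k r 0] s_def by simp
      moreover from this have "?h (quadrant_point k r 2) = s"
        using step[of 2] quadrant_point_mod[of k r 1] by (simp add: numeral_eq_Suc)
      moreover have "j = 0 \<or> j = 1 \<or> j = 2 \<or> j = 3" using that by linarith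
      ultimately show ?thesis using s_def by metis
    qed
    show ?thesis
    proof (rule const_nearI[where s = s])
      show "open (k ` ball 0 r)" using open_chart_image[OF dk] by auto
      have "k 0 = m" using dk by (simp add: disc_chart_def)
      then show "m \<in> k ` ball 0 r" using r(1) by (metis centre_in_ball imageI)
      fix v assume v: "v \<in> k ` ball 0 r" "v \<notin> P"
      then obtain u where u: "u \<in> ball 0 r" "v = k u" by blast
      then have "Re u \<noteq> 0" "Im u \<noteq> 0" using v kP by blast+
      then obtain j u' where j: "j < 4" "u = u' * \<i> ^ j" "Re u' > 0" "Im u' > 0" by (rule quarter_turn)
      have "u' \<in> ball 0 r" using u(1) j(2) by (simp add: norm_mult norm_power)
      then have "?h v = ?h (quadrant_point k r j)"
        using cross_chart_quadrant[OF k h] j u(2) by blast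
      then show "?h v = s" using all[OF j(1)] by simp
    qed
  qed
qed

text \<open>\<open>X\<close> marks the arcs across which \<open>f\<close> has to flip.\<close>

definition flips_along :: "(complex \<Rightarrow> bool) \<Rightarrow> complex set \<Rightarrow> (complex \<Rightarrow> bool) \<Rightarrow> bool" where
  "flips_along X U f \<longleftrightarrow> (\<forall>w\<in>U. (w \<notin> P \<longrightarrow> const_near P f w) \<and>
     (w \<in> P \<longrightarrow> w \<notin> C \<longrightarrow> (const_near P f w \<longleftrightarrow> \<not> X w)))"

text \<open>The solution lives on an open neighbourhood, so that \<open>S\<close> can be a closed
  set such as a box and two solutions still overlap near a common edge.\<close>

definition solvable :: "(complex \<Rightarrow> bool) \<Rightarrow> complex set \<Rightarrow> bool" where
  "solvable X S \<longleftrightarrow> (\<exists>U f. open U \<and> S \<subseteq> U \<and> flips_along X U f)"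

lemma solvable_mono: "solvable X S \<Longrightarrow> T \<subseteq> S \<Longrightarrow> solvable X T"
  unfolding solvable_def by (meson subset_trans)

lemma flips_along_cong:
  assumes "open U" "\<And>w. w \<in> U \<Longrightarrow> w \<notin> P \<Longrightarrow> f w = g w" "flips_along X U f"
  shows "flips_along X U g"
proof -
  have "const_near P f w \<longleftrightarrow> const_near P g w" if "w \<in> U" for w
    using const_near_cong[OF assms(1) that assms(2)] .
  then show ?thesis using assms(3) unfolding flips_along_def by simp
qed

lemma flips_along_mono: "flips_along X U f \<Longrightarrow> V \<subseteq> U \<Longrightarrow> flips_along X V f"
  unfolding flips_along_def by blast

lemma flips_along_Un: "flips_along X U f \<Longrightarrow> flips_along X V f \<Longrightarrow> flips_along X (U \<union> V) f"
  unfolding flips_along_def by blast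

text \<open>Uniqueness up to negation: the difference is locally constant, so connectedness of
  \<open>J\<close> leaves a single constant. The open set \<open>O1\<close> around \<open>J\<close>
  gives the room for patching.\<close>

lemma flips_along_compare:
  assumes U: "open U" "flips_along X U f" "flips_along X U g" and J: "connected J" "J \<subseteq> U"
  obtains O1 s where "open O1" "J \<subseteq> O1" "O1 \<subseteq> U" "\<And>w. w \<in> O1 \<Longrightarrow> w \<notin> P \<Longrightarrow> f w = (g w \<noteq> s)"
proof -
  \<comment> \<open>Everywhere the difference is known to be \<open>s\<close>. The two sets are
    disjoint because the complement of \<open>P\<close> is dense.\<close>
  define W where "W s = \<Union>{T. open T \<and> T \<subseteq> U \<and> (\<forall>w\<in>T - P. (f w \<noteq> g w) = s)}" for s
  have op: "open (W s)" for s unfolding W_def by (rule open_Union) simp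
  have WU: "W s \<subseteq> U" for s unfolding W_def by blast
  have val: "(f w \<noteq> g w) = s" if "w \<in> W s" "w \<notin> P" for w s using that unfolding W_def by blast
  have disj: "W True \<inter> W False = {}"
  proof (rule ccontr)
    assume "W True \<inter> W False \<noteq> {}"
    then obtain m where "m \<in> W True \<inter> W False" by blast
    then obtain w where "w \<in> W True \<inter> W False" "w \<notin> P"
      using complement_dense[of "W True \<inter> W False" m] op by blast
    then show False using val[of w True] val[of w False] by simp
  qed
  have cover: "J \<subseteq> W True \<union> W False"
  proof
    fix m assume "m \<in> J"
    then have m: "m \<in> U" using J by blast
    have "const_near P (\<lambda>w. f w \<noteq> g w) m"
      using U by (intro xor_const_near[OF U(1) m]) (auto simp: flips_along_def)
    then obtain T s where T: "open T" "m \<in> T" "T \<subseteq> U" "\<And>w. w \<in> T \<Longrightarrow> w \<notin> P \<Longrightarrow> (f w \<noteq> g w) = s"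
      by (rule const_near_mono[OF _ U(1) m]) metis
    then have "m \<in> W s" unfolding W_def by blast
    then show "m \<in> W True \<union> W False" by (cases s) auto
  qed
  have "W True \<inter> J = {} \<or> W False \<inter> J = {}"
    using connectedD[OF J(1) op op] disj cover by blast
  then have "\<exists>s. J \<subseteq> W s" using cover by blast
  then obtain s where "J \<subseteq> W s" by blast
  then show thesis using op WU val by (intro that[of "W s" s]) metis+
qed

text \<open>Negate the second solution if necessary, so that it agrees with the first near the
  interface \<open>J\<close>, and use one on each side of the level \<open>t\<close> of
  \<open>\<phi>\<close>. A connected interface leaves only one constant to adjust.\<close>

lemma solvable_glue:
  fixes \<phi> :: "complex \<Rightarrow> real"
  assumes S: "solvable X S1" "solvable X S2" and \<phi>: "continuous_on UNIV \<phi>"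
    and le: "\<And>z. z \<in> S1 \<Longrightarrow> \<phi> z \<le> t" and ge: "\<And>z. z \<in> S2 \<Longrightarrow> t \<le> \<phi> z"
    and J: "connected J" "J \<subseteq> S1 \<inter> S2" "\<And>z. z \<in> S1 \<union> S2 \<Longrightarrow> \<phi> z = t \<Longrightarrow> z \<in> J"
  shows "solvable X (S1 \<union> S2)"
proof -
  obtain U1 f1 where 1: "open U1" "S1 \<subseteq> U1" "flips_along X U1 f1" using S by (auto simp: solvable_def)
  obtain U2 f2 where 2: "open U2" "S2 \<subseteq> U2" "flips_along X U2 f2" using S by (auto simp: solvable_def)
  have "open (U1 \<inter> U2)" "J \<subseteq> U1 \<inter> U2" using 1 2 J by auto
  then obtain O1 s where O1: "open O1" "J \<subseteq> O1" "O1 \<subseteq> U1 \<inter> U2"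
    "\<And>w. w \<in> O1 \<Longrightarrow> w \<notin> P \<Longrightarrow> f1 w = (f2 w \<noteq> s)"
    using flips_along_compare[OF _ flips_along_mono[OF 1(3)] flips_along_mono[OF 2(3)] J(1), of "U1 \<inter> U2"]
    by (metis inf_le1 inf_le2)
  define g where "g = (\<lambda>w. if \<phi> w \<le> t then f1 w else (f2 w \<noteq> s))"
  let ?V1 = "U1 \<inter> {z. \<phi> z < t}" and ?V2 = "U2 \<inter> {z. t < \<phi> z}"
  have op: "open ?V1" "open ?V2"
    using 1(1) 2(1) \<phi> by (auto intro!: open_Int open_Collect_less continuous_intros)
  have "flips_along X ?V1 g"
    by (rule flips_along_cong[OF op(1) _ flips_along_mono[OF 1(3)]]) (auto simp: g_def)
  moreover have "flips_along X U2 (\<lambda>w. f2 w \<noteq> s)"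
    using 2(3) by (simp only: flips_along_def const_near_xor)
  then have "flips_along X ?V2 (\<lambda>w. f2 w \<noteq> s)" by (rule flips_along_mono) blast
  then have "flips_along X ?V2 g"
    by (rule flips_along_cong[OF op(2), rotated]) (auto simp: g_def)
  moreover have "flips_along X O1 f1" by (rule flips_along_mono[OF 1(3)]) (use O1(3) in blast)
  then have "flips_along X O1 g"
    by (rule flips_along_cong[OF O1(1), rotated]) (use O1(4) in \<open>auto simp: g_def\<close>)
  ultimately have "flips_along X (?V1 \<union> ?V2 \<union> O1) g" by (intro flips_along_Un)
  moreover have "open (?V1 \<union> ?V2 \<union> O1)" using op O1(1) by blast
  moreover have "S1 \<union> S2 \<subseteq> ?V1 \<union> ?V2 \<union> O1"
  proof
    fix z assume z: "z \<in> S1 \<union> S2"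
    show "z \<in> ?V1 \<union> ?V2 \<union> O1"
    proof (cases "\<phi> z = t")
      case True
      then show ?thesis using J(3)[OF z] O1(2) by blast
    next
      case False
      then show ?thesis using z le[of z] ge[of z] 1(2) 2(2) by force
    qed
  qed
  ultimately show ?thesis unfolding solvable_def by blast
qed

text \<open>The \<open>Bolzano\<close> bisection rule is used once per coordinate: from points to
  vertical segments, and from segments to boxes. The interfaces are a point and a vertical segment,
  both connected.\<close>

lemma solvable_box:
  assumes loc: "\<And>m. \<exists>T. open T \<and> m \<in> T \<and> solvable X T"
  shows "solvable X (cbox (Complex a c) (Complex b d))"
proof -
  have seg: "solvable X (cbox (Complex x c) (Complex x d))" if "c \<le> d" for x c d
    using that
  proof (induction c d rule: Bolzano)
    case (trans c e d)
    have "solvable X (cbox (Complex x c) (Complex x e) \<union> cbox (Complex x e) (Complex x d))"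
    proof (rule solvable_glue[where \<phi> = Im and t = e and J = "cbox (Complex x e) (Complex x e)"])
      show "connected (cbox (Complex x e) (Complex x e))" by (intro convex_connected convex_box)
    qed (use trans in \<open>auto simp: in_cbox_complex_iff intro!: continuous_intros\<close>)
    then show ?case
      by (rule solvable_mono) (auto simp: in_cbox_complex_iff)
  next
    case (local y)
    obtain T where T: "open T" "Complex x y \<in> T" "solvable X T" using loc by blast
    then obtain e where e: "e > 0" "ball (Complex x y) e \<subseteq> T" using open_contains_ball by blast
    have "solvable X (cbox (Complex x a) (Complex x b))" if "a \<le> y \<and> y \<le> b \<and> b - a < e" for a b
    proof (rule solvable_mono[OF T(3)])
      have "z \<in> ball (Complex x y) e" if "z \<in> cbox (Complex x a) (Complex x b)" for z
      proof -
        have "Re z = x" "\<bar>y - Im z\<bar> < e" using that \<open>a \<le> y \<and> y \<le> b \<and> b - a < e\<close>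
          by (auto simp: in_cbox_complex_iff abs_if)
        then show ?thesis by (simp add: dist_norm cmod_def)
      qed
      then show "cbox (Complex x a) (Complex x b) \<subseteq> T" using e by blast
    qed
    then show ?case using e(1) by blast
  qed
  have "solvable X (cbox (Complex a c) (Complex b d))" if "a \<le> b" and cd: "c \<le> d"
    using \<open>a \<le> b\<close>
  proof (induction a b rule: Bolzano)
    case (trans a e b)
    have "solvable X (cbox (Complex a c) (Complex e d) \<union> cbox (Complex e c) (Complex b d))"
    proof (rule solvable_glue[where \<phi> = Re and t = e and J = "cbox (Complex e c) (Complex e d)"])
      show "connected (cbox (Complex e c) (Complex e d))" by (intro convex_connected convex_box)
    qed (use trans in \<open>auto simp: in_cbox_complex_iff intro!: continuous_intros\<close>)
    then show ?case
      by (rule solvable_mono) (auto simp: in_cbox_complex_iff)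
  next
    \<comment> \<open>A neighbourhood of a vertical segment contains a thin slab around it, by
      compactness of the segment.\<close>
    case (local x)
    obtain U f where U: "open U" "cbox (Complex x c) (Complex x d) \<subseteq> U" "flips_along X U f"
      using seg[OF cd, of x] unfolding solvable_def by blast
    obtain e where e: "e > 0" "(\<Union>z\<in>cbox (Complex x c) (Complex x d). ball z e) \<subseteq> U"
      using compact_subset_open_imp_ball_epsilon_subset[OF compact_cbox U(1,2)] by metis
    have "solvable X (cbox (Complex a c) (Complex b d))" if ab: "a \<le> x \<and> x \<le> b \<and> b - a < e" for a b
    proof -
      have "z \<in> U" if "z \<in> cbox (Complex a c) (Complex b d)" for z
      proof -
        have "Complex x (Im z) \<in> cbox (Complex x c) (Complex x d)" using that by (simp add: in_cbox_complex_iff)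
        moreover have "\<bar>x - Re z\<bar> < e" using that ab by (auto simp: in_cbox_complex_iff abs_if)
        then have "z \<in> ball (Complex x (Im z)) e" by (simp add: dist_norm cmod_def)
        ultimately show ?thesis using e(2) by blast
      qed
      then show ?thesis using U unfolding solvable_def by blast
    qed
    then show ?case using e(1) by blast
  qed
  moreover have "solvable X {}" unfolding solvable_def flips_along_def by blast
  moreover have "cbox (Complex a c) (Complex b d) = {}" if "\<not> (a \<le> b \<and> c \<le> d)"
    using that by (auto simp: in_cbox_complex_iff)
  ultimately show ?thesis by (cases "a \<le> b \<and> c \<le> d") auto
qed

text \<open>Far out there is nothing to flip, so a constant is a solution outside a disc that
  contains \<open>P\<close>. It is glued to a solution on the disc along a circle, which is
  connected.\<close>

lemma solvable_UNIV:
  assumes loc: "\<And>m. \<exists>T. open T \<and> m \<in> T \<and> solvable X T"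
  shows "solvable X UNIV"
proof -
  obtain e where e: "e > 0" "P \<subseteq> ball 0 e" using bounded_subset_ballD[OF bounded_P] by blast
  \<comment> \<open>Larger than \<open>e\<close>, so that the closed outer part has an open
    neighbourhood missing \<open>P\<close>.\<close>
  define r where "r = e + 1"
  have "cball 0 r \<subseteq> cbox (Complex (-r) (-r)) (Complex r r)"
    by (auto simp: in_cbox_complex_iff) (meson abs_Re_le_cmod abs_Im_le_cmod abs_le_D1 abs_le_D2 minus_le_iff order_trans)+
  then have 1: "solvable X (cball 0 r)" using solvable_mono[OF solvable_box[OF loc]] by blast
  have "flips_along X (- cball 0 e) (\<lambda>_. False)"
  proof -
    have "w \<notin> P" if "w \<in> - cball 0 e" for w using that e(2) ball_subset_cball by blast
    moreover have "const_near P (\<lambda>_. False) w" for w by (rule const_nearI[of UNIV _ _ _ False]) auto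
    ultimately show ?thesis unfolding flips_along_def by blast
  qed
  moreover have "- ball 0 r \<subseteq> - cball (0::complex) e" by (auto simp: r_def)
  ultimately have 2: "solvable X (- ball 0 r)" unfolding solvable_def by (meson closed_cball open_Compl)
  have "solvable X (cball 0 r \<union> - ball 0 r)"
  proof (rule solvable_glue[OF 1 2, where \<phi> = norm and t = r and J = "sphere 0 r"])
    show "connected (sphere (0::complex) r)" by (rule connected_sphere) simp
  qed (auto intro: continuous_on_norm_id)
  moreover have "cball 0 r \<union> - ball 0 r = (UNIV :: complex set)" by auto
  ultimately show ?thesis by simp
qed

end

section \<open>Local solutions off the projection, on arcs and at crossings\<close>

lemma axis_point:
  fixes w :: complex
  assumes "w \<noteq> 0" "Re w = 0 \<or> Im w = 0"
  obtains j s where "j < 4" "0 < s" "w = of_real s * \<i> ^ j"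
proof -
  consider "Re w > 0" "Im w = 0" | "Re w = 0" "Im w > 0" | "Re w < 0" "Im w = 0" | "Re w = 0" "Im w < 0"
    using assms by (metis complex_eqI linorder_neqE_linordered_idom zero_complex.sel)
  then show ?thesis
  proof cases
    case 1 then show ?thesis by (intro that[of 0 "Re w"]) (auto simp: complex_eq_iff)
  next
    case 2 then show ?thesis by (intro that[of 1 "Im w"]) (auto simp: complex_eq_iff)
  next
    case 3 then show ?thesis by (intro that[of 2 "- Re w"]) (auto simp: complex_eq_iff)
  next
    case 4 then show ?thesis by (intro that[of 3 "- Im w"]) (auto simp: complex_eq_iff numeral_3_eq_3)
  qed
qed

context crossed_set
begin

lemma solvable_off:
  assumes "m \<notin> P"
  shows "\<exists>T. open T \<and> m \<in> T \<and> solvable X T"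
proof -
  have "flips_along X (- P) (\<lambda>_. False)"
    unfolding flips_along_def by (auto intro: const_nearI[of UNIV _ _ _ False])
  then have "solvable X (- P)" unfolding solvable_def using closed_P by blast
  then show ?thesis using closed_P assms by blast
qed

lemma solvable_arc:
  assumes m: "m \<in> P" "m \<notin> C"
    and X: "open V" "m \<in> V" "\<And>m'. m' \<in> V \<Longrightarrow> m' \<in> P \<Longrightarrow> m' \<notin> C \<Longrightarrow> X m' = X m"
  shows "\<exists>T. open T \<and> m \<in> T \<and> solvable X T"
proof -
  obtain r0 k where k0: "arc_chart P m r0 k" using arcs m by metis
  then have "disc_chart m r0 k" by (simp add: arc_chart_def)
  then obtain r where r: "0 < r" "r \<le> r0" "k ` ball 0 r \<subseteq> V" by (rule disc_chart_small[OF _ X(1,2)])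
  have k: "arc_chart P m r k" by (rule arc_chart_mono[OF k0 r(1,2)])
  have dk: "disc_chart m r k" and kP: "\<And>v. v \<in> ball 0 r \<Longrightarrow> k v \<in> P \<longleftrightarrow> Im v = 0"
    using k by (auto simp: arc_chart_def)
  have inj: "inj_on k (ball 0 r)" and k0: "k 0 = m" using dk by (auto simp: disc_chart_def)
  define N where "N = k ` ball 0 r"
  have N: "open N" "m \<in> N"
    using open_chart_image[OF dk, of "ball 0 r"] r(1) k0 unfolding N_def by (auto intro: image_eqI[of _ _ 0])
  \<comment> \<open>The upper side gets the mark of the arc and the lower side gets False, so the
    two differ iff the arc is marked.\<close>
  define f where "f z \<longleftrightarrow> X m \<and> Im (inv_into (ball 0 r) k z) > 0" for z
  have fk: "f (k v) \<longleftrightarrow> X m \<and> Im v > 0" if "v \<in> ball 0 r" for v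
    unfolding f_def using inv_into_f_f[OF inj that] by simp
  have off: "const_near P f z" if z: "z \<in> N" "z \<notin> P" for z
  proof -
    obtain v where v: "v \<in> ball 0 r" "z = k v" using z unfolding N_def by blast
    then have "Im v \<noteq> 0" using kP z by blast
    show ?thesis unfolding v(2)
    proof (rule const_near_chart[OF dk])
      let ?S = "ball 0 r \<inter> {u. 0 < Im u * Im v}"
      show "open ?S" by (intro open_Int open_ball open_Collect_less continuous_intros)
      show "v \<in> ?S" using v \<open>Im v \<noteq> 0\<close> by (auto simp: zero_less_mult_iff)
      fix u assume u: "u \<in> ?S"
      then show "f (k u) = f (k v)" using fk v by (simp add: zero_less_mult_iff) linarith
    qed blast
  qed
  obtain a b where ab: "chart_sides P r k f a b"
    using arc_chart_sides[OF k, of f] off unfolding N_def by blast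
  have p: "Complex 0 (r/2) \<in> ball 0 r" "Complex 0 (-r/2) \<in> ball 0 r" using r(1) by (auto simp: cmod_def)
  have "a = X m" "b = False"
    using chart_sidesD(1)[OF ab p(1)] chart_sidesD(2)[OF ab p(2)] fk[OF p(1)] fk[OF p(2)] r(1) by auto
  then have on: "const_near P f z \<longleftrightarrow> \<not> X z" if z: "z \<in> N" "z \<in> P" "z \<notin> C" for z
  proof -
    obtain v where v: "v \<in> ball 0 r" "z = k v" using z unfolding N_def by blast
    have "X z = X m" using X(3) z r(3) unfolding N_def by blast
    moreover have "Im v = 0" using kP v z by blast
    ultimately show ?thesis using chart_sidesD(3)[OF ab v(1)] v(2) \<open>a = X m\<close> \<open>b = False\<close> by simp
  qed
  have "flips_along X N f" using off on unfolding flips_along_def by blast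
  then show ?thesis using N unfolding solvable_def by blast
qed

text \<open>Here \<open>x j\<close> is the mark of ray \<open>j\<close>. Going once around the
  crossing must return to the starting value, so the four marks have to sum to zero modulo 2, which
  is \<open>even_x\<close>.\<close>

lemma solvable_crossing:
  fixes x :: "nat \<Rightarrow> bool"
  assumes c: "c \<in> C" and t: "0 < t"
    and X: "\<And>j s. 0 < s \<Longrightarrow> s < t \<Longrightarrow> X (\<kappa> c (of_real s * \<i> ^ j)) = x j"
    and even_x: "(x 0 \<noteq> x 2) \<longleftrightarrow> (x 1 \<noteq> x 3)"
  shows "\<exists>T. open T \<and> c \<in> T \<and> solvable X T"
proof -
  define k where "k = \<kappa> c"
  define r where "r = min t (\<rho> c)"
  have r: "0 < r" "r \<le> \<rho> c" "r \<le> t" using t \<rho>_pos[OF c] by (auto simp: r_def)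
  have k: "cross_chart P c r k" unfolding k_def by (rule cross_chart_mono[OF crosses[OF c] r(1,2)])
  have dk: "disc_chart c r k" and kP: "\<And>v. v \<in> ball 0 r \<Longrightarrow> k v \<in> P \<longleftrightarrow> Re v = 0 \<or> Im v = 0"
    using k by (auto simp: cross_chart_def)
  have inj: "inj_on k (ball 0 r)" and k0: "k 0 = c" using dk by (auto simp: disc_chart_def)
  define N where "N = k ` ball 0 r"
  have N: "open N" "c \<in> N"
    using open_chart_image[OF dk, of "ball 0 r"] r(1) k0 unfolding N_def by (auto intro: image_eqI[of _ _ 0])
  \<comment> \<open>Partial sums modulo 2: the quadrants 0 to 3 get 0, \<open>x 1\<close>,
    \<open>x 1 + x 2\<close> and \<open>x 1 + x 2 + x 3\<close>. By \<open>even_x\<close> the last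
    value is \<open>x 0\<close>, as crossing ray 0 demands.\<close>
  define \<phi> where "\<phi> v = (if Re v > 0 then Im v < 0 \<and> ((x 1 \<noteq> x 2) \<noteq> x 3)
      else if Im v > 0 then x 1 else (x 1 \<noteq> x 2))" for v
  define f where "f z \<longleftrightarrow> \<phi> (inv_into (ball 0 r) k z)" for z
  have fk: "f (k v) \<longleftrightarrow> \<phi> v" if "v \<in> ball 0 r" for v
    unfolding f_def using inv_into_f_f[OF inj that] by simp
  have off: "const_near P f z" if z: "z \<in> N" "z \<notin> P" for z
  proof -
    obtain v where v: "v \<in> ball 0 r" "z = k v" using z unfolding N_def by blast
    then have nz: "Re v \<noteq> 0" "Im v \<noteq> 0" using kP z by blast+
    show ?thesis unfolding v(2)
    proof (rule const_near_chart[OF dk])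
      let ?S = "ball 0 r \<inter> {u. 0 < Re u * Re v} \<inter> {u. 0 < Im u * Im v}"
      show "open ?S" by (intro open_Int open_ball open_Collect_less continuous_intros)
      show "v \<in> ?S" using v nz by (auto simp: zero_less_mult_iff)
      fix u assume u: "u \<in> ?S"
      then have "Re u > 0 \<longleftrightarrow> Re v > 0" "Im u > 0 \<longleftrightarrow> Im v > 0" "Im u < 0 \<longleftrightarrow> Im v < 0"
        by (auto simp: zero_less_mult_iff)
      moreover have "u \<in> ball 0 r" using u by blast
      ultimately show "f (k u) = f (k v)" using fk v(1) by (simp add: \<phi>_def)
    qed blast
  qed
  then have h: "const_near P f z" if "z \<in> k ` ball 0 r" "z \<notin> P" for z using that unfolding N_def by blast
  have fq: "f (quadrant_point k r j) = \<phi> (of_real (r / 2) * (1 + \<i>) * \<i> ^ j)" for j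
    unfolding quadrant_point_def by (rule fk) (use norm_quadrant_point[OF r(1), of j] in simp)
  have q: "f (quadrant_point k r 0) = False" "f (quadrant_point k r 1) = x 1"
    "f (quadrant_point k r 2) = (x 1 \<noteq> x 2)" "f (quadrant_point k r 3) = ((x 1 \<noteq> x 2) \<noteq> x 3)"
    unfolding fq \<phi>_def using r(1) by (simp_all add: numeral_3_eq_3)
  have qq: "f (quadrant_point k r j) = f (quadrant_point k r (j + 3)) \<longleftrightarrow> \<not> x j" if "j < 4" for j
  proof -
    have m: "quadrant_point k r 4 = quadrant_point k r 0" "quadrant_point k r 5 = quadrant_point k r 1"
      "quadrant_point k r 6 = quadrant_point k r 2"
      using quadrant_point_mod[of k r 0] quadrant_point_mod[of k r 1] quadrant_point_mod[of k r 2] by simp_all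
    have "j = 0 \<or> j = 1 \<or> j = 2 \<or> j = 3" using that by linarith
    then show ?thesis using q m even_x by (elim disjE) (simp_all del: One_nat_def, auto)
  qed
  have on: "const_near P f z \<longleftrightarrow> \<not> X z" if z: "z \<in> N" "z \<in> P" "z \<notin> C" for z
  proof -
    obtain v where v: "v \<in> ball 0 r" "z = k v" using z unfolding N_def by blast
    have "v \<noteq> 0" using k0 v z c by blast
    moreover have "Re v = 0 \<or> Im v = 0" using kP v z by blast
    ultimately obtain j s where js: "j < 4" "0 < s" "v = of_real s * \<i> ^ j"
      by (rule axis_point)
    have "s < r" using v(1) js by (simp add: norm_mult norm_power)
    have "X z = x j" using X[OF js(2), of j] \<open>s < r\<close> r(3) v(2) js(3) unfolding k_def by simp
    moreover have "const_near P f (k (of_real s * \<i> ^ j)) \<longleftrightarrow> \<not> x j"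
      using cross_chart_ray[OF k h js(2) \<open>s < r\<close>] qq[OF js(1)] by blast
    ultimately show ?thesis using v js by simp
  qed
  have "flips_along X N f" using off on unfolding flips_along_def by blast
  then show ?thesis using N unfolding solvable_def by blast
qed

text \<open>Vanishing of the first cohomology of the plane modulo 2: a marking that is locally
  constant along arcs and even at every crossing has a potential.\<close>

theorem ex_flips_along:
  assumes "\<And>m. m \<in> P \<Longrightarrow> m \<notin> C \<Longrightarrow>
      \<exists>T. open T \<and> m \<in> T \<and> (\<forall>m'\<in>T. m' \<in> P \<longrightarrow> m' \<notin> C \<longrightarrow> X m' = X m)"
    and "\<And>c. c \<in> C \<Longrightarrow> \<exists>t x. 0 < t \<and> (\<forall>j s. 0 < s \<and> s < t \<longrightarrow> X (\<kappa> c (of_real s * \<i> ^ j)) = x j) \<and>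
        (x 0 \<noteq> x 2 \<longleftrightarrow> x 1 \<noteq> x (3::nat))"
  shows "\<exists>f. flips_along X UNIV f"
proof -
  have "solvable X UNIV"
  proof (rule solvable_UNIV)
    fix m
    consider "m \<notin> P" | "m \<in> P" "m \<notin> C" | "m \<in> C" by blast
    then show "\<exists>T. open T \<and> m \<in> T \<and> solvable X T"
    proof cases
      case 1 then show ?thesis by (rule solvable_off)
    next
      case 2
      obtain V where V: "open V" "m \<in> V" "\<forall>m'\<in>V. m' \<in> P \<longrightarrow> m' \<notin> C \<longrightarrow> X m' = X m"
        using assms(1)[OF 2] by blast
      show ?thesis by (rule solvable_arc[OF 2 V(1,2)]) (use V(3) in blast)
    next
      case 3
      obtain t x where t: "0 < t" "\<forall>j s. 0 < s \<and> s < t \<longrightarrow> X (\<kappa> m (of_real s * \<i> ^ j)) = x j"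
        "x 0 \<noteq> x 2 \<longleftrightarrow> x 1 \<noteq> x (3::nat)" using assms(2)[OF 3] by blast
      show ?thesis by (rule solvable_crossing[OF 3 t(1) _ t(3)]) (use t(2) in blast)
    qed
  qed
  then obtain U f where "UNIV \<subseteq> U" "flips_along X U f" unfolding solvable_def by blast
  then show ?thesis using top.extremum_uniqueI by metis
qed

section \<open>Corners, boundaries of regions and indicator functions\<close>

definition corner :: "complex \<Rightarrow> nat \<Rightarrow> complex" where
  "corner c j = quadrant_point (\<kappa> c) (\<rho> c) j"

lemma corner_mod: "corner c (j + 4) = corner c j"
  by (simp add: corner_def quadrant_point_mod)

lemma corner_off: "c \<in> C \<Longrightarrow> corner c j \<notin> P"
proof -
  assume c: "c \<in> C"
  have "of_real (\<rho> c / 2) * (1 + \<i>) \<in> ball 0 (\<rho> c)"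
    using norm_quadrant_point[OF \<rho>_pos[OF c], of 0] by simp
  then show ?thesis unfolding corner_def quadrant_point_def
    by (rule quadrant_off_axes[OF crosses[OF c]]) (use \<rho>_pos[OF c] in simp_all)
qed

lemma const_near_ray:
  assumes "c \<in> C" "\<And>w. w \<notin> P \<Longrightarrow> const_near P f w" "0 < s" "s < \<rho> c"
  shows "const_near P f (\<kappa> c (of_real s * \<i> ^ j)) \<longleftrightarrow> f (corner c j) = f (corner c (j + 3))"
  unfolding corner_def using assms by (intro cross_chart_ray[OF crosses])

text \<open>Each open quadrant is connected and off \<open>P\<close>, so it lies in a single region,
  and it accumulates at the crossing. Conversely, points of \<open>R\<close> close to the crossing
  lie off the axes, hence in a quadrant.\<close>

lemma frontier_crossing_iff:
  assumes c: "c \<in> C" and R: "R \<in> components (- P)"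
  shows "c \<in> frontier R \<longleftrightarrow> (\<exists>j<4. corner c j \<in> R)"
proof
  have k: "cross_chart P c (\<rho> c) (\<kappa> c)" and dk: "disc_chart c (\<rho> c) (\<kappa> c)"
    using crosses crosses_disc c by blast+
  have kc: "\<kappa> c 0 = c" using dk by (simp add: disc_chart_def)
  have RP: "R \<inter> P = {}" using in_components_subset[OF R] by blast
  let ?A = "\<lambda>j. (\<lambda>v. \<kappa> c (v * \<i> ^ j)) ` quadrant (\<rho> c)"
  have A: "corner c j \<in> ?A j" "connected (?A j)" "?A j \<subseteq> - P" for j
  proof -
    have "of_real (\<rho> c / 2) * (1 + \<i>) \<in> ball 0 (\<rho> c)"
      using norm_quadrant_point[OF \<rho>_pos[OF c], of 0] by simp
    then show "corner c j \<in> ?A j" unfolding corner_def quadrant_point_def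
      by (intro image_eqI[where x = "of_real (\<rho> c / 2) * (1 + \<i>)"]) (use \<rho>_pos[OF c] in simp_all)
    show "connected (?A j)" by (rule connected_quadrant[OF k])
    show "?A j \<subseteq> - P" using quadrant_off_axes[OF k] by blast
  qed
  {
    assume "\<exists>j<4. corner c j \<in> R"
    then obtain j where j: "corner c j \<in> R" by blast
    have AR: "?A j \<subseteq> R" by (rule components_maximal[OF R A(2,3)]) (use j A(1) in blast)
    have "c \<in> closure R"
      unfolding closure_iff_nhds_not_empty
    proof (intro allI impI)
      fix B V assume V: "V \<subseteq> B" "open V" "c \<in> V"
      obtain s where s: "0 < s" "s \<le> \<rho> c" "\<kappa> c ` ball 0 s \<subseteq> V" by (rule disc_chart_small[OF dk V(2,3)])
      let ?v = "of_real (s / 2) * (1 + \<i>)"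
      have v: "?v \<in> ball 0 s" using norm_quadrant_point[OF s(1), of 0] by simp
      then have "\<kappa> c (?v * \<i> ^ j) \<in> ?A j" using s by (intro imageI) auto
      moreover have "?v * \<i> ^ j \<in> ball 0 s" using v by simp
      then have "\<kappa> c (?v * \<i> ^ j) \<in> V" using s(3) by blast
      ultimately show "R \<inter> B \<noteq> {}" using AR V(1) by blast
    qed
    moreover have "interior R \<subseteq> R" by (rule interior_subset)
    then have "c \<notin> interior R" using RP C_sub c by blast
    ultimately show "c \<in> frontier R" unfolding frontier_def by blast
  next
    assume "c \<in> frontier R"
    then have cl: "c \<in> closure R" unfolding frontier_def by blast
    have "open (\<kappa> c ` ball 0 (\<rho> c))" using open_chart_image[OF dk] by blast
    moreover have "c \<in> \<kappa> c ` ball 0 (\<rho> c)" using kc \<rho>_pos[OF c] by (metis centre_in_ball imageI)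
    ultimately have "R \<inter> \<kappa> c ` ball 0 (\<rho> c) \<noteq> {}" using cl closure_iff_nhds_not_empty by blast
    then obtain u where u: "u \<in> ball 0 (\<rho> c)" "\<kappa> c u \<in> R" by blast
    then have "\<kappa> c u \<notin> P" using RP by blast
    then have "Re u \<noteq> 0" "Im u \<noteq> 0" using k u(1) unfolding cross_chart_def by blast+
    then obtain j v where j: "j < 4" "u = v * \<i> ^ j" "Re v > 0" "Im v > 0" by (rule quarter_turn)
    have "v \<in> ball 0 (\<rho> c)" using u(1) j(2) by (simp add: norm_mult norm_power)
    then have "\<kappa> c u \<in> ?A j" using j by blast
    then have "?A j \<subseteq> R" using u(2) by (intro components_maximal[OF R A(2,3)]) blast
    then show "\<exists>j<4. corner c j \<in> R" using A(1)[of j] j(1) by blast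
  }
qed

lemma const_on_region:
  assumes "\<And>w. w \<notin> P \<Longrightarrow> const_near P f w" "R \<in> components (- P)" "x \<in> R" "y \<in> R"
  shows "f x = f y"
proof (rule const_on_connected[of R P f])
  show "connected R" using assms(2) by (rule in_components_connected)
  show "R \<inter> P = {}" using in_components_subset[OF assms(2)] by blast
  then show "const_near P f w" if "w \<in> R" for w using assms(1) that by blast
qed fact+

lemma const_near_region:
  assumes R: "R \<in> components (- P)" and w: "w \<notin> P"
  shows "const_near P (\<lambda>z. z \<in> R) w"
proof -
  have op: "open (- P)" using closed_P by blast
  obtain S where S: "S \<in> components (- P)" "w \<in> S"
    using w Union_components[of "- P"] by blast
  have "z \<in> R \<longleftrightarrow> w \<in> R" if "z \<in> S" for z
    using components_nonoverlap[OF R S(1)] S that by blast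
  then show ?thesis using open_components[OF op S(1)] S(2) by (intro const_nearI[of S])
qed

end

section \<open>Charts of a link diagram\<close>

lemma cis_near_inj:
  assumes "cis s = cis t" "\<bar>s - t\<bar> < 2 * pi"
  shows "s = t"
proof -
  have "cis (s - t) = 1" using assms(1) by (simp add: cis_divide[symmetric])
  then have "cos (s - t) = 1" by (metis cis.sel(1) one_complex.sel(1))
  then obtain n :: int where n: "s - t = of_int n * 2 * pi" using cos_one_2pi_int by auto
  then have "\<bar>real_of_int n\<bar> * (2 * pi) < 1 * (2 * pi)" using assms(2) by (simp add: abs_mult)
  then have "\<bar>real_of_int n\<bar> < 1" by (rule mult_right_less_imp_less) simp
  then have "n = 0" by linarith
  then show ?thesis using n by simp
qed

lemma sphere_cis: "z \<in> sphere 0 1 \<Longrightarrow> \<exists>t. z = cis t"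
  by (metis cis_Arg dist_0_norm mem_sphere norm_zero sgn_eq div_by_1 of_real_1 zero_neq_one)

text \<open>A passage through the value 0 at \<open>t0\<close>, seen at height \<open>s\<close>. A
  negative \<open>s\<close> encodes a decreasing passage.\<close>

definition two_sided_value :: "(real \<Rightarrow> real) \<Rightarrow> real \<Rightarrow> real \<Rightarrow> real \<Rightarrow> real \<Rightarrow> bool" where
  "two_sided_value \<phi> t0 e \<epsilon> s \<longleftrightarrow>
    (\<exists>t. t0 < t \<and> t < t0 + \<epsilon> \<and> t \<le> t0 + e \<and> \<phi> t = s) \<and>
    (\<exists>t. t0 - \<epsilon> < t \<and> t < t0 \<and> t0 - e \<le> t \<and> \<phi> t = - s)"

text \<open>A continuous injective function on an interval is strictly monotone and takes all
  intermediate values; \<open>\<sigma>\<close> records whether it increases or decreases.\<close>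

lemma inj_real_branches:
  fixes \<phi> :: "real \<Rightarrow> real"
  assumes e: "e > 0" and cont: "continuous_on {t0 - e..t0 + e} \<phi>" and inj: "inj_on \<phi> {t0 - e..t0 + e}"
    and 0: "\<phi> t0 = 0"
  shows "\<exists>\<sigma>\<in>{1, -1}. \<forall>\<epsilon>>0. \<exists>\<delta>>0. \<forall>s. 0 < s \<and> s < \<delta> \<longrightarrow> two_sided_value \<phi> t0 e \<epsilon> (\<sigma> * s)"
proof -
  have main: "\<forall>\<epsilon>>0. \<exists>\<delta>>0. \<forall>s. 0 < s \<and> s < \<delta> \<longrightarrow> two_sided_value \<psi> t0 e \<epsilon> s"
    if \<psi>: "continuous_on {t0 - e..t0 + e} \<psi>" "inj_on \<psi> {t0 - e..t0 + e}" "\<psi> t0 = 0" "\<psi> (t0 + e) > 0"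
    for \<psi> :: "real \<Rightarrow> real"
  proof (intro allI impI)
    fix \<epsilon> :: real assume "\<epsilon> > 0"
    define d where "d = min e \<epsilon> / 2"
    have d: "0 < d" "d < e" "d < \<epsilon>" using e \<open>\<epsilon> > 0\<close> by (auto simp: d_def)
    have mono: "(\<psi> a < \<psi> x \<and> \<psi> x < \<psi> b) \<or> (\<psi> b < \<psi> x \<and> \<psi> x < \<psi> a)"
      if "a < x" "x < b" "t0 - e \<le> a" "b \<le> t0 + e" for a x b
      using that by (intro continuous_inj_imp_mono continuous_on_subset[OF \<psi>(1)] inj_on_subset[OF \<psi>(2)]) auto
    have pos: "\<psi> (t0 + d) > 0" using mono[of t0 "t0 + d" "t0 + e"] d \<psi> by auto
    have neg: "\<psi> (t0 - d) < 0" using mono[of "t0 - d" t0 "t0 + d"] d \<psi> pos by auto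
    have "two_sided_value \<psi> t0 e \<epsilon> s"
      if s: "0 < s" "s < min (\<psi> (t0 + d)) (- \<psi> (t0 - d))" for s
      unfolding two_sided_value_def
    proof
      have "\<exists>t\<ge>t0. t \<le> t0 + d \<and> \<psi> t = s"
        by (rule IVT') (use s \<psi>(3) d in \<open>auto intro: continuous_on_subset[OF \<psi>(1)]\<close>)
      then obtain t where t: "t \<ge> t0" "t \<le> t0 + d" "\<psi> t = s" by blast
      moreover from t have "t \<noteq> t0" using s \<psi>(3) by auto
      ultimately show "\<exists>t. t0 < t \<and> t < t0 + \<epsilon> \<and> t \<le> t0 + e \<and> \<psi> t = s"
        using d by (intro exI[of _ t]) auto
      have "\<exists>t\<ge>t0 - d. t \<le> t0 \<and> \<psi> t = - s"
        by (rule IVT') (use s \<psi>(3) d in \<open>auto intro: continuous_on_subset[OF \<psi>(1)]\<close>)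
      then obtain u where u: "u \<ge> t0 - d" "u \<le> t0" "\<psi> u = - s" by blast
      moreover from u have "u \<noteq> t0" using s \<psi>(3) by auto
      ultimately show "\<exists>t. t0 - \<epsilon> < t \<and> t < t0 \<and> t0 - e \<le> t \<and> \<psi> t = - s"
        using d by (intro exI[of _ u]) auto
    qed
    then show "\<exists>\<delta>>0. \<forall>s. 0 < s \<and> s < \<delta> \<longrightarrow> two_sided_value \<psi> t0 e \<epsilon> s"
      using pos neg by (intro exI[of _ "min (\<psi> (t0 + d)) (- \<psi> (t0 - d))"]) auto
  qed
  have "\<phi> (t0 + e) \<noteq> \<phi> t0" using inj_onD[OF inj, of "t0 + e" t0] e by auto
  then consider "\<phi> (t0 + e) > 0" | "- \<phi> (t0 + e) > 0" using 0 by linarith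
  then show ?thesis
  proof cases
    case 1
    show ?thesis
      by (rule bexI[of _ 1], unfold mult_1_left, rule main[of \<phi>, OF cont inj 0 1], simp)
  next
    case 2
    have inj': "inj_on (\<lambda>t. - \<phi> t) {t0 - e..t0 + e}"
      by (rule inj_onI, rule inj_onD[OF inj]) simp_all
    have 0: "- \<phi> t0 = 0" using 0 by simp
    have eq: "two_sided_value (\<lambda>t. - \<phi> t) t0 e \<epsilon> s \<longleftrightarrow> two_sided_value \<phi> t0 e \<epsilon> (- s)" for \<epsilon> s
      unfolding two_sided_value_def by (simp only: minus_equation_iff[of "\<phi> _"] eq_commute[of _ "\<phi> _"] minus_minus)
    show ?thesis
      by (rule bexI[of _ "- 1"], unfold mult_minus1,
          rule main[of "\<lambda>t. - \<phi> t", OF continuous_on_minus[OF cont] inj' 0 2, unfolded eq], simp)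
  qed
qed

section \<open>The components as periodic curves on the real line\<close>

locale diagram =
  fixes D :: diagram_data
  assumes diagram: "link_diagram D"
begin

abbreviation "P \<equiv> projection D"
abbreviation "C \<equiv> crossings D"
abbreviation "n \<equiv> num_components D"

text \<open>Unrolling makes the parameters real numbers, where order, one-sided neighbourhoods and
  the intermediate value theorem are available.\<close>

definition G :: "nat \<Rightarrow> real \<Rightarrow> complex" where
  "G i t = curve D i (cis t)"

lemma cont_curve: "i < n \<Longrightarrow> continuous_on (sphere 0 1) (curve D i)"
  using diagram by (simp add: link_diagram_def)

lemma cont_G: "i < n \<Longrightarrow> continuous_on S (G i)"
  unfolding G_def
  by (rule continuous_on_compose2[OF cont_curve]) (auto intro: continuous_intros)

lemma finite_C: "finite C"
  using diagram by (simp add: link_diagram_def)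

lemma G_in_P: "i < n \<Longrightarrow> G i t \<in> P"
  unfolding projection_def params_def point_at_def G_def by force

lemma P_cases:
  assumes "m \<in> P"
  obtains i t where "i < n" "m = G i t"
  using assms sphere_cis unfolding projection_def params_def point_at_def G_def by fastforce

lemma P_eq: "P = (\<Union>i<n. curve D i ` sphere 0 1)"
  unfolding projection_def params_def point_at_def by force

lemma compact_P: "compact P"
  unfolding P_eq by (intro compact_UN compact_continuous_image cont_curve) auto

lemma C_sub_P: "C \<subseteq> P"
  unfolding crossings_def fibre_def projection_def by blast

lemma mem_fibre: "i < n \<Longrightarrow> (i, cis t) \<in> fibre D (G i t)"
  unfolding fibre_def params_def point_at_def G_def by simp

lemma G_eq_noncrossing:
  assumes "i < n" "j < n" "G i s = G j t" "G i s \<notin> C"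
  shows "i = j \<and> cis s = cis t"
  using assms mem_fibre[of i s] mem_fibre[of j t] unfolding crossings_def by auto

lemma G_crossingI:
  assumes "i < n" "j < n" "G i s = G j t" "(i, cis s) \<noteq> (j, cis t)"
  shows "G i s \<in> C"
  using G_eq_noncrossing assms by blast

lemma finite_fibre: "finite (fibre D c)"
proof (cases "c \<in> C")
  case True
  then have "transverse_double_point D c" using diagram by (simp add: link_diagram_def)
  then show ?thesis unfolding transverse_double_point_def by auto
next
  case False
  then have "fibre D c \<subseteq> {p}" if "p \<in> fibre D c" for p using that unfolding crossings_def by blast
  then show ?thesis by (metis equals0I finite.emptyI finite.insertI finite_subset)
qed

text \<open>Finitely many crossings with finite fibres leave only finitely many parameters on the
  circle. The bound 1 keeps \<open>t\<close> within less than a full turn of \<open>t0\<close>, so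
  that \<open>cis\<close> does not return to the same point.\<close>

lemma isolated_params:
  assumes i: "i < n"
  obtains e where "0 < e" "e \<le> 1" "\<And>t. t \<noteq> t0 \<Longrightarrow> \<bar>t - t0\<bar> < e \<Longrightarrow> G i t \<notin> C"
proof -
  define F where "F = {z \<in> sphere 0 1. curve D i z \<in> C}"
  have "F \<subseteq> snd ` (\<Union>c\<in>C. fibre D c)"
    using i unfolding F_def fibre_def params_def point_at_def by force
  then have "finite F" by (rule finite_subset) (use finite_C finite_fibre in auto)
  then have "open (- (F - {cis t0}))" by (intro open_Compl finite_imp_closed) auto
  then have "open (cis -` (- (F - {cis t0})))" by (intro open_vimage) (auto intro: continuous_intros)
  moreover have "t0 \<in> cis -` (- (F - {cis t0}))" by simp
  ultimately obtain e where e: "e > 0" "ball t0 e \<subseteq> cis -` (- (F - {cis t0}))"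
    using open_contains_ball by blast
  show ?thesis
  proof (rule that[of "min e 1"])
    fix t assume t: "t \<noteq> t0" "\<bar>t - t0\<bar> < min e 1"
    then have "cis t \<noteq> cis t0" using cis_near_inj[of t t0] pi_gt3 by fastforce
    moreover have "t \<in> ball t0 e" using t by (auto simp: dist_real_def)
    ultimately have "cis t \<notin> F" using e(2) by blast
    then show "G i t \<notin> C" unfolding F_def G_def by simp
  qed (use e in auto)
qed

text \<open>A coincidence of two nearby parameters would put both over a crossing, but near
  \<open>t0\<close> only \<open>t0\<close> itself can lie over one.\<close>

lemma locally_injective:
  assumes i: "i < n"
  obtains e where "0 < e" "inj_on (G i) {t0 - e..t0 + e}"
proof -
  obtain e where e: "0 < e" "e \<le> 1" "\<And>t. t \<noteq> t0 \<Longrightarrow> \<bar>t - t0\<bar> < e \<Longrightarrow> G i t \<notin> C"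
    using isolated_params[OF i] by metis
  have "s = t" if st: "s \<in> {t0 - e/2..t0 + e/2}" "t \<in> {t0 - e/2..t0 + e/2}" "G i s = G i t" for s t
  proof (rule ccontr)
    assume "s \<noteq> t"
    moreover have "\<bar>s - t\<bar> < 2 * pi" using st e(2) pi_gt3 by auto
    ultimately have "cis s \<noteq> cis t" using cis_near_inj by blast
    then have "G i s \<in> C" "G i t \<in> C" using G_crossingI[OF i i st(3)] st(3) by auto
    then have "s = t0" "t = t0" using e(3)[of s] e(3)[of t] st e(1) by force+
    then show False using \<open>s \<noteq> t\<close> by simp
  qed
  then have "inj_on (G i) {t0 - e/2..t0 + e/2}" by (intro inj_onI)
  then show ?thesis using e(1) by (intro that[of "e/2"]) auto
qed

text \<open>In the chart \<open>k\<close>, the strand through \<open>G i t0\<close> runs along the axis spanned by \<open>e\<close>, in the direction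
  of \<open>e\<close>, and fills it near the origin.\<close>

definition reached :: "(complex \<Rightarrow> complex) \<Rightarrow> complex \<Rightarrow> nat \<Rightarrow> real \<Rightarrow> real \<Rightarrow> real \<Rightarrow> bool" where
  "reached k e i t0 \<epsilon> s \<longleftrightarrow>
     (\<exists>t. t0 < t \<and> t < t0 + \<epsilon> \<and> G i t = k (of_real s * e)) \<and>
     (\<exists>t. t0 - \<epsilon> < t \<and> t < t0 \<and> G i t = k (- of_real s * e))"

definition strand :: "(complex \<Rightarrow> complex) \<Rightarrow> complex \<Rightarrow> nat \<Rightarrow> real \<Rightarrow> bool" where
  "strand k e i t0 \<longleftrightarrow> (\<forall>\<epsilon>>0. \<exists>\<delta>>0. \<forall>s. 0 < s \<and> s < \<delta> \<longrightarrow> reached k e i t0 \<epsilon> s)"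

text \<open>A diagram only says that a strand stays in an axis of a chart. That it fills both half
  axes near the origin comes from injectivity of the curve and the intermediate value theorem.
  Division by the unit \<open>e\<close> turns the axis into the real line, and
  \<open>\<sigma>\<close> is the direction of travel.\<close>

lemma ex_strand:
  assumes i: "i < n" and U: "open U" "homeomorphism U V h k" "G i t0 \<in> U" "h (G i t0) = 0"
    and e: "cmod e = 1"
    and along: "\<forall>\<^sub>F u in at (cis t0) within sphere 0 1. Im (h (curve D i u) / e) = 0"
  shows "\<exists>\<sigma>\<in>{1, -1}. strand k (\<sigma> * e) i t0"
proof -
  have ch: "continuous_on U h" and kh: "\<And>z. z \<in> U \<Longrightarrow> k (h z) = z"
    using U(2) by (auto simp: homeomorphism_def)
  obtain S where S: "open S" "cis t0 \<in> S"
    "\<And>u. u \<in> S \<Longrightarrow> u \<noteq> cis t0 \<Longrightarrow> u \<in> sphere 0 1 \<Longrightarrow> Im (h (curve D i u) / e) = 0"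
    using along unfolding eventually_at_topological by blast
  have "open (cis -` S)" using S(1) by (intro open_vimage) (auto intro: continuous_intros)
  moreover have "open (G i -` U)" using U(1) cont_G[OF i] by (intro open_vimage) auto
  ultimately have "open (cis -` S \<inter> G i -` U)" by blast
  then obtain d where d: "d > 0" "cball t0 d \<subseteq> cis -` S \<inter> G i -` U"
    using open_contains_cball S(2) U(3) by (metis IntI vimageI)
  obtain b where b: "0 < b" "inj_on (G i) {t0 - b..t0 + b}" by (rule locally_injective[OF i])
  define a where "a = min b d"
  have a: "a > 0" using b d by (simp add: a_def)
  define \<phi> where "\<phi> t = Re (h (G i t) / e)" for t
  let ?I = "{t0 - a..t0 + a}"
  have Isub: "G i t \<in> U \<and> cis t \<in> S" if "t \<in> ?I" for t
  proof -
    have "t \<in> cball t0 d" using that by (auto simp: dist_real_def a_def)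
    then show ?thesis using d(2) by blast
  qed
  have line: "h (G i t) = of_real (\<phi> t) * e" if "t \<in> ?I" for t
  proof -
    have "Im (h (G i t) / e) = 0"
      using S(3)[of "cis t"] Isub[OF that] U(4) by (cases "cis t = cis t0") (auto simp: G_def)
    then have "h (G i t) / e = of_real (\<phi> t)" by (simp add: complex_eq_iff \<phi>_def)
    moreover have "e \<noteq> 0" using e by auto
    ultimately show ?thesis by (simp add: field_simps)
  qed
  have "continuous_on ?I \<phi>" unfolding \<phi>_def
  proof (intro continuous_intros continuous_on_compose2[OF ch])
    show "G i ` ?I \<subseteq> U" using Isub by blast
  qed (use cont_G[OF i] e in auto)
  moreover have "inj_on \<phi> ?I"
  proof (rule inj_onI)
    fix s t assume st: "s \<in> ?I" "t \<in> ?I" "\<phi> s = \<phi> t"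
    then have "h (G i s) = h (G i t)" using line by metis
    then have "G i s = G i t" using kh Isub st by metis
    moreover have "s \<in> {t0 - b..t0 + b}" "t \<in> {t0 - b..t0 + b}" using st by (auto simp: a_def)
    ultimately show "s = t" using inj_onD[OF b(2)] by blast
  qed
  moreover have "\<phi> t0 = 0" using U(4) by (simp add: \<phi>_def)
  ultimately obtain \<sigma> where \<sigma>: "\<sigma> \<in> {1, -1::real}"
    "\<forall>\<epsilon>>0. \<exists>\<delta>>0. \<forall>s. 0 < s \<and> s < \<delta> \<longrightarrow> two_sided_value \<phi> t0 a \<epsilon> (\<sigma> * s)"
    using inj_real_branches[OF a] by blast
  have pt: "G i t = k (of_real (\<phi> t) * e)" if "t \<in> ?I" for t
    using line[OF that] kh Isub[OF that] by metis
  have "strand k (of_real \<sigma> * e) i t0"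
    unfolding strand_def
  proof (intro allI impI)
    fix \<epsilon> :: real assume "\<epsilon> > 0"
    then obtain \<delta> where \<delta>: "\<delta> > 0" "\<And>s. 0 < s \<Longrightarrow> s < \<delta> \<Longrightarrow> two_sided_value \<phi> t0 a \<epsilon> (\<sigma> * s)"
      using \<sigma>(2) by metis
    have "reached k (of_real \<sigma> * e) i t0 \<epsilon> s" if s: "0 < s" "s < \<delta>" for s
    proof -
      obtain t u where t: "t0 < t" "t < t0 + \<epsilon>" "t \<le> t0 + a" "\<phi> t = \<sigma> * s"
        and u: "t0 - \<epsilon> < u" "u < t0" "t0 - a \<le> u" "\<phi> u = - (\<sigma> * s)"
        using \<delta>(2)[OF s] unfolding two_sided_value_def by metis
      have "G i t = k (of_real s * (of_real \<sigma> * e))" using pt[of t] t a by (simp add: ac_simps)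
      moreover have "G i u = k (- of_real s * (of_real \<sigma> * e))" using pt[of u] u a by (simp add: ac_simps)
      ultimately show ?thesis using t u unfolding reached_def by blast
    qed
    then show "\<exists>\<delta>>0. \<forall>s. 0 < s \<and> s < \<delta> \<longrightarrow> reached k (of_real \<sigma> * e) i t0 \<epsilon> s"
      using \<delta>(1) by blast
  qed
  then show ?thesis using \<sigma>(1) by auto
qed

text \<open>Remote parts of the link cannot accumulate at \<open>m\<close>: the parameters outside
  the sets \<open>B p\<close> form a compact set whose image misses \<open>m\<close>.\<close>

lemma fibre_neighbourhood:
  assumes B: "\<And>p. p \<in> fibre D m \<Longrightarrow> open (B p)" "\<And>p. p \<in> fibre D m \<Longrightarrow> snd p \<in> B p"
  shows "\<exists>T. open T \<and> m \<in> T \<and>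
    (\<forall>i<n. \<forall>z\<in>sphere 0 1. curve D i z \<in> T \<longrightarrow> (\<exists>p\<in>fibre D m. fst p = i \<and> z \<in> B p))"
proof -
  define W where "W i = (\<Union>p\<in>{p\<in>fibre D m. fst p = i}. B p)" for i
  have opW: "open (W i)" for i unfolding W_def using B(1) by (intro open_UN) auto
  define K where "K = (\<Union>i<n. curve D i ` (sphere 0 1 - W i))"
  have "compact K" unfolding K_def
  proof (intro compact_UN compact_continuous_image)
    fix i assume "i \<in> {..<n}"
    then show "continuous_on (sphere 0 1 - W i) (curve D i)"
      using cont_curve by (auto intro: continuous_on_subset)
    show "compact (sphere 0 1 - W i)" using opW by (intro compact_diff) auto
  qed auto
  then have opK: "open (- K)" using compact_imp_closed by blast
  have mK: "m \<notin> K"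
  proof
    assume "m \<in> K"
    then obtain i z where z: "i < n" "z \<in> sphere 0 1" "z \<notin> W i" "m = curve D i z" unfolding K_def by blast
    then have "(i, z) \<in> fibre D m" unfolding fibre_def params_def point_at_def by simp
    then have "z \<in> W i" using B(2) unfolding W_def by force
    then show False using z by simp
  qed
  show ?thesis
  proof (intro exI[of _ "- K"] conjI allI ballI impI)
    fix i z assume z: "i < n" "z \<in> sphere 0 1" "curve D i z \<in> - K"
    then have "z \<in> W i" unfolding K_def by blast
    then show "\<exists>p\<in>fibre D m. fst p = i \<and> z \<in> B p" unfolding W_def by blast
  qed (use opK mK in auto)
qed

text \<open>Local equality of \<open>P\<close> with the model \<open>A\<close>. That
  \<open>P\<close> lies in the model follows from \<open>fibre_neighbourhood\<close>; that the model
  is covered is \<open>hit\<close>. The assumption on the origin is there because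
  \<open>runs_along\<close> says nothing about the parameter itself.\<close>

lemma chart_from_strands:
  assumes m: "m \<in> P" and U: "open U" "open V" "m \<in> U" "homeomorphism U V h k" "h m = 0"
    and A: "0 \<in> A" "\<And>p. p \<in> fibre D m \<Longrightarrow> runs_along D h p A"
    and hit: "d > 0" "\<And>w. w \<in> A \<Longrightarrow> w \<noteq> 0 \<Longrightarrow> cmod w < d \<Longrightarrow> k w \<in> P"
  obtains r where "disc_chart m r k" "\<And>w. w \<in> ball 0 r \<Longrightarrow> k w \<in> P \<longleftrightarrow> w \<in> A"
proof -
  have hom: "continuous_on V k" "h ` U = V" "\<And>w. w \<in> V \<Longrightarrow> k w \<in> U" "\<And>w. w \<in> V \<Longrightarrow> h (k w) = w"
    and k0: "k 0 = m" and V0: "0 \<in> V"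
    using U unfolding homeomorphism_def by (auto intro: rev_image_eqI)
  have "\<exists>B. open B \<and> snd p \<in> B \<and> (\<forall>u\<in>B. u \<in> sphere 0 1 \<longrightarrow> h (curve D (fst p) u) \<in> A)"
    if p: "p \<in> fibre D m" for p
  proof -
    obtain B where B: "open B" "snd p \<in> B"
      "\<And>u. u \<in> B \<Longrightarrow> u \<noteq> snd p \<Longrightarrow> u \<in> sphere 0 1 \<Longrightarrow> h (curve D (fst p) u) \<in> A"
      using A(2)[OF p] unfolding runs_along_def eventually_at_topological by blast
    moreover have "curve D (fst p) (snd p) = m" using p by (simp add: fibre_def point_at_def)
    ultimately show ?thesis using U(5) A(1) by metis
  qed
  then obtain B where B: "\<And>p. p \<in> fibre D m \<Longrightarrow> open (B p)" "\<And>p. p \<in> fibre D m \<Longrightarrow> snd p \<in> B p"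
    "\<And>p u. p \<in> fibre D m \<Longrightarrow> u \<in> B p \<Longrightarrow> u \<in> sphere 0 1 \<Longrightarrow> h (curve D (fst p) u) \<in> A"
    by metis
  obtain T where T: "open T" "m \<in> T"
    "\<forall>i<n. \<forall>z\<in>sphere 0 1. curve D i z \<in> T \<longrightarrow> (\<exists>p\<in>fibre D m. fst p = i \<and> z \<in> B p)"
    using fibre_neighbourhood[of m B] B(1,2) by blast
  have PK: "h w \<in> A" if w: "w \<in> P" "w \<in> T" for w
  proof -
    obtain i z where z: "i < n" "z \<in> sphere 0 1" "w = curve D i z" using w(1) unfolding P_eq by blast
    then obtain p where "p \<in> fibre D m" "fst p = i" "z \<in> B p" using T(3) w(2) by blast
    then show ?thesis using B(3) z by blast
  qed
  have "open (V \<inter> k -` T)" using continuous_open_preimage[OF hom(1) U(2) T(1)] .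
  moreover have "0 \<in> V \<inter> k -` T" using V0 k0 T(2) by simp
  ultimately obtain r0 where r0: "r0 > 0" "ball 0 r0 \<subseteq> V \<inter> k -` T"
    using open_contains_ball by blast
  define r where "r = min r0 d"
  have r: "r > 0" "ball 0 r \<subseteq> V \<inter> k -` T"
    using r0 hit(1) by (auto simp: r_def)
  have "disc_chart m r k"
    unfolding disc_chart_def
  proof (intro conjI)
    show "continuous_on (ball 0 r) k" using hom(1) r(2) by (auto intro: continuous_on_subset)
    show "inj_on k (ball 0 r)" using hom(4) r(2) by (metis IntD1 inj_onI subsetD)
  qed (use r k0 in auto)
  moreover have "k w \<in> P \<longleftrightarrow> w \<in> A" if w: "w \<in> ball 0 r" for w
  proof
    assume "k w \<in> P"
    moreover have "w \<in> V" "k w \<in> T" using w r(2) by blast+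
    ultimately show "w \<in> A" using PK[of "k w"] hom(4) by simp
  next
    assume "w \<in> A"
    then show "k w \<in> P" using hit(2)[of w] w k0 m by (cases "w = 0") (auto simp: r_def)
  qed
  ultimately show thesis by (rule that)
qed

lemma strand_hits:
  assumes "i < n" "strand k e i t0"
  obtains d where "d > 0" "\<And>s. s \<noteq> 0 \<Longrightarrow> \<bar>s\<bar> < d \<Longrightarrow> k (of_real s * e) \<in> P"
proof -
  obtain d where d: "d > 0" "\<And>s. 0 < s \<Longrightarrow> s < d \<Longrightarrow> reached k e i t0 1 s"
    using assms(2) unfolding strand_def by (metis zero_less_one)
  have "k (of_real s * e) \<in> P" if "s \<noteq> 0" "\<bar>s\<bar> < d" for s
  proof (cases "s > 0")
    case True
    then have "\<exists>t. G i t = k (of_real s * e)" using d(2)[of s] that unfolding reached_def by auto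
    then show ?thesis using G_in_P[OF assms(1)] by metis
  next
    case False
    then have "0 < - s" "- s < d" using that by auto
    then have "\<exists>t. G i t = k (- of_real (- s) * e)" using d(2) unfolding reached_def by blast
    then show ?thesis using G_in_P[OF assms(1)] by (metis add.inverse_inverse of_real_minus)
  qed
  with d(1) show ?thesis by (rule that)
qed

section \<open>Charts of the projection at arcs and crossings\<close>

lemma ex_arc_chart:
  assumes m: "m \<in> P" "m \<notin> C"
  shows "\<exists>r k. arc_chart P m r k"
proof -
  obtain i t0 where i: "i < n" "m = G i t0" using m(1) by (rule P_cases)
  have fib: "fibre D m = {(i, cis t0)}"
    using mem_fibre[OF i(1), of t0] m(2) i(2) unfolding crossings_def by blast
  have "(i, cis t0) \<in> params D" using i(1) by (simp add: params_def)
  then have "locally_flat D (i, cis t0)" using diagram unfolding link_diagram_def by blast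
  moreover have "point_at D (i, cis t0) = m" using i(2) by (simp add: point_at_def G_def)
  ultimately obtain U h V k where U: "open U" "m \<in> U" "h m = 0" "open V" "homeomorphism U V h k"
    and run: "runs_along D h (i, cis t0) {w. Im w = 0}"
    unfolding locally_flat_def chart_at_def by auto
  obtain \<sigma> where \<sigma>: "\<sigma> \<in> {1, -1}" "strand k (\<sigma> * 1) i t0"
    using ex_strand[OF i(1) U(1,5), of t0 1] U(2,3) i(2) run unfolding runs_along_def by auto
  obtain d where d: "d > 0" "\<And>s. s \<noteq> 0 \<Longrightarrow> \<bar>s\<bar> < d \<Longrightarrow> k (of_real s * \<sigma>) \<in> P"
    using strand_hits[OF i(1) \<sigma>(2)] by auto
  have hit: "k w \<in> P" if w: "w \<in> {w. Im w = 0}" "w \<noteq> 0" "cmod w < d" for w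
  proof -
    have "w = of_real (Re w)" using w(1) by (simp add: complex_eq_iff)
    moreover have "Re w \<noteq> 0" using w calculation by auto
    moreover have "\<bar>Re w\<bar> < d" using w(3) abs_Re_le_cmod[of w] by linarith
    ultimately show ?thesis using d(2)[of "Re w"] d(2)[of "- Re w"] \<sigma>(1) by auto
  qed
  obtain r where "disc_chart m r k" "\<And>w. w \<in> ball 0 r \<Longrightarrow> k w \<in> P \<longleftrightarrow> w \<in> {w. Im w = 0}"
    by (rule chart_from_strands[OF m(1) U(1,4,2,5,3) _ _ d(1) hit]) (use run fib in auto)
  then show ?thesis unfolding arc_chart_def by (intro exI[of _ r] exI[of _ k]) simp
qed

text \<open>The parameters over \<open>c\<close> and the directions of travel are stored with the
  chart, because later arguments follow a strand through it.\<close>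

definition crossing_chart ::
  "complex \<Rightarrow> real \<Rightarrow> (complex \<Rightarrow> complex) \<Rightarrow> nat \<Rightarrow> real \<Rightarrow> nat \<Rightarrow> real \<Rightarrow> complex \<Rightarrow> complex \<Rightarrow> bool" where
  "crossing_chart c r k i t j u e e' \<longleftrightarrow> cross_chart P c r k \<and>
     (\<forall>w\<in>ball 0 r. w \<noteq> 0 \<longrightarrow> k w \<notin> C) \<and> i < n \<and> j < n \<and> (i, cis t) \<noteq> (j, cis u) \<and>
     fibre D c = {(i, cis t), (j, cis u)} \<and> e \<in> {1, -1} \<and> e' \<in> {\<i>, -\<i>} \<and>
     strand k e i t \<and> strand k e' j u"

lemma ex_crossing_chart:
  assumes c: "c \<in> C"
  shows "\<exists>r k i t j u e e'. crossing_chart c r k i t j u e e'"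
proof -
  have "transverse_double_point D c" using c diagram by (simp add: link_diagram_def)
  then obtain p q U h V k where pq: "p \<noteq> q" "fibre D c = {p, q}"
    and U: "open U" "c \<in> U" "h c = 0" "open V" "homeomorphism U V h k"
    and run: "runs_along D h p {w. Im w = 0}" "runs_along D h q {w. Re w = 0}"
    unfolding transverse_double_point_def chart_at_def by blast
  have par: "fst p' < n \<and> snd p' \<in> sphere 0 1 \<and> curve D (fst p') (snd p') = c" if "p' \<in> fibre D c" for p'
    using that unfolding fibre_def params_def point_at_def by auto
  obtain i t where i: "i < n" "p = (i, cis t)" "G i t = c"
    using par[of p] sphere_cis[of "snd p"] pq(2) unfolding G_def by (metis insertI1 prod.collapse)
  obtain j u where j: "j < n" "q = (j, cis u)" "G j u = c"
    using par[of q] sphere_cis[of "snd q"] pq(2) unfolding G_def by (metis insertI1 insertI2 prod.collapse)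
  obtain \<sigma> where \<sigma>: "\<sigma> \<in> {1, -1}" "strand k (\<sigma> * 1) i t"
    using ex_strand[OF i(1) U(1,5), of t 1] U(2,3) i run(1) unfolding runs_along_def by auto
  have "\<exists>\<tau>\<in>{1, -1}. strand k (\<tau> * \<i>) j u"
    by (rule ex_strand[OF j(1) U(1,5)]) (use U(2,3) j run(2) in \<open>simp_all add: runs_along_def\<close>)
  then obtain \<tau> where \<tau>: "\<tau> \<in> {1, -1}" "strand k (\<tau> * \<i>) j u" by blast
  obtain d where d: "d > 0" "\<And>s. s \<noteq> 0 \<Longrightarrow> \<bar>s\<bar> < d \<Longrightarrow> k (of_real s * \<sigma>) \<in> P"
    using strand_hits[OF i(1) \<sigma>(2)] by auto
  obtain d' where d': "d' > 0" "\<And>s. s \<noteq> 0 \<Longrightarrow> \<bar>s\<bar> < d' \<Longrightarrow> k (of_real s * (\<tau> * \<i>)) \<in> P"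
    using strand_hits[OF j(1) \<tau>(2)] by auto
  have hit: "k w \<in> P" if w: "w \<in> {w. Re w = 0 \<or> Im w = 0}" "w \<noteq> 0" "cmod w < min d d'" for w
  proof (cases "Im w = 0")
    case True
    then have "w = of_real (Re w)" by (simp add: complex_eq_iff)
    moreover have "Re w \<noteq> 0" using w calculation by auto
    moreover have "\<bar>Re w\<bar> < d" using w(3) abs_Re_le_cmod[of w] by linarith
    ultimately show ?thesis using d(2)[of "Re w"] d(2)[of "- Re w"] \<sigma>(1) by auto
  next
    case False
    then have "w = of_real (Im w) * \<i>" using w(1) by (simp add: complex_eq_iff)
    moreover have "\<bar>Im w\<bar> < d'" using w(3) abs_Im_le_cmod[of w] by linarith
    ultimately show ?thesis using False d'(2)[of "Im w"] d'(2)[of "- Im w"] \<tau>(1) by auto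
  qed
  have "c \<in> P" using c C_sub_P by blast
  have "min d d' > 0" using d d' by simp
  have ra: "runs_along D h p' {w. Re w = 0 \<or> Im w = 0}" if "p' \<in> fibre D c" for p'
    using that run pq(2) unfolding runs_along_def by (auto elim: eventually_mono)
  obtain r0 where r0: "disc_chart c r0 k" "\<And>w. w \<in> ball 0 r0 \<Longrightarrow> k w \<in> P \<longleftrightarrow> w \<in> {w. Re w = 0 \<or> Im w = 0}"
    by (rule chart_from_strands[OF \<open>c \<in> P\<close> U(1,4,2,5,3) _ ra \<open>min d d' > 0\<close> hit]) auto
  \<comment> \<open>The chart is shrunk until it misses the finitely many other crossings.\<close>
  have "open (- (C - {c}))" using finite_C by (intro open_Compl finite_imp_closed) auto
  then obtain r where r: "0 < r" "r \<le> r0" "k ` ball 0 r \<subseteq> - (C - {c})"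
    by (rule disc_chart_small[OF r0(1)]) auto
  have dk: "disc_chart c r k" by (rule disc_chart_mono[OF r0(1) r(1,2)])
  then have inj: "inj_on k (ball 0 r)" "k 0 = c" by (auto simp: disc_chart_def)
  have "cross_chart P c r k" using dk r0(2) r(2) unfolding cross_chart_def by auto
  moreover have "k w \<notin> C" if "w \<in> ball 0 r" "w \<noteq> 0" for w
  proof -
    have "k w \<noteq> k 0" using inj_onD[OF inj(1), of w 0] that r(1) by auto
    then show ?thesis using r(3) that(1) inj(2) by blast
  qed
  ultimately have "crossing_chart c r k i t j u \<sigma> (\<tau> * \<i>)"
    using i j pq \<sigma> \<tau> unfolding crossing_chart_def by auto
  then show ?thesis by blast
qed

end

section \<open>Parities along the components\<close>

lemma ex_shift_2pi: "\<exists>k::int. a < y + 2 * pi * k \<and> y + 2 * pi * k \<le> a + 2 * pi"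
proof -
  define k where "k = \<lfloor>(a + 2 * pi - y) / (2 * pi)\<rfloor>"
  have "real_of_int k \<le> (a + 2 * pi - y) / (2 * pi)" "(a + 2 * pi - y) / (2 * pi) < real_of_int k + 1"
    unfolding k_def by linarith+
  then have "real_of_int k * (2 * pi) \<le> a + 2 * pi - y" "a + 2 * pi - y < (real_of_int k + 1) * (2 * pi)"
    by (simp_all add: pos_le_divide_eq pos_divide_less_eq)
  then show ?thesis by (intro exI[of _ k]) (simp add: algebra_simps)
qed

lemma cis_shift: "cis (y + 2 * pi * of_int k) = cis y"
  by (simp add: cis_mult[symmetric] cis_multiple_2pi)

text \<open>Lifts nearness on the circle to nearness of angles: \<open>B\<close> is the complement
  of the opposite closed arc, which is compact. For large \<open>\<epsilon>\<close> that arc is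
  empty.\<close>

lemma cis_arc_neighbourhood:
  assumes "\<epsilon> > 0"
  obtains B where "open B" "cis t0 \<in> B" "\<And>z. z \<in> B \<Longrightarrow> z \<in> sphere 0 1 \<Longrightarrow> \<exists>t. \<bar>t - t0\<bar> < \<epsilon> \<and> z = cis t"
proof -
  let ?A = "{t0 + \<epsilon>..t0 + 2 * pi - \<epsilon>}"
  have "compact (cis ` ?A)" by (intro compact_continuous_image) (auto intro: continuous_intros)
  then have op: "open (- (cis ` ?A))" using compact_imp_closed by blast
  have "cis t0 \<notin> cis ` ?A"
  proof
    assume "cis t0 \<in> cis ` ?A"
    then obtain s where s: "s \<in> ?A" "cis t0 = cis s" by blast
    then have "t0 = s" using cis_near_inj[of t0 s] \<open>\<epsilon> > 0\<close> by auto
    then show False using s(1) \<open>\<epsilon> > 0\<close> by simp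
  qed
  moreover have "\<exists>t. \<bar>t - t0\<bar> < \<epsilon> \<and> z = cis t" if z: "z \<in> - (cis ` ?A)" "z \<in> sphere 0 1" for z
  proof -
    obtain y where y: "z = cis y" using sphere_cis z(2) by blast
    obtain k :: int where k: "t0 - \<epsilon> < y + 2 * pi * k" "y + 2 * pi * k \<le> t0 - \<epsilon> + 2 * pi"
      using ex_shift_2pi by blast
    have zk: "z = cis (y + 2 * pi * k)" using y cis_shift by simp
    then have "y + 2 * pi * k \<notin> ?A" using z(1) by blast
    then have "\<bar>y + 2 * pi * k - t0\<bar> < \<epsilon>" using k by auto
    then show ?thesis using zk by blast
  qed
  ultimately show thesis using op by (intro that) auto
qed

text \<open>Required at every real number, not only at the points of \<open>M\<close>, so that
  \<open>M\<close> has no limit points and is finite on bounded intervals.\<close>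

definition discrete_set :: "real set \<Rightarrow> bool" where
  "discrete_set M \<longleftrightarrow> (\<forall>t. \<exists>\<epsilon>>0. \<forall>s. s \<noteq> t \<and> \<bar>s - t\<bar> < \<epsilon> \<longrightarrow> s \<notin> M)"

lemma discrete_set_finite:
  assumes "discrete_set M"
  shows "finite (M \<inter> {a<..b})"
proof (rule ccontr)
  assume "infinite (M \<inter> {a<..b})"
  moreover have "M \<inter> {a<..b} \<subseteq> {a..b}" by auto
  ultimately obtain t where "t islimpt (M \<inter> {a<..b})"
    using compact_eq_Bolzano_Weierstrass[of "{a..b}"] compact_Icc by metis
  then have "\<forall>e>0. \<exists>s\<in>M. s \<noteq> t \<and> dist s t < e" unfolding islimpt_approachable by blast
  moreover obtain \<epsilon> where "\<epsilon> > 0" "\<forall>s. s \<noteq> t \<and> \<bar>s - t\<bar> < \<epsilon> \<longrightarrow> s \<notin> M"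
    using assms unfolding discrete_set_def by blast
  ultimately show False unfolding dist_real_def by blast
qed

text \<open>Only the two sides of \<open>t\<close> are compared. The value at \<open>t\<close>,
  where a strand may run through a crossing, is left free.\<close>

definition switch :: "(real \<Rightarrow> bool) \<Rightarrow> real \<Rightarrow> bool \<Rightarrow> bool" where
  "switch x t b \<longleftrightarrow> (\<exists>\<epsilon>>0. \<forall>s s'. t - \<epsilon> < s \<and> s < t \<and> t < s' \<and> s' < t + \<epsilon> \<longrightarrow> (x s \<noteq> x s' \<longleftrightarrow> b))"

definition switches_at :: "(real \<Rightarrow> bool) \<Rightarrow> real set \<Rightarrow> bool" where
  "switches_at x M \<longleftrightarrow> (\<forall>t. switch x t (t \<in> M))"

lemma ex_parity_function:
  assumes M: "discrete_set M"
  shows "\<exists>x :: real \<Rightarrow> bool. \<forall>s t. s \<le> t \<longrightarrow> (x s \<noteq> x t \<longleftrightarrow> odd (card (M \<inter> {s<..t})))"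
proof -
  \<comment> \<open>At most one of the two intervals is nonempty; the points of \<open>M\<close>
    between 0 and \<open>t\<close> are counted for either sign of \<open>t\<close>.\<close>
  define x where "x t \<longleftrightarrow> odd (card (M \<inter> {0<..t}) + card (M \<inter> {t<..0}))" for t
  have add: "card (M \<inter> {a<..c}) = card (M \<inter> {a<..b}) + card (M \<inter> {b<..c})" if "a \<le> b" "b \<le> c" for a b c
  proof -
    have "M \<inter> {a<..c} = (M \<inter> {a<..b}) \<union> (M \<inter> {b<..c})" using that by auto
    then show ?thesis by (simp add: card_Un_disjoint discrete_set_finite[OF M] disjoint_iff)
  qed
  have "x s \<noteq> x t \<longleftrightarrow> odd (card (M \<inter> {s<..t}))" if st: "s \<le> t" for s t
  proof -
    consider "0 \<le> s" | "s < 0" "0 \<le> t" | "t < 0" by linarith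
    then show ?thesis
    proof cases
      case 1
      then show ?thesis using add[of 0 s t] st unfolding x_def by auto
    next
      case 2
      then show ?thesis using add[of s 0 t] st unfolding x_def by auto
    next
      case 3
      then show ?thesis using add[of s t 0] st unfolding x_def by auto
    qed
  qed
  then show ?thesis by blast
qed

lemma parity_function_switches:
  assumes M: "discrete_set M" and x: "\<And>s t. s \<le> t \<Longrightarrow> (x s \<noteq> x t \<longleftrightarrow> odd (card (M \<inter> {s<..t})))"
  shows "switches_at x M"
  unfolding switches_at_def
proof
  fix t
  obtain \<epsilon> where \<epsilon>: "\<epsilon> > 0" "\<forall>s. s \<noteq> t \<and> \<bar>s - t\<bar> < \<epsilon> \<longrightarrow> s \<notin> M"
    using M unfolding discrete_set_def by blast
  have "x s \<noteq> x s' \<longleftrightarrow> t \<in> M" if s: "t - \<epsilon> < s" "s < t" "t < s'" "s' < t + \<epsilon>" for s s'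
  proof -
    have "M \<inter> {s<..s'} = (if t \<in> M then {t} else {})"
    proof (intro set_eqI iffI)
      fix r assume r: "r \<in> M \<inter> {s<..s'}"
      then have "\<bar>r - t\<bar> < \<epsilon>" using s by auto
      then have "r = t" using \<epsilon>(2) r by blast
      then show "r \<in> (if t \<in> M then {t} else {})" using r by simp
    qed (use s in \<open>auto split: if_splits\<close>)
    then show ?thesis using x[of s s'] s by simp
  qed
  then show "switch x t (t \<in> M)"
    using \<epsilon>(1) unfolding switch_def by blast
qed

lemma parity_function_locally_const:
  assumes M: "discrete_set M" and x: "\<And>s t. s \<le> t \<Longrightarrow> (x s \<noteq> x t \<longleftrightarrow> odd (card (M \<inter> {s<..t})))"
    and t: "t \<notin> M"
  shows "\<exists>\<epsilon>>0. \<forall>s. \<bar>s - t\<bar> < \<epsilon> \<longrightarrow> x s = x t"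
proof -
  obtain \<epsilon> where \<epsilon>: "\<epsilon> > 0" "\<forall>s. s \<noteq> t \<and> \<bar>s - t\<bar> < \<epsilon> \<longrightarrow> s \<notin> M"
    using M unfolding discrete_set_def by blast
  have "x s = x t" if s: "\<bar>s - t\<bar> < \<epsilon>" for s
  proof -
    have no: "r \<notin> M" if "\<bar>r - t\<bar> < \<epsilon>" for r using \<epsilon>(2) t that by metis
    have "r \<notin> {s<..t} \<union> {t<..s}" if "r \<in> M" for r
    proof
      assume "r \<in> {s<..t} \<union> {t<..s}"
      then have "\<bar>r - t\<bar> < \<epsilon>" using s by auto
      then show False using no that by blast
    qed
    then have "M \<inter> {s<..t} = {}" "M \<inter> {t<..s} = {}" by blast+
    then have "even (card (M \<inter> {s<..t}))" "even (card (M \<inter> {t<..s}))" by simp_all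
    then show ?thesis using x[of s t] x[of t s] linear[of s t] by metis
  qed
  then show ?thesis using \<epsilon>(1) by blast
qed

text \<open>Connectedness of the line, applied to the value that \<open>z\<close> has around a
  point. This value is locally constant in the point, even if \<open>z\<close> itself has stray
  values at isolated points.\<close>

lemma punctured_locally_const:
  fixes z :: "real \<Rightarrow> bool"
  assumes "\<And>t. \<exists>\<epsilon>>0. \<exists>a. \<forall>s. s \<noteq> t \<and> \<bar>s - t\<bar> < \<epsilon> \<longrightarrow> z s = a"
  shows "\<exists>a. \<forall>t. \<exists>\<epsilon>>0. \<forall>s. s \<noteq> t \<and> \<bar>s - t\<bar> < \<epsilon> \<longrightarrow> z s = a"
proof -
  define A where "A a = {t. \<exists>\<epsilon>>0. \<forall>s. s \<noteq> t \<and> \<bar>s - t\<bar> < \<epsilon> \<longrightarrow> z s = a}" for a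
  have op: "open (A a)" for a
    unfolding open_dist
  proof
    fix t assume "t \<in> A a"
    then obtain \<epsilon> where \<epsilon>: "\<epsilon> > 0" "\<forall>s. s \<noteq> t \<and> \<bar>s - t\<bar> < \<epsilon> \<longrightarrow> z s = a" unfolding A_def by blast
    have "y \<in> A a" if y: "dist y t < \<epsilon>" for y
    proof (cases "y = t")
      case True
      then show ?thesis using \<open>t \<in> A a\<close> by simp
    next
      case False
      \<comment> \<open>An interval of this radius around \<open>y\<close> avoids \<open>t\<close>
        and stays within \<open>\<epsilon>\<close> of it.\<close>
      define d where "d = min \<bar>y - t\<bar> (\<epsilon> - \<bar>y - t\<bar>)"
      have "d > 0" using y False by (auto simp: d_def dist_real_def)
      moreover have "z s = a" if s: "\<bar>s - y\<bar> < d" for s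
      proof -
        have "s \<noteq> t" using s by (auto simp: d_def)
        moreover have "\<bar>s - t\<bar> < \<epsilon>" using s unfolding d_def by linarith
        ultimately show ?thesis using \<epsilon>(2) by blast
      qed
      ultimately show ?thesis unfolding A_def by blast
    qed
    then show "\<exists>e>0. \<forall>y. dist y t < e \<longrightarrow> y \<in> A a" using \<epsilon>(1) by blast
  qed
  have disj: "A True \<inter> A False = {}"
  proof (rule ccontr)
    assume "A True \<inter> A False \<noteq> {}"
    then obtain t where t: "t \<in> A True" "t \<in> A False" by blast
    obtain d where d: "d > 0" "\<forall>s. s \<noteq> t \<and> \<bar>s - t\<bar> < d \<longrightarrow> z s = True" using t(1) unfolding A_def by blast
    obtain e where e: "e > 0" "\<forall>s. s \<noteq> t \<and> \<bar>s - t\<bar> < e \<longrightarrow> z s = False" using t(2) unfolding A_def by blast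
    have "t + min d e / 2 \<noteq> t" "\<bar>t + min d e / 2 - t\<bar> < d" "\<bar>t + min d e / 2 - t\<bar> < e"
      using d(1) e(1) by auto
    then show False using d(2) e(2) by blast
  qed
  have cover: "UNIV \<subseteq> A True \<union> A False"
  proof
    fix t
    obtain a where "t \<in> A a" using assms[of t] unfolding A_def by blast
    then show "t \<in> A True \<union> A False" by (cases a) auto
  qed
  have "A True \<inter> UNIV = {} \<or> A False \<inter> UNIV = {}"
    using connectedD[OF connected_UNIV op op] disj cover by blast
  then have "\<exists>a. A a = UNIV" using cover by blast
  then obtain a where "A a = UNIV" by blast
  then have "\<forall>t. t \<in> A a" by blast
  then show ?thesis unfolding A_def mem_Collect_eq by (rule exI)
qed

text \<open>The parity function \<open>y\<close> of \<open>M\<close> switches exactly where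
  \<open>x\<close> does, so their difference has no switches and takes the same value at both ends.
  As \<open>x\<close> returns to its value, so does \<open>y\<close>, which means that the count is
  even.\<close>

lemma even_switches:
  assumes M: "discrete_set M" and x: "switches_at x M"
    and per: "x (t0 + l) = x t0" "l \<ge> 0"
    and t0: "\<exists>\<epsilon>>0. \<forall>s. \<bar>s - t0\<bar> < \<epsilon> \<longrightarrow> x s = x t0" "\<exists>\<epsilon>>0. \<forall>s. \<bar>s - (t0 + l)\<bar> < \<epsilon> \<longrightarrow> x s = x (t0 + l)"
      "t0 \<notin> M" "t0 + l \<notin> M"
  shows "even (card (M \<inter> {t0<..t0 + l}))"
proof -
  obtain y :: "real \<Rightarrow> bool" where y_all: "\<forall>s t. s \<le> t \<longrightarrow> (y s \<noteq> y t \<longleftrightarrow> odd (card (M \<inter> {s<..t})))"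
    using ex_parity_function[OF M] by (rule exE)
  have y: "y s \<noteq> y t \<longleftrightarrow> odd (card (M \<inter> {s<..t}))" if "s \<le> t" for s t
    using y_all that by (elim allE impE)
  have ysw: "switches_at y M" by (rule parity_function_switches[OF M y])
  define z where "z t \<longleftrightarrow> (x t \<noteq> y t)" for t
  have "\<exists>\<epsilon>>0. \<exists>a. \<forall>s. s \<noteq> t \<and> \<bar>s - t\<bar> < \<epsilon> \<longrightarrow> z s = a" for t
  proof -
    obtain d where d: "d > 0" "\<forall>s s'. t - d < s \<and> s < t \<and> t < s' \<and> s' < t + d \<longrightarrow> (x s \<noteq> x s' \<longleftrightarrow> t \<in> M)"
      using x unfolding switches_at_def switch_def by blast
    obtain e where e: "e > 0" "\<forall>s s'. t - e < s \<and> s < t \<and> t < s' \<and> s' < t + e \<longrightarrow> (y s \<noteq> y s' \<longleftrightarrow> t \<in> M)"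
      using ysw unfolding switches_at_def switch_def by blast
    define b where "b = min d e"
    have b: "b > 0" using d e by (simp add: b_def)
    have zz: "z s = z s'" if s: "t - b < s" "s < t" "t < s'" "s' < t + b" for s s'
    proof -
      have "t - d < s" "s' < t + d" "t - e < s" "s' < t + e" using s unfolding b_def by linarith+
      then have "x s \<noteq> x s' \<longleftrightarrow> t \<in> M" "y s \<noteq> y s' \<longleftrightarrow> t \<in> M"
        using d(2) e(2) s by metis+
      then show ?thesis unfolding z_def by blast
    qed
    have "z s = z (t + b/2)" if s: "s \<noteq> t" "\<bar>s - t\<bar> < b" for s
    proof (cases "s < t")
      case True
      then show ?thesis using s b by (intro zz; linarith)
    next
      case False
      then have "z (t - b/2) = z s" using s b by (intro zz; linarith)
      moreover have "z (t - b/2) = z (t + b/2)" using b by (intro zz; linarith)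
      ultimately show ?thesis by simp
    qed
    then show ?thesis using b by blast
  qed
  then obtain a where a: "\<And>t. \<exists>\<epsilon>>0. \<forall>s. s \<noteq> t \<and> \<bar>s - t\<bar> < \<epsilon> \<longrightarrow> z s = a"
    using punctured_locally_const[of z] by blast
  have val: "z t = a" if t: "\<exists>\<epsilon>>0. \<forall>s. \<bar>s - t\<bar> < \<epsilon> \<longrightarrow> x s = x t" "t \<notin> M" for t
  proof -
    obtain d where d: "d > 0" "\<forall>s. \<bar>s - t\<bar> < d \<longrightarrow> x s = x t" using t(1) by blast
    obtain e where e: "e > 0" "\<forall>s. \<bar>s - t\<bar> < e \<longrightarrow> y s = y t"
      using parity_function_locally_const[OF M y t(2)] by blast
    obtain b where b: "b > 0" "\<forall>s. s \<noteq> t \<and> \<bar>s - t\<bar> < b \<longrightarrow> z s = a" using a by blast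
    define s where "s = t + min b (min d e) / 2"
    have "s \<noteq> t" "\<bar>s - t\<bar> < b" "\<bar>s - t\<bar> < d" "\<bar>s - t\<bar> < e"
      using b(1) d(1) e(1) unfolding s_def by auto
    then have "z s = a" "x s = x t" "y s = y t" using b(2) d(2) e(2) by blast+
    then show ?thesis unfolding z_def by blast
  qed
  have "z t0 = z (t0 + l)" using val t0 by metis
  then have "y t0 = y (t0 + l)" using per(1) unfolding z_def by metis
  then show ?thesis using y[of t0 "t0 + l"] per(2) by (metis le_add_same_cancel1)
qed

lemma periodic_cis:
  assumes per: "\<And>t. x (t + 2 * pi) = (x t :: bool)" and "cis s = cis t"
  shows "x s = x t"
proof -
  have nat: "x (t + 2 * pi * real k) = x t" for t k
  proof (induction k)
    case (Suc k)
    have "t + 2 * pi * real (Suc k) = (t + 2 * pi * real k) + 2 * pi" by (simp add: algebra_simps)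
    then show ?case using Suc per by metis
  qed simp
  have "cis (s - t) = 1" using assms(2) by (simp add: cis_divide[symmetric])
  then have "cos (s - t) = 1" by (metis cis.sel(1) one_complex.sel(1))
  then obtain k :: int where k: "s - t = of_int k * 2 * pi" using cos_one_2pi_int by auto
  show ?thesis
  proof (cases "k \<ge> 0")
    case True
    then have "s = t + 2 * pi * real (nat k)" using k by (simp add: algebra_simps)
    then show ?thesis using nat by metis
  next
    case False
    then have "t = s + 2 * pi * real (nat (- k))" using k by (simp add: algebra_simps)
    then show ?thesis using nat by metis
  qed
qed

section \<open>Potentials for markings of the components\<close>

context diagram
begin

definition chosen_chart :: "complex \<Rightarrow> real \<times> (complex \<Rightarrow> complex)" where
  "chosen_chart c = (SOME p. \<exists>i t j u e e'. crossing_chart c (fst p) (snd p) i t j u e e')"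

definition \<rho> :: "complex \<Rightarrow> real" where "\<rho> c = fst (chosen_chart c)"

definition \<kappa> :: "complex \<Rightarrow> complex \<Rightarrow> complex" where "\<kappa> c = snd (chosen_chart c)"

lemma crossing_chart_chosen:
  assumes "c \<in> C"
  shows "\<exists>i t j u e e'. crossing_chart c (\<rho> c) (\<kappa> c) i t j u e e'"
proof -
  have "\<exists>p. \<exists>i t j u e e'. crossing_chart c (fst p) (snd p) i t j u e e'"
    using ex_crossing_chart[OF assms] by simp
  then show ?thesis unfolding \<rho>_def \<kappa>_def chosen_chart_def by (rule someI_ex)
qed

sublocale crossed_set "projection D" "crossings D" \<rho> \<kappa>
proof
  show "bounded P" "closed P" using compact_P compact_imp_bounded compact_imp_closed by blast+
  show "C \<subseteq> P" by (rule C_sub_P)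
  show "\<exists>r k. arc_chart P m r k" if "m \<in> P" "m \<notin> C" for m by (rule ex_arc_chart[OF that])
  show "cross_chart P c (\<rho> c) (\<kappa> c)" if "c \<in> C" for c
    using crossing_chart_chosen[OF that] unfolding crossing_chart_def by blast
  show "\<kappa> c w \<notin> C" if "c \<in> C" "w \<in> ball 0 (\<rho> c)" "w \<noteq> 0" for c w
    using crossing_chart_chosen[OF that(1)] that(2,3) unfolding crossing_chart_def by blast
qed

text \<open>Periodicity of the components. It allows the angle stored in a chart to be replaced by
  the one at hand.\<close>

lemma strand_cong_cis:
  assumes st: "strand k e i t" and eq: "cis t = cis t'"
  shows "strand k e i t'"
  unfolding strand_def
proof (intro allI impI)
  fix \<epsilon> :: real assume "\<epsilon> > 0"
  then obtain \<delta> where \<delta>: "\<delta> > 0" "\<And>s. 0 < s \<Longrightarrow> s < \<delta> \<Longrightarrow> reached k e i t \<epsilon> s"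
    using st unfolding strand_def by metis
  have sh: "G i (r + (t' - t)) = G i r" for r
    unfolding G_def using eq by (simp add: cis_mult[symmetric] cis_divide[symmetric])
  have "reached k e i t' \<epsilon> s" if s: "0 < s" "s < \<delta>" for s
  proof -
    obtain r q where r: "t < r" "r < t + \<epsilon>" "G i r = k (of_real s * e)"
      and q: "t - \<epsilon> < q" "q < t" "G i q = k (- of_real s * e)" using \<delta>(2)[OF s] unfolding reached_def by metis
    show ?thesis
      unfolding reached_def
    proof
      show "\<exists>r. t' < r \<and> r < t' + \<epsilon> \<and> G i r = k (of_real s * e)"
        using r sh[of r] by (intro exI[of _ "r + (t' - t)"]) auto
      show "\<exists>r. t' - \<epsilon> < r \<and> r < t' \<and> G i r = k (- of_real s * e)"
        using q sh[of q] by (intro exI[of _ "q + (t' - t)"]) auto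
    qed
  qed
  then show "\<exists>\<delta>>0. \<forall>s. 0 < s \<and> s < \<delta> \<longrightarrow> reached k e i t' \<epsilon> s"
    using \<delta>(1) by blast
qed

text \<open>Carries a switch from the parameter line into the chart: on the ray in direction
  \<open>e\<close> the strand has passed \<open>t\<close>, on the opposite ray it has not yet, so
  the marks of these rays differ iff the strand switches.\<close>

lemma strand_values:
  assumes c: "c \<in> C" and st: "strand (\<kappa> c) e i t" and e: "cmod e = 1"
    and sw: "\<epsilon> > 0" "\<And>s s'. t - \<epsilon> < s \<Longrightarrow> s < t \<Longrightarrow> t < s' \<Longrightarrow> s' < t + \<epsilon> \<Longrightarrow> (y s \<noteq> y s' \<longleftrightarrow> b)"
    and g: "\<And>s. G i s \<notin> C \<Longrightarrow> g (G i s) = y s"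
  shows "\<exists>\<delta>>0. \<exists>a. \<forall>s. 0 < s \<and> s < \<delta> \<longrightarrow>
    g (\<kappa> c (of_real s * e)) = a \<and> g (\<kappa> c (- of_real s * e)) = (a \<noteq> b)"
proof -
  obtain \<delta> where \<delta>: "\<delta> > 0" "\<And>s. 0 < s \<Longrightarrow> s < \<delta> \<Longrightarrow> reached (\<kappa> c) e i t \<epsilon> s"
    using st sw(1) unfolding strand_def by metis
  define a where "a = y (t + \<epsilon>/2)"
  have left: "y s = (a \<noteq> b)" if "t - \<epsilon> < s" "s < t" for s
    using sw(2)[of s "t + \<epsilon>/2"] that sw(1) unfolding a_def by auto
  have right: "y s = a" if "t < s" "s < t + \<epsilon>" for s
    using sw(2)[of "t - \<epsilon>/2" s] left[of "t - \<epsilon>/2"] that sw(1) by auto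
  have off: "\<kappa> c (of_real s * e) \<notin> C" if "s \<noteq> 0" "\<bar>s\<bar> < \<rho> c" for s
  proof (rule isolated[OF c])
    have "e \<noteq> 0" using e by auto
    then show "of_real s * e \<noteq> 0" using that by simp
    show "of_real s * e \<in> ball 0 (\<rho> c)" using that e by (simp add: norm_mult)
  qed
  have "g (\<kappa> c (of_real s * e)) = a \<and> g (\<kappa> c (- of_real s * e)) = (a \<noteq> b)"
    if s: "0 < s" "s < min \<delta> (\<rho> c)" for s
  proof -
    have "reached (\<kappa> c) e i t \<epsilon> s" using \<delta>(2) s by simp
    then obtain r q where r: "t < r" "r < t + \<epsilon>" "G i r = \<kappa> c (of_real s * e)"
      and q: "t - \<epsilon> < q" "q < t" "G i q = \<kappa> c (- of_real s * e)" unfolding reached_def by metis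
    have "G i r \<notin> C" "G i q \<notin> C" using off[of s] off[of "- s"] s r(3) q(3) by auto
    then show ?thesis using g[of r] g[of q] r q left right by metis
  qed
  then show ?thesis using \<delta>(1) \<rho>_pos[OF c] by (intro exI[of _ "min \<delta> (\<rho> c)"] exI[of _ a] conjI) simp_all
qed

lemma i_power_cases: "\<i> ^ j \<in> {1, \<i>, -1, - \<i>}"
  by (induction j) auto

text \<open>Marking the arcs by \<open>x\<close> gives a cycle modulo 2: at a crossing either both strands switch or none.\<close>

lemma ex_potential:
  assumes per: "\<And>i s t. i < n \<Longrightarrow> cis s = cis t \<Longrightarrow> x i s = x i t"
    and loc: "\<And>i t. i < n \<Longrightarrow> G i t \<notin> C \<Longrightarrow> \<exists>\<epsilon>>0. \<forall>s. \<bar>s - t\<bar> < \<epsilon> \<longrightarrow> x i s = x i t"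
    and sw: "\<And>i. i < n \<Longrightarrow> switches_at (x i) {t. G i t \<in> Q}"
  shows "\<exists>f. (\<forall>w. w \<notin> P \<longrightarrow> const_near P f w) \<and>
    (\<forall>i t. i < n \<longrightarrow> G i t \<notin> C \<longrightarrow> (const_near P f (G i t) \<longleftrightarrow> \<not> x i t))"
proof -
  \<comment> \<open>The marking is moved from parameters to points. Off the crossings a point has
    only one parameter up to full turns, so it is well defined there.\<close>
  define X where "X m \<longleftrightarrow> (\<exists>i t. i < n \<and> m = G i t \<and> x i t)" for m
  have X: "X (G i t) = x i t" if it: "i < n" "G i t \<notin> C" for i t
    unfolding X_def using G_eq_noncrossing[OF it(1) _ _ it(2)] per it by metis
  have "\<exists>f. flips_along X UNIV f"
  proof (rule ex_flips_along, goal_cases)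
    case (1 m)
    note m = 1
    obtain i t where i: "i < n" "m = G i t" by (rule P_cases[OF m(1)])
    obtain \<epsilon> where \<epsilon>: "\<epsilon> > 0" "\<forall>s. \<bar>s - t\<bar> < \<epsilon> \<longrightarrow> x i s = x i t" using loc i m by metis
    obtain B where B: "open B" "cis t \<in> B"
      "\<And>z. z \<in> B \<Longrightarrow> z \<in> sphere 0 1 \<Longrightarrow> \<exists>s. \<bar>s - t\<bar> < \<epsilon> \<and> z = cis s"
      using cis_arc_neighbourhood[OF \<epsilon>(1), of t] by metis
    have fib: "fibre D m = {(i, cis t)}"
      using mem_fibre[OF i(1), of t] m(2) i(2) unfolding crossings_def by blast
    obtain T where T: "open T" "m \<in> T"
      "\<forall>j<n. \<forall>z\<in>sphere 0 1. curve D j z \<in> T \<longrightarrow> (\<exists>p\<in>fibre D m. fst p = j \<and> z \<in> B)"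
      using fibre_neighbourhood[of m "\<lambda>_. B"] B(1,2) fib by auto
    have "X m' = X m" if m': "m' \<in> T" "m' \<in> P" "m' \<notin> C" for m'
    proof -
      obtain j s where j: "j < n" "m' = G j s" by (rule P_cases[OF m'(2)])
      have "j = i" "cis s \<in> B" using T(3)[rule_format, OF j(1), of "cis s"] m'(1) j(2) fib unfolding G_def by auto
      then obtain r where "\<bar>r - t\<bar> < \<epsilon>" "cis s = cis r" using B(3)[of "cis s"] by auto
      then have "x j s = x i t" using \<epsilon>(2) per[OF i(1)] \<open>j = i\<close> by metis
      then show ?thesis using X j i m m' by metis
    qed
    then show ?case
      using T(1,2) by (intro exI[of _ T]) simp
  next
    case c: (2 c)
    obtain i t j u e e' where ch: "crossing_chart c (\<rho> c) (\<kappa> c) i t j u e e'"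
      using crossing_chart_chosen[OF c] by blast
    then have ij: "i < n" "j < n" and fib: "fibre D c = {(i, cis t), (j, cis u)}"
      and ee: "e \<in> {1, -1}" "e' \<in> {\<i>, -\<i>}" and st: "strand (\<kappa> c) e i t" "strand (\<kappa> c) e' j u"
      unfolding crossing_chart_def by auto
    have "(i, cis t) \<in> fibre D c" "(j, cis u) \<in> fibre D c" using fib by auto
    then have Gc: "G i t = c" "G j u = c" unfolding fibre_def point_at_def G_def by simp_all
    define b where "b \<longleftrightarrow> c \<in> Q"
    obtain \<epsilon> where \<epsilon>: "\<epsilon> > 0" "\<And>s s'. t - \<epsilon> < s \<Longrightarrow> s < t \<Longrightarrow> t < s' \<Longrightarrow> s' < t + \<epsilon> \<Longrightarrow> (x i s \<noteq> x i s' \<longleftrightarrow> b)"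
      using sw[OF ij(1), unfolded switches_at_def switch_def] Gc(1) unfolding b_def mem_Collect_eq by metis
    obtain \<eta> where \<eta>: "\<eta> > 0" "\<And>s s'. u - \<eta> < s \<Longrightarrow> s < u \<Longrightarrow> u < s' \<Longrightarrow> s' < u + \<eta> \<Longrightarrow> (x j s \<noteq> x j s' \<longleftrightarrow> b)"
      using sw[OF ij(2), unfolded switches_at_def switch_def] Gc(2) unfolding b_def mem_Collect_eq by metis
    have "cmod e = 1" "cmod e' = 1" using ee by auto
    have "\<exists>d>0. \<exists>a. \<forall>s. 0 < s \<and> s < d \<longrightarrow>
        X (\<kappa> c (of_real s * e)) = a \<and> X (\<kappa> c (- of_real s * e)) = (a \<noteq> b)"
      by (rule strand_values[where g = X and y = "x i" and b = b, OF c st(1) \<open>cmod e = 1\<close> \<epsilon>(1)],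
          erule (3) \<epsilon>(2), erule X[OF ij(1)])
    then obtain d a where d: "d > 0" "\<forall>s. 0 < s \<and> s < d \<longrightarrow>
        X (\<kappa> c (of_real s * e)) = a \<and> X (\<kappa> c (- of_real s * e)) = (a \<noteq> b)" by (elim exE conjE)
    have "\<exists>d>0. \<exists>a. \<forall>s. 0 < s \<and> s < d \<longrightarrow>
        X (\<kappa> c (of_real s * e')) = a \<and> X (\<kappa> c (- of_real s * e')) = (a \<noteq> b)"
      by (rule strand_values[where g = X and y = "x j" and b = b, OF c st(2) \<open>cmod e' = 1\<close> \<eta>(1)],
          erule (3) \<eta>(2), erule X[OF ij(2)])
    then obtain d' a' where d': "d' > 0" "\<forall>s. 0 < s \<and> s < d' \<longrightarrow>
        X (\<kappa> c (of_real s * e')) = a' \<and> X (\<kappa> c (- of_real s * e')) = (a' \<noteq> b)" by (elim exE conjE)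
    define m where "m = min d d'"
    have m: "m > 0" using d(1) d'(1) by (simp add: m_def)
    \<comment> \<open>The mark of the ray in direction \<open>z\<close>. It is the same at every
      radius below \<open>m\<close> and is read at half of it.\<close>
    define v where "v z \<longleftrightarrow> X (\<kappa> c (of_real (m/2) * z))" for z
    have ray: "X (\<kappa> c (of_real s * z)) = v z" if s: "0 < s" "s < m" and z: "z \<in> {1, \<i>, -1, -\<i>}" for s z
    proof -
      have m2: "0 < m/2" "m/2 < d" "m/2 < d'" "s < d" "s < d'" using m s by (auto simp: m_def)
      have "z = e \<or> z = - e \<or> z = e' \<or> z = - e'" using z ee by auto
      moreover have "X (\<kappa> c (of_real s * e)) = v e" "X (\<kappa> c (- of_real s * e)) = v (- e)"
        using d(2)[rule_format, of s] d(2)[rule_format, of "m/2"] m2 s unfolding v_def by simp_all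
      moreover have "X (\<kappa> c (of_real s * e')) = v e'" "X (\<kappa> c (- of_real s * e')) = v (- e')"
        using d'(2)[rule_format, of s] d'(2)[rule_format, of "m/2"] m2 s unfolding v_def by simp_all
      ultimately show ?thesis by auto
    qed
    have m2: "0 < m/2 \<and> m/2 < d" "0 < m/2 \<and> m/2 < d'" using m by (auto simp: m_def)
    have "(v e \<noteq> v (- e)) = b" "(v e' \<noteq> v (- e')) = b"
      using d(2)[rule_format, OF m2(1)] d'(2)[rule_format, OF m2(2)] unfolding v_def by auto
    then have "(v 1 \<noteq> v (-1)) = b" "(v \<i> \<noteq> v (-\<i>)) = b" using ee by auto
    \<comment> \<open>For either strand the two opposite rays differ iff \<open>c\<close> is in
      \<open>Q\<close>; equality of the two answers is the cycle condition.\<close>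
    then have ev: "v (\<i> ^ 0) \<noteq> v (\<i> ^ 2) \<longleftrightarrow> v (\<i> ^ 1) \<noteq> v (\<i> ^ 3)" by (auto simp: numeral_3_eq_3)
    have "\<forall>j s. 0 < s \<and> s < m \<longrightarrow> X (\<kappa> c (of_real s * \<i> ^ j)) = v (\<i> ^ j)"
      using ray i_power_cases by blast
    then show ?case
      using m ev by (intro exI[of _ m] exI[of _ "\<lambda>j. v (\<i> ^ j)"] conjI)
  qed
  then obtain f where f: "flips_along X UNIV f" by (rule exE)
  show ?thesis
  proof (intro exI[of _ f] conjI allI impI)
    show "const_near P f w" if "w \<notin> P" for w using f that unfolding flips_along_def by simp
    show "const_near P f (G i t) \<longleftrightarrow> \<not> x i t" if "i < n" "G i t \<notin> C" for i t
      using f X[OF that] G_in_P[OF that(1)] that(2) unfolding flips_along_def by simp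
  qed
qed

section \<open>Corner sums as switches along the components\<close>

definition corner_sum :: "(complex \<Rightarrow> bool) \<Rightarrow> complex \<Rightarrow> bool" where
  "corner_sum f c \<longleftrightarrow> (f (corner c 0) \<noteq> f (corner c 1)) \<noteq> (f (corner c 2) \<noteq> f (corner c 3))"

lemma const_near_locally_const:
  assumes i: "i < n" "G i t \<notin> C" and f: "\<And>w. w \<notin> P \<Longrightarrow> const_near P f w"
  shows "\<exists>\<epsilon>>0. \<forall>s. \<bar>s - t\<bar> < \<epsilon> \<longrightarrow> const_near P f (G i s) = const_near P f (G i t)"
proof -
  obtain r k where k: "arc_chart P (G i t) r k" using arcs[OF G_in_P[OF i(1)] i(2)] by blast
  then have dk: "disc_chart (G i t) r k" and kP: "\<And>w. w \<in> ball 0 r \<Longrightarrow> k w \<in> P \<longleftrightarrow> Im w = 0"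
    by (auto simp: arc_chart_def)
  have "\<exists>a b. chart_sides P r k f a b"
    by (rule arc_chart_sides[OF k f])
  then obtain a b where ab: "chart_sides P r k f a b" by (elim exE)
  let ?N = "k ` ball 0 r"
  have val: "const_near P f m \<longleftrightarrow> a = b" if m: "m \<in> ?N" "m \<in> P" for m
  proof -
    obtain w where w: "w \<in> ball 0 r" "m = k w" using m(1) by blast
    then have "Im w = 0" using kP m(2) by blast
    then show ?thesis using chart_sidesD(3)[OF ab w(1)] w(2) by simp
  qed
  have "open ?N" by (rule open_chart_image[OF dk]) auto
  then have "open (G i -` ?N)" using cont_G[OF i(1)] by (rule open_vimage)
  moreover have "G i t \<in> ?N" using dk unfolding disc_chart_def by (metis centre_in_ball imageI)
  ultimately obtain \<epsilon> where \<epsilon>: "\<epsilon> > 0" "ball t \<epsilon> \<subseteq> G i -` ?N"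
    using open_contains_ball by (metis vimageI)
  have "const_near P f (G i s) = const_near P f (G i t)" if s: "\<bar>s - t\<bar> < \<epsilon>" for s
  proof -
    have "s \<in> ball t \<epsilon>" using s by (simp add: dist_real_def abs_minus_commute)
    then have "G i s \<in> ?N" using \<epsilon>(2) by blast
    then show ?thesis using val[of "G i s"] val[of "G i t"] \<open>G i t \<in> ?N\<close> G_in_P[OF i(1)] by simp
  qed
  then show ?thesis using \<epsilon>(1) by blast
qed

text \<open>The strand arrives along ray \<open>j + 2\<close> and leaves along ray \<open>j\<close>.
  Whether \<open>f\<close> flips across it compares the corners \<open>j + 2\<close> and
  \<open>j + 1\<close> on arrival, and \<open>j\<close> and \<open>j + 3\<close> on departure, so
  the change between the two is the sum over all four corners.\<close>

lemma corner_sum_switch: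
  assumes i: "i < n" and c: "G i t \<in> C" and f: "\<And>w. w \<notin> P \<Longrightarrow> const_near P f w"
  shows "switch (\<lambda>s. const_near P f (G i s)) t (corner_sum f (G i t))"
proof -
  define c where "c = G i t"
  have cC: "c \<in> C" using c c_def by simp
  define y where "y s = const_near P f (G i s)" for s
  obtain i1 t1 j1 u1 e1 e2 where ch: "crossing_chart c (\<rho> c) (\<kappa> c) i1 t1 j1 u1 e1 e2"
    using crossing_chart_chosen[OF cC] by blast
  have "(i, cis t) \<in> fibre D c" using mem_fibre[OF i] c_def by simp
  then have "(i = i1 \<and> cis t = cis t1) \<or> (i = j1 \<and> cis t = cis u1)"
    using ch unfolding crossing_chart_def by auto
  then have "\<exists>e\<in>{e1, e2}. strand (\<kappa> c) e i t"
    using ch strand_cong_cis unfolding crossing_chart_def by (metis insertI1 insertI2)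
  moreover have "{e1, e2} \<subseteq> {\<i> ^ 0, \<i> ^ 1, \<i> ^ 2, \<i> ^ 3}"
    using ch unfolding crossing_chart_def by (auto simp: numeral_3_eq_3)
  ultimately obtain j where j: "j \<in> {0, 1, 2, 3}" and st: "strand (\<kappa> c) (\<i> ^ j) i t" by blast
  obtain \<epsilon> where \<epsilon>: "0 < \<epsilon>" "\<epsilon> \<le> 1" "\<And>s. s \<noteq> t \<Longrightarrow> \<bar>s - t\<bar> < \<epsilon> \<Longrightarrow> G i s \<notin> C"
    using isolated_params[OF i, of t] by metis
  have const: "y s = y s'" if S: "connected S" "t \<notin> S" "S \<subseteq> {t - \<epsilon><..<t + \<epsilon>}" "s \<in> S" "s' \<in> S" for S s s'
  proof (rule connected_local_const[OF S(1,4,5)])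
    show "\<forall>a\<in>S. \<forall>\<^sub>F b in at a within S. y a = y b"
    proof
      fix a assume "a \<in> S"
      then have "a \<noteq> t" "a \<in> {t - \<epsilon><..<t + \<epsilon>}" using S(2,3) by blast+
      then have "a \<noteq> t" "\<bar>a - t\<bar> < \<epsilon>" by auto
      then have "\<exists>d>0. \<forall>s. \<bar>s - a\<bar> < d \<longrightarrow> y s = y a"
        unfolding y_def by (intro const_near_locally_const[OF i \<epsilon>(3) f])
      then obtain d where d: "d > 0" "\<forall>s. \<bar>s - a\<bar> < d \<longrightarrow> y s = y a" by (elim exE conjE)
      have "\<forall>x\<in>S. x \<noteq> a \<and> dist x a < d \<longrightarrow> y a = y x"
        using d(2) unfolding dist_real_def by metis
      then show "\<forall>\<^sub>F b in at a within S. y a = y b"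
        unfolding eventually_at using d(1) by (intro exI[of _ d] conjI)
    qed
  qed
  obtain \<delta> where \<delta>: "\<delta> > 0" "\<And>s. 0 < s \<Longrightarrow> s < \<delta> \<Longrightarrow> reached (\<kappa> c) (\<i> ^ j) i t \<epsilon> s"
    using st \<epsilon>(1) unfolding strand_def by metis
  define s0 where "s0 = min \<delta> (\<rho> c) / 2"
  have s0: "0 < s0" "s0 < \<delta>" "s0 < \<rho> c" using \<delta>(1) \<rho>_pos[OF cC] by (auto simp: s0_def)
  obtain r q where r: "t < r" "r < t + \<epsilon>" "G i r = \<kappa> c (of_real s0 * \<i> ^ j)"
    and q: "t - \<epsilon> < q" "q < t" "G i q = \<kappa> c (- of_real s0 * \<i> ^ j)"
    using \<delta>(2)[OF s0(1,2)] unfolding reached_def by metis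
  have neg: "- of_real s0 * \<i> ^ j = of_real s0 * \<i> ^ (j + 2)" by (simp add: power_add)
  have yr: "y r \<longleftrightarrow> f (corner c j) = f (corner c (j + 3))"
    unfolding y_def r(3) by (rule const_near_ray[OF cC f s0(1,3)])
  have yq: "y q \<longleftrightarrow> f (corner c (j + 2)) = f (corner c (j + 2 + 3))"
    unfolding y_def q(3) neg by (rule const_near_ray[OF cC f s0(1,3)])
  have mods: "corner c 4 = corner c 0" "corner c 5 = corner c 1" "corner c 6 = corner c 2"
    "corner c 7 = corner c 3" "corner c 8 = corner c 0"
    using corner_mod[of c 0] corner_mod[of c 1] corner_mod[of c 2] corner_mod[of c 3] corner_mod[of c 4] by simp_all
  have qr: "y q \<noteq> y r \<longleftrightarrow> corner_sum f c"
    using j yr yq mods unfolding corner_sum_def by (elim insertE emptyE) (simp_all add: numeral_eq_Suc, blast+)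
  have "y s \<noteq> y s' \<longleftrightarrow> corner_sum f c" if s: "t - \<epsilon> < s" "s < t" "t < s'" "s' < t + \<epsilon>" for s s'
  proof -
    have "y s = y q" by (rule const[of "{t - \<epsilon><..<t}"]) (use s q in auto)
    moreover have "y s' = y r" by (rule const[of "{t<..<t + \<epsilon>}"]) (use s r in auto)
    ultimately show ?thesis using qr by simp
  qed
  then show ?thesis using \<epsilon>(1) unfolding switch_def y_def c_def by blast
qed

lemma discrete_params: "i < n \<Longrightarrow> Q \<subseteq> C \<Longrightarrow> discrete_set {t. G i t \<in> Q}"
  unfolding discrete_set_def
proof
  fix t assume i: "i < n" "Q \<subseteq> C"
  obtain e where e: "0 < e" "\<And>s. s \<noteq> t \<Longrightarrow> \<bar>s - t\<bar> < e \<Longrightarrow> G i s \<notin> C"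
    using isolated_params[OF i(1), of t] by metis
  then show "\<exists>\<epsilon>>0. \<forall>s. s \<noteq> t \<and> \<bar>s - t\<bar> < \<epsilon> \<longrightarrow> s \<notin> {t. G i t \<in> Q}"
    using i(2) by (intro exI[of _ e]) auto
qed

text \<open>The interval is half-open, so that every point of the circle has exactly one angle in
  it.\<close>

lemma card_params:
  "card ({t. G i t \<in> Q} \<inter> {t0<..t0 + 2 * pi}) = card {z \<in> sphere 0 1. curve D i z \<in> Q}"
proof (rule bij_betw_same_card[of cis])
  have "inj_on cis ({t. G i t \<in> Q} \<inter> {t0<..t0 + 2 * pi})"
    by (rule inj_onI, rule cis_near_inj) auto
  moreover have "z \<in> cis ` ({t. G i t \<in> Q} \<inter> {t0<..t0 + 2 * pi})"
    if z: "z \<in> sphere 0 1" "curve D i z \<in> Q" for z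
  proof -
    obtain y where y: "z = cis y" using sphere_cis z(1) by blast
    obtain k :: int where k: "t0 < y + 2 * pi * k" "y + 2 * pi * k \<le> t0 + 2 * pi"
      using ex_shift_2pi by blast
    have zk: "z = cis (y + 2 * pi * k)" using y cis_shift by simp
    then have "G i (y + 2 * pi * k) \<in> Q" using z(2) unfolding G_def by simp
    then show ?thesis using k zk by (intro image_eqI[of z cis "y + 2 * pi * k"]) simp_all
  qed
  moreover have "cis t \<in> {z \<in> sphere 0 1. curve D i z \<in> Q}" if "G i t \<in> Q" for t
    using that unfolding G_def by simp
  ultimately show "bij_betw cis ({t. G i t \<in> Q} \<inter> {t0<..t0 + 2 * pi}) {z \<in> sphere 0 1. curve D i z \<in> Q}"
    unfolding bij_betw_def by blast
qed

text \<open>Followed once around the closed component, the flipping behaviour of \<open>f\<close>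
  returns to its initial state, so it switches an even number of times; by
  \<open>corner_sum_switch\<close> it does so at the odd corner sums.\<close>

lemma even_corner_sum:
  assumes i: "i < n" and f: "\<And>w. w \<notin> P \<Longrightarrow> const_near P f w"
  shows "even (card {z \<in> sphere 0 1. curve D i z \<in> {c \<in> C. corner_sum f c}})"
proof -
  let ?Q = "{c \<in> C. corner_sum f c}"
  let ?x = "\<lambda>t. const_near P f (G i t)"
  obtain e where e: "0 < e" "\<And>s. s \<noteq> 0 \<Longrightarrow> \<bar>s - 0\<bar> < e \<Longrightarrow> G i s \<notin> C"
    using isolated_params[OF i, of 0] by metis
  \<comment> \<open>A base parameter that is not over a crossing, as \<open>even_switches\<close>
    requires.\<close>
  define t0 where "t0 = e/2"
  have t0: "G i t0 \<notin> C" using e(1) by (intro e(2)) (auto simp: t0_def)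
  have per: "G i (t0 + 2 * pi) = G i t0" unfolding G_def using cis_shift[of t0 1] by simp
  have sw: "switches_at ?x {t. G i t \<in> ?Q}"
    unfolding switches_at_def
  proof
    fix t
    show "switch ?x t (t \<in> {t. G i t \<in> ?Q})"
    proof (cases "G i t \<in> C")
      case True
      then show ?thesis using corner_sum_switch[OF i True f] by simp
    next
      case False
      have "\<exists>d>0. \<forall>s. \<bar>s - t\<bar> < d \<longrightarrow> ?x s = ?x t"
        by (rule const_near_locally_const[OF i False f])
      then obtain d where d: "d > 0" "\<forall>s. \<bar>s - t\<bar> < d \<longrightarrow> ?x s = ?x t" by (elim exE conjE)
      have "?x s = ?x s'" if "t - d < s" "s < t" "t < s'" "s' < t + d" for s s'
        using d(2)[rule_format, of s] d(2)[rule_format, of s'] that by auto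
      then show ?thesis using False d(1) unfolding switch_def by (intro exI[of _ d]) auto
    qed
  qed
  have loc: "\<exists>\<epsilon>>0. \<forall>s. \<bar>s - t\<bar> < \<epsilon> \<longrightarrow> ?x s = ?x t" if "G i t \<notin> C" for t
    by (rule const_near_locally_const[OF i that f])
  have "even (card ({t. G i t \<in> ?Q} \<inter> {t0<..t0 + 2 * pi}))"
  proof (rule even_switches[OF _ sw])
    show "discrete_set {t. G i t \<in> ?Q}" by (rule discrete_params[OF i]) blast
    show "?x (t0 + 2 * pi) = ?x t0" using per by simp
    show "\<exists>\<epsilon>>0. \<forall>s. \<bar>s - t0\<bar> < \<epsilon> \<longrightarrow> ?x s = ?x t0" by (rule loc[OF t0])
    show "\<exists>\<epsilon>>0. \<forall>s. \<bar>s - (t0 + 2 * pi)\<bar> < \<epsilon> \<longrightarrow> ?x s = ?x (t0 + 2 * pi)"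
      using t0 per by (intro loc) simp
  qed (use t0 per in auto)
  then show ?thesis by (simp only: card_params)
qed

text \<open>An arc is marked by the parity of the passages through \<open>Q\<close> up to it. This
  is consistent on a closed component since a full turn has an even number of passages. The corner
  sums of the potential are read off from the marks just before and just after a crossing.\<close>

lemma ex_corner_sum:
  assumes Q: "Q \<subseteq> C" and ev: "\<And>i. i < n \<Longrightarrow> even (card {z \<in> sphere 0 1. curve D i z \<in> Q})"
  shows "\<exists>f. (\<forall>w. w \<notin> P \<longrightarrow> const_near P f w) \<and> (\<forall>c\<in>C. corner_sum f c \<longleftrightarrow> c \<in> Q)"
proof -
  let ?M = "\<lambda>i. {t. G i t \<in> Q}"
  have "\<exists>x :: real \<Rightarrow> bool. \<forall>s t. s \<le> t \<longrightarrow> (x s \<noteq> x t \<longleftrightarrow> odd (card (?M i \<inter> {s<..t})))" if "i < n" for i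
    using ex_parity_function[OF discrete_params[OF that Q]] .
  then obtain x :: "nat \<Rightarrow> real \<Rightarrow> bool" where
    x: "\<And>i s t. i < n \<Longrightarrow> s \<le> t \<Longrightarrow> (x i s \<noteq> x i t \<longleftrightarrow> odd (card (?M i \<inter> {s<..t})))"
    by metis
  have per: "x i s = x i t" if i: "i < n" and st: "cis s = cis t" for i s t
  proof (rule periodic_cis[OF _ st])
    show "x i (t + 2 * pi) = x i t" for t
      using x[OF i, of t "t + 2 * pi"] ev[OF i] card_params[of i Q t] by auto
  qed
  have sw: "switches_at (x i) (?M i)" if i: "i < n" for i
    by (rule parity_function_switches[OF discrete_params[OF i Q] x[OF i]])
  have loc: "\<exists>\<epsilon>>0. \<forall>s. \<bar>s - t\<bar> < \<epsilon> \<longrightarrow> x i s = x i t" if i: "i < n" "G i t \<notin> C" for i t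
    by (rule parity_function_locally_const[OF discrete_params[OF i(1) Q] x[OF i(1)]]) (use i(2) Q in auto)
  obtain f where f: "\<And>w. w \<notin> P \<Longrightarrow> const_near P f w"
    and fx: "\<And>i t. i < n \<Longrightarrow> G i t \<notin> C \<Longrightarrow> (const_near P f (G i t) \<longleftrightarrow> \<not> x i t)"
    using ex_potential[OF per loc sw] by blast
  have "corner_sum f c \<longleftrightarrow> c \<in> Q" if c: "c \<in> C" for c
  proof -
    obtain i t where i: "i < n" "c = G i t" using c C_sub_P by (blast intro: P_cases)
    have "G i t \<in> C" using c i by simp
    obtain \<epsilon> where \<epsilon>: "\<epsilon> > 0" "\<forall>s s'. t - \<epsilon> < s \<and> s < t \<and> t < s' \<and> s' < t + \<epsilon> \<longrightarrow>
      (const_near P f (G i s) \<noteq> const_near P f (G i s') \<longleftrightarrow> corner_sum f (G i t))"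
      using corner_sum_switch[OF i(1) \<open>G i t \<in> C\<close> f] unfolding switch_def by blast
    obtain \<eta> where \<eta>: "\<eta> > 0" "\<forall>s s'. t - \<eta> < s \<and> s < t \<and> t < s' \<and> s' < t + \<eta> \<longrightarrow>
      (x i s \<noteq> x i s' \<longleftrightarrow> t \<in> ?M i)"
      using sw[OF i(1)] unfolding switches_at_def switch_def by blast
    obtain e where e: "0 < e" "\<And>s. s \<noteq> t \<Longrightarrow> \<bar>s - t\<bar> < e \<Longrightarrow> G i s \<notin> C"
      using isolated_params[OF i(1), of t] by metis
    define d where "d = min e (min \<epsilon> \<eta>) / 2"
    have d: "0 < d" "d < e" "d < \<epsilon>" "d < \<eta>" using e(1) \<epsilon>(1) \<eta>(1) by (auto simp: d_def)
    have "G i (t - d) \<notin> C" "G i (t + d) \<notin> C"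
      by (rule e(2); use d in simp)+
    then have "const_near P f (G i (t - d)) \<longleftrightarrow> \<not> x i (t - d)" "const_near P f (G i (t + d)) \<longleftrightarrow> \<not> x i (t + d)"
      using fx[OF i(1)] by blast+
    moreover have "const_near P f (G i (t - d)) \<noteq> const_near P f (G i (t + d)) \<longleftrightarrow> corner_sum f (G i t)"
      using \<epsilon>(2)[rule_format, of "t - d" "t + d"] d by simp
    moreover have "x i (t - d) \<noteq> x i (t + d) \<longleftrightarrow> c \<in> Q"
      using \<eta>(2)[rule_format, of "t - d" "t + d"] d i(2) by simp
    ultimately show ?thesis unfolding i(2) by metis
  qed
  then show ?thesis using f by blast
qed

end

section \<open>Separating curves at reducible crossings\<close>

lemma connected_inside_or_outside:
  assumes "connected A" "A \<inter> S = {}"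
  shows "A \<subseteq> inside S \<or> A \<subseteq> outside S"
proof -
  have "A \<subseteq> inside S \<union> outside S" using assms(2) union_with_inside[of S] union_with_outside[of S] inside_outside[of S] by blast
  then show ?thesis using inside_outside_intersect_connected[OF assms(1), of S] assms(2) by blast
qed

text \<open>The curve follows the diagonal through the crossing from quadrant 2 to quadrant 0 and
  returns by an arc in \<open>R\<close>. Near \<open>c\<close> it is just the diagonal, so the
  Jordan curve theorem puts the half discs beside the diagonal on different sides. Quadrants 1 and 3
  miss the curve and inherit these sides.\<close>

lemma chart_double_region:
  assumes k: "cross_chart P c r k" and R: "open R" "connected R" "R \<inter> P = {}"
    and Q02: "\<And>v. v \<in> ball 0 r \<Longrightarrow> Re v > 0 \<Longrightarrow> Im v > 0 \<Longrightarrow> k v \<in> R \<and> k (- v) \<in> R"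
    and Q13: "\<And>v. v \<in> ball 0 r \<Longrightarrow> Re v > 0 \<Longrightarrow> Im v > 0 \<Longrightarrow> k (v * \<i> ^ 1) \<notin> R \<and> k (v * \<i> ^ 3) \<notin> R"
    and c: "c \<in> P"
  shows "\<exists>\<gamma>. simple_path \<gamma> \<and> pathfinish \<gamma> = pathstart \<gamma> \<and> path_image \<gamma> \<subseteq> insert c R \<and> c \<in> path_image \<gamma> \<and>
    (quadrant_point k r 1 \<in> inside (path_image \<gamma>) \<and> quadrant_point k r 3 \<in> outside (path_image \<gamma>) \<or>
     quadrant_point k r 3 \<in> inside (path_image \<gamma>) \<and> quadrant_point k r 1 \<in> outside (path_image \<gamma>))"
proof -
  have dk: "disc_chart c r k" using k by (simp add: cross_chart_def)
  then have r: "r > 0" and k0: "k 0 = c" and ck: "continuous_on (ball 0 r) k" and inj: "inj_on k (ball 0 r)"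
    by (auto simp: disc_chart_def)
  define D where "D s = of_real s * (1 + \<i>)" for s :: real
  define d where "d s = k (D s)" for s
  have cR: "c \<notin> R" using c R(3) by blast
  have Dball: "D s \<in> ball 0 r" if "s \<in> {-r/2..r/2}" for s
  proof -
    have "\<bar>s\<bar> \<le> r / 2" using that by auto
    then have "\<bar>s\<bar> * cmod (1 + \<i>) \<le> r / 2 * cmod (1 + \<i>)" by (rule mult_right_mono) simp
    also have "\<dots> < r" using norm_quadrant_point[OF r, of 0] r by (simp add: norm_mult)
    finally show ?thesis by (simp add: D_def norm_mult)
  qed
  have dR: "d s \<in> R" if s: "s \<in> {-r/2..r/2}" "s \<noteq> 0" for s
  proof (cases "s > 0")
    case True
    then show ?thesis using Q02[OF Dball[OF s(1)]] unfolding d_def D_def by simp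
  next
    case False
    have m: "- s \<in> {-r/2..r/2}" using s(1) by auto
    have "k (- D (- s)) \<in> R" using Q02[OF Dball[OF m]] False s(2) unfolding D_def by simp
    then show ?thesis unfolding d_def D_def by simp
  qed
  have dinj: "s = t" if "s \<in> {-r/2..r/2}" "t \<in> {-r/2..r/2}" "d s = d t" for s t
  proof -
    have "D s = D t" using inj_onD[OF inj] that Dball unfolding d_def by blast
    then show ?thesis unfolding D_def by (simp add: complex_eq_iff)
  qed
  have d0: "d 0 = c" unfolding d_def D_def using k0 by simp
  have dcont: "continuous_on {-r/2..r/2} d"
    unfolding d_def
  proof (rule continuous_on_compose2[OF ck])
    show "continuous_on {-r/2..r/2} D" unfolding D_def by (intro continuous_intros)
    show "D ` {-r/2..r/2} \<subseteq> ball 0 r" using Dball by blast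
  qed
  have ends: "r/2 \<in> {-r/2..r/2}" "-r/2 \<in> {-r/2..r/2}" using r by auto
  have "path_connected R" using R connected_open_path_connected by blast
  moreover have "d (r/2) \<noteq> d (-r/2)" using dinj[OF ends] r by auto
  moreover have "d (r/2) \<in> R" "d (-r/2) \<in> R" using dR ends r by simp_all
  ultimately obtain g where g: "arc g" "path_image g \<subseteq> R" "pathstart g = d (r/2)" "pathfinish g = d (-r/2)"
    unfolding path_connected_arcwise by blast
  have gcont: "continuous_on {0..1} g" using g(1) by (simp add: arc_def path_def)
  have gR: "g t \<in> R" if "t \<in> {0..1}" for t using g(2) that unfolding path_image_def by blast
  have g0: "g 0 = d (r/2)" and g1: "g 1 = d (-r/2)" using g(3,4) by (simp_all add: pathstart_def pathfinish_def)
  have cl: "closed (d ` {a..b})" if "-r/2 \<le> a" "b \<le> r/2" for a b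
    by (intro compact_imp_closed compact_continuous_image continuous_on_subset[OF dcont]) (use that in auto)
  \<comment> \<open>The arc \<open>g\<close> may meet the diagonal many times. Its last visit
    \<open>t0\<close> to the half in quadrant 0 and, after that, its first visit \<open>t1\<close>
    to the half in quadrant 2 cut out a piece that shares only its endpoints with the diagonal
    segment between them.\<close>
  define Tp where "Tp = {0..1} \<inter> g -` (d ` {0..r/2})"
  have "closed Tp" unfolding Tp_def by (rule continuous_closed_preimage[OF gcont]) (use cl r in auto)
  moreover have "bounded Tp" unfolding Tp_def by (rule bounded_subset[of "{0..1}"]) auto
  ultimately have "compact Tp" by (simp add: compact_eq_bounded_closed)
  moreover have "0 \<in> Tp" unfolding Tp_def using g0 r by auto
  ultimately obtain t0 where t0: "t0 \<in> Tp" "\<And>t. t \<in> Tp \<Longrightarrow> t \<le> t0"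
    using compact_attains_sup[of Tp] by blast
  then have t01: "t0 \<in> {0..1}" unfolding Tp_def by blast
  obtain s0 where s0: "s0 \<in> {0..r/2}" "g t0 = d s0" using t0(1) unfolding Tp_def by blast
  \<comment> \<open>The arc stays in \<open>R\<close> while \<open>c\<close> is outside
    \<open>R\<close>. With the same argument for \<open>s1\<close>, the diagonal piece has
    \<open>c\<close> in its interior.\<close>
  have "s0 \<noteq> 0" using gR[OF t01] s0(2) d0 cR by auto
  then have s0pos: "s0 > 0" using s0(1) by simp
  define Tm where "Tm = {t0..1} \<inter> g -` (d ` {-r/2..0})"
  have gc': "continuous_on {t0..1} g" using gcont t01 by (auto intro: continuous_on_subset)
  have "closed Tm" unfolding Tm_def by (rule continuous_closed_preimage[OF gc']) (use cl r in auto)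
  moreover have "bounded Tm" unfolding Tm_def by (rule bounded_subset[of "{t0..1}"]) auto
  ultimately have "compact Tm" by (simp add: compact_eq_bounded_closed)
  moreover have "1 \<in> Tm" unfolding Tm_def using g1 r t01 by auto
  ultimately obtain t1 where t1: "t1 \<in> Tm" "\<And>t. t \<in> Tm \<Longrightarrow> t1 \<le> t"
    using compact_attains_inf[of Tm] by blast
  then have t11: "t1 \<in> {t0..1}" unfolding Tm_def by blast
  obtain s1 where s1: "s1 \<in> {-r/2..0}" "g t1 = d s1" using t1(1) unfolding Tm_def by blast
  have t1in: "t1 \<in> {0..1}" using t11 t01 by auto
  have "s1 \<noteq> 0" using gR[OF t1in] s1(2) d0 cR by auto
  then have s1neg: "s1 < 0" using s1(1) by simp
  have sin: "s0 \<in> {-r/2..r/2}" "s1 \<in> {-r/2..r/2}" using s0(1) s1(1) r by auto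
  have "t0 \<noteq> t1" using s0(2) s1(2) dinj[OF sin] s0pos s1neg by auto
  then have t0t1: "t0 < t1" using t11 by auto
  define \<alpha> where "\<alpha> = subpath t0 t1 g"
  define \<beta> where "\<beta> = d \<circ> linepath s1 s0"
  have a: "arc \<alpha>" unfolding \<alpha>_def by (rule arc_subpath_arc[OF g(1) t01 t1in \<open>t0 \<noteq> t1\<close>])
  have ai: "path_image \<alpha> = g ` {t0..t1}" unfolding \<alpha>_def path_image_subpath using t0t1 by simp
  have li: "path_image (linepath s1 s0) = {s1..s0}"
    using s0pos s1neg by (simp add: closed_segment_eq_real_ivl)
  have bi: "path_image \<beta> = d ` {s1..s0}"
    unfolding \<beta>_def path_image_compose li ..
  have sub: "{s1..s0} \<subseteq> {-r/2..r/2}" using s0(1) s1(1) by auto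
  have b: "arc \<beta>"
    unfolding arc_def
  proof
    have "path (linepath s1 s0)" by simp
    then show "path \<beta>" unfolding \<beta>_def
      by (rule path_continuous_image) (use li sub in \<open>auto intro: continuous_on_subset[OF dcont]\<close>)
    have "inj_on (linepath s1 s0) {0..1}" using arc_linepath[of s1 s0] s0pos s1neg by (simp add: arc_def)
    moreover have "inj_on d (linepath s1 s0 ` {0..1})"
    proof (rule inj_onI)
      fix x y assume xy: "x \<in> linepath s1 s0 ` {0..1}" "y \<in> linepath s1 s0 ` {0..1}" "d x = d y"
      then have "x \<in> {s1..s0}" "y \<in> {s1..s0}" using li unfolding path_image_def by blast+
      then show "x = y" using dinj sub xy(3) by blast
    qed
    ultimately show "inj_on \<beta> {0..1}" unfolding \<beta>_def by (rule comp_inj_on)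
  qed
  have e1: "pathstart \<alpha> = d s0" "pathfinish \<alpha> = d s1" unfolding \<alpha>_def using s0(2) s1(2) by simp_all
  have e2: "pathstart \<beta> = d s1" "pathfinish \<beta> = d s0"
    unfolding \<beta>_def by (simp_all add: pathstart_compose pathfinish_compose)
  have meet: "path_image \<alpha> \<inter> path_image \<beta> \<subseteq> {pathstart \<alpha>, pathstart \<beta>}"
  proof
    fix z assume "z \<in> path_image \<alpha> \<inter> path_image \<beta>"
    then obtain t s where t: "t \<in> {t0..t1}" "z = g t" and s: "s \<in> {s1..s0}" "z = d s" unfolding ai bi by blast
    have gt: "g t = d s" using t(2) s(2) by simp
    show "z \<in> {pathstart \<alpha>, pathstart \<beta>}"
    proof (cases "s \<ge> 0")
      case True
      then have "s \<in> {0..r/2}" using s(1) s0(1) by auto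
      then have "g t \<in> d ` {0..r/2}" unfolding gt by (rule imageI)
      moreover have "t \<in> {0..1}" using t(1) t01 t1in by auto
      ultimately have "t \<in> Tp" unfolding Tp_def by blast
      then have "t = t0" using t0(2)[of t] t(1) by auto
      then show ?thesis using t(2) s0(2) e1 by simp
    next
      case False
      then have "s \<in> {-r/2..0}" using s(1) s1(1) by auto
      then have "g t \<in> d ` {-r/2..0}" unfolding gt by (rule imageI)
      moreover have "t \<in> {t0..1}" using t(1) t1in by auto
      ultimately have "t \<in> Tm" unfolding Tm_def by blast
      then have "t = t1" using t1(2)[of t] t(1) by auto
      then show ?thesis using t(2) s1(2) e2 by simp
    qed
  qed
  define \<gamma> where "\<gamma> = \<alpha> +++ \<beta>"
  let ?\<Gamma> = "path_image \<gamma>"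
  have sp: "simple_path \<gamma>" unfolding \<gamma>_def by (rule simple_path_join_loop[OF a b]) (use e1 e2 meet in auto)
  have closed_\<gamma>: "pathfinish \<gamma> = pathstart \<gamma>" unfolding \<gamma>_def using e1 e2 by simp
  have im: "?\<Gamma> = g ` {t0..t1} \<union> d ` {s1..s0}"
    unfolding \<gamma>_def using path_image_join[of \<alpha> \<beta>] e1 e2 ai bi by simp
  have gimR: "g ` {t0..t1} \<subseteq> R" using gR t01 t1in by force
  have imR: "?\<Gamma> \<subseteq> insert c R"
  proof
    fix z assume "z \<in> ?\<Gamma>"
    then consider "z \<in> g ` {t0..t1}" | s where "s \<in> {s1..s0}" "z = d s" unfolding im by blast
    then show "z \<in> insert c R"
    proof cases
      case 1 then show ?thesis using gimR by blast
    next
      case 2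
      then show ?thesis using dR[of s] d0 sub by (cases "s = 0") auto
    qed
  qed
  have c\<gamma>: "c \<in> ?\<Gamma>"
  proof -
    have "0 \<in> {s1..s0}" using s0pos s1neg by auto
    then show ?thesis unfolding im d0[symmetric] by blast
  qed
  have J: "open (inside ?\<Gamma>)" "open (outside ?\<Gamma>)"
    "inside ?\<Gamma> \<inter> outside ?\<Gamma> = {}"
    "inside ?\<Gamma> \<union> outside ?\<Gamma> = - ?\<Gamma>"
    "frontier (inside ?\<Gamma>) = ?\<Gamma>" "frontier (outside ?\<Gamma>) = ?\<Gamma>"
    using Jordan_inside_outside[OF sp closed_\<gamma>] by simp_all
  have "compact (g ` {t0..t1})"
    by (intro compact_continuous_image continuous_on_subset[OF gcont]) (use t01 t1in in auto)
  then have opK: "open (- (g ` {t0..t1}))" using compact_imp_closed by blast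
  have cK: "c \<in> - (g ` {t0..t1})" using gimR cR by blast
  obtain e0 where e0: "0 < e0" "e0 \<le> r" "k ` ball 0 e0 \<subseteq> - (g ` {t0..t1})"
    by (rule disc_chart_small[OF dk opK cK])
  \<comment> \<open>Within this radius the return arc is absent and the diagonal piece has not
    ended.\<close>
  define e where "e = min e0 (min s0 (- s1))"
  have e: "0 < e" "e \<le> e0" "e \<le> s0" "e \<le> - s1" using e0 s0pos s1neg by (auto simp: e_def)
  have er: "ball 0 e \<subseteq> ball (0::complex) r" using e(2) e0(2) by auto
  have diag: "k w \<in> ?\<Gamma> \<longleftrightarrow> Re w = Im w" if w: "w \<in> ball 0 e" for w
  proof
    assume "k w \<in> ?\<Gamma>"
    moreover have "w \<in> ball 0 e0" using w e(2) by simp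
    ultimately obtain s where s: "s \<in> {s1..s0}" "k w = d s" unfolding im using e0(3) by blast
    then have "w = D s" using inj_onD[OF inj, of w "D s"] w er Dball sub unfolding d_def by blast
    then show "Re w = Im w" by (simp add: D_def)
  next
    assume "Re w = Im w"
    then have "w = D (Re w)" by (simp add: D_def complex_eq_iff)
    moreover have "\<bar>Re w\<bar> < e" using w abs_Re_le_cmod[of w] by simp
    then have "Re w \<in> {s1..s0}" using e by auto
    ultimately show "k w \<in> ?\<Gamma>" unfolding im d_def by (metis UnI2 image_eqI)
  qed
  \<comment> \<open>The half discs beside the diagonal; \<open>\<sigma> = 1\<close> is the side of
    quadrant 1.\<close>
  define H where "H \<sigma> = ball 0 e \<inter> {w. 0 < inner (Complex (- \<sigma>) \<sigma>) w}" for \<sigma> :: real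
  have Hmem: "w \<in> H \<sigma> \<longleftrightarrow> w \<in> ball 0 e \<and> \<sigma> * Re w < \<sigma> * Im w" for w \<sigma>
    unfolding H_def by (auto simp: inner_complex_def)
  have Hside: "k ` H \<sigma> \<subseteq> inside ?\<Gamma> \<or> k ` H \<sigma> \<subseteq> outside ?\<Gamma>" for \<sigma>
  proof (rule connected_inside_or_outside)
    have "convex (H \<sigma>)" unfolding H_def by (intro convex_Int convex_ball convex_halfspace_gt)
    moreover have "H \<sigma> \<subseteq> ball 0 r" using er unfolding H_def by blast
    ultimately show "connected (k ` H \<sigma>)"
      using ck by (meson connected_continuous_image continuous_on_subset convex_connected)
    show "k ` H \<sigma> \<inter> ?\<Gamma> = {}"
    proof -
      have "k w \<notin> ?\<Gamma>" if "w \<in> H \<sigma>" for w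
        using diag[of w] that unfolding Hmem by auto
      then show ?thesis by blast
    qed
  qed
  have opN: "open (k ` ball 0 e)" by (rule open_chart_image[OF dk]) (use er in auto)
  have cN: "c \<in> k ` ball 0 e" using k0 e(1) by (metis centre_in_ball imageI)
  \<comment> \<open>Inside and outside both have \<open>c\<close> on their frontier, so each meets a
    half disc near \<open>c\<close>. As every half disc lies on one side only, they get one
    each.\<close>
  have hits: "\<exists>\<sigma>\<in>{1, -1}. k ` H \<sigma> \<inter> S \<noteq> {}" if S: "frontier S = ?\<Gamma>" "S \<inter> ?\<Gamma> = {}" for S
  proof -
    have "c \<in> closure S" using c\<gamma> S(1) unfolding frontier_def by blast
    then have "S \<inter> k ` ball 0 e \<noteq> {}" using opN cN closure_iff_nhds_not_empty by blast
    then obtain w where w: "w \<in> ball 0 e" "k w \<in> S" by blast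
    then have "Re w \<noteq> Im w" using diag S(2) by blast
    then have "w \<in> H 1 \<or> w \<in> H (-1)" using w(1) unfolding Hmem by auto
    then show ?thesis using w(2) by blast
  qed
  have hI: "\<exists>\<sigma>\<in>{1, -1}. k ` H \<sigma> \<inter> inside ?\<Gamma> \<noteq> {}"
    by (rule hits[OF J(5)]) (use J(4) in blast)
  have hO: "\<exists>\<sigma>\<in>{1, -1}. k ` H \<sigma> \<inter> outside ?\<Gamma> \<noteq> {}"
    by (rule hits[OF J(6)]) (use J(4) in blast)
  have opp: "(k ` H 1 \<subseteq> inside ?\<Gamma> \<and> k ` H (-1) \<subseteq> outside ?\<Gamma>) \<or>
    (k ` H (-1) \<subseteq> inside ?\<Gamma> \<and> k ` H 1 \<subseteq> outside ?\<Gamma>)"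
    using Hside[of 1] Hside[of "-1"] hI hO J(3) by blast
  have quad: "quadrant_point k r j \<in> S"
    if j: "j \<in> {1, 3}" and S: "k ` H \<sigma> \<subseteq> S" "S = inside ?\<Gamma> \<or> S = outside ?\<Gamma>"
      and \<sigma>: "\<sigma> = (if j = 1 then 1 else -1)" for j S \<sigma>
  proof -
    let ?A = "(\<lambda>v. k (v * \<i> ^ j)) ` quadrant r"
    have "k (v * \<i> ^ j) \<notin> ?\<Gamma>" if v: "v \<in> ball 0 r" "Re v > 0" "Im v > 0" for v
    proof -
      have "k (v * \<i> ^ j) \<notin> P" by (rule quadrant_off_axes[OF k v])
      moreover have "k (v * \<i> ^ j) \<notin> R" using Q13[OF v] j by blast
      ultimately show ?thesis using imR c by blast
    qed
    then have A: "?A \<inter> ?\<Gamma> = {}" by blast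
    have side: "?A \<subseteq> inside ?\<Gamma> \<or> ?A \<subseteq> outside ?\<Gamma>"
      by (rule connected_inside_or_outside[OF connected_quadrant[OF k] A])
    let ?v = "of_real (e/2) * (1 + \<i>)"
    have v: "?v \<in> ball 0 e" using norm_quadrant_point[OF e(1), of 0] by simp
    have "?v * \<i> ^ j \<in> H \<sigma>"
    proof -
      have "?v * \<i> ^ j \<in> ball 0 e" using v by simp
      moreover have "\<sigma> * Re (?v * \<i> ^ j) < \<sigma> * Im (?v * \<i> ^ j)"
        using j \<sigma> e(1) by (auto simp: numeral_3_eq_3)
      ultimately show ?thesis unfolding Hmem by blast
    qed
    then have "k (?v * \<i> ^ j) \<in> S" using S(1) by blast
    moreover have "k (?v * \<i> ^ j) \<in> ?A"
    proof (rule image_eqI[of _ _ ?v])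
      have "?v \<in> ball 0 r" using v er by blast
      then show "?v \<in> quadrant r" using e(1) by simp
    qed simp
    ultimately have "?A \<subseteq> S" using side S(2) J(3) by blast
    moreover have "quadrant_point k r j \<in> ?A"
      unfolding quadrant_point_def
    proof (rule image_eqI[of _ _ "of_real (r/2) * (1 + \<i>)"])
      show "of_real (r/2) * (1 + \<i>) \<in> quadrant r"
        using norm_quadrant_point[OF r, of 0] r by simp
    qed simp
    ultimately show ?thesis by blast
  qed
  have "quadrant_point k r 1 \<in> inside ?\<Gamma> \<and> quadrant_point k r 3 \<in> outside ?\<Gamma> \<or>
     quadrant_point k r 3 \<in> inside ?\<Gamma> \<and> quadrant_point k r 1 \<in> outside ?\<Gamma>"
    using opp
  proof
    assume "k ` H 1 \<subseteq> inside ?\<Gamma> \<and> k ` H (-1) \<subseteq> outside ?\<Gamma>"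
    then show ?thesis using quad[of 1 1] quad[of 3 "-1"] by simp
  next
    assume "k ` H (-1) \<subseteq> inside ?\<Gamma> \<and> k ` H 1 \<subseteq> outside ?\<Gamma>"
    then show ?thesis using quad[of 1 1] quad[of 3 "-1"] by simp
  qed
  then show ?thesis using sp closed_\<gamma> imR c\<gamma> by (intro exI[of _ \<gamma>]) simp
qed

lemma nested_inside:
  fixes \<gamma> \<delta> :: "real \<Rightarrow> complex"
  assumes "simple_path \<gamma>" "simple_path \<delta>" "path_image \<delta> \<subseteq> inside (path_image \<gamma>)"
  shows "inside (path_image \<delta>) \<subseteq> inside (path_image \<gamma>)"
  by (rule inside_inside_compact_connected[OF closed_simple_path_image[OF assms(2)]
        compact_simple_path_image[OF assms(1)] connected_simple_path_image[OF assms(1)] assms(3)])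

context crossed_set
begin

text \<open>Which of the two remaining corners is enclosed is left open, since either can be on the
  side of infinity.\<close>

definition separating_curve :: "complex \<Rightarrow> complex set \<Rightarrow> nat \<Rightarrow> (real \<Rightarrow> complex) \<Rightarrow> bool" where
  "separating_curve c R j \<gamma> \<longleftrightarrow> simple_path \<gamma> \<and> pathfinish \<gamma> = pathstart \<gamma> \<and>
     path_image \<gamma> \<subseteq> insert c R \<and> c \<in> path_image \<gamma> \<and>
     (corner c (j + 1) \<in> inside (path_image \<gamma>) \<and> corner c (j + 3) \<in> outside (path_image \<gamma>) \<or>
      corner c (j + 3) \<in> inside (path_image \<gamma>) \<and> corner c (j + 1) \<in> outside (path_image \<gamma>))"

text \<open>Turning the chart by \<open>j\<close> quarter turns moves the doubled region to the
  quadrants 0 and 2.\<close>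

lemma double_region_curve:
  assumes c: "c \<in> C" and R: "R \<in> components (- P)" "corner c j \<in> R" "corner c (j + 2) \<in> R"
    and notR: "corner c (j + 1) \<notin> R" "corner c (j + 3) \<notin> R"
  shows "\<exists>\<gamma>. separating_curve c R j \<gamma>"
proof -
  let ?k = "\<lambda>w. \<kappa> c (w * \<i> ^ j)"
  have k: "cross_chart P c (\<rho> c) (\<kappa> c)" by (rule crosses[OF c])
  have k': "cross_chart P c (\<rho> c) ?k" by (rule cross_chart_turn[OF k])
  have qp: "quadrant_point ?k (\<rho> c) m = corner c (j + m)" for m
    unfolding quadrant_point_def corner_def by (simp add: power_add mult_ac)
  have RP: "R \<inter> P = {}" using in_components_subset[OF R(1)] by blast
  have op: "open R" using closed_P R(1) by (metis open_Compl open_components)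
  have conn: "connected R" using R(1) by (rule in_components_connected)
  have inR: "?k (v * \<i> ^ m) \<in> R \<longleftrightarrow> corner c (j + m) \<in> R"
    if v: "v \<in> ball 0 (\<rho> c)" "Re v > 0" "Im v > 0" for v m
  proof -
    have "?k (v * \<i> ^ m) \<in> R \<longleftrightarrow> quadrant_point ?k (\<rho> c) m \<in> R"
      using cross_chart_quadrant[OF k', of "\<lambda>z. z \<in> R", OF _ v] const_near_region[OF R(1)] by blast
    then show ?thesis unfolding qp .
  qed
  have Q02: "?k v \<in> R \<and> ?k (- v) \<in> R" if v: "v \<in> ball 0 (\<rho> c)" "Re v > 0" "Im v > 0" for v
    using inR[OF v, of 0] inR[OF v, of 2] R(2,3) by simp
  have Q13: "?k (v * \<i> ^ 1) \<notin> R \<and> ?k (v * \<i> ^ 3) \<notin> R" if v: "v \<in> ball 0 (\<rho> c)" "Re v > 0" "Im v > 0" for v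
    using inR[OF v, of 1] inR[OF v, of 3] notR by simp
  have "c \<in> P" using c C_sub by blast
  from chart_double_region[OF k' op conn RP Q02 Q13 this] show ?thesis
    unfolding separating_curve_def qp by simp
qed

end

section \<open>The span of the region boundaries\<close>

text \<open>The span over the field with two elements, generated one summand at a time just as
  region crossing changes are made one at a time.\<close>

inductive_set sd_span :: "'a set set \<Rightarrow> 'a set set" for F where
  empty: "{} \<in> sd_span F"
| step: "A \<in> F \<Longrightarrow> S \<in> sd_span F \<Longrightarrow> sym_diff A S \<in> sd_span F"

lemma sd_span_sym_diff:
  assumes "S \<in> sd_span F" "T \<in> sd_span F"
  shows "sym_diff S T \<in> sd_span F"
  using assms(1)
proof induction
  case empty
  then show ?case using assms(2) by simp
next
  case (step A S)
  have "sym_diff (sym_diff A S) T = sym_diff A (sym_diff S T)" by blast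
  then show ?case using sd_span.step[OF step(1,3)] by simp
qed

lemma sd_span_singletons:
  assumes "finite Z" "\<And>d. d \<in> Z \<Longrightarrow> {d} \<in> sd_span F"
  shows "Z \<in> sd_span F"
  using assms
proof (induction Z)
  case empty
  show ?case by (rule sd_span.empty)
next
  case (insert d Z)
  have "sym_diff {d} Z \<in> sd_span F" by (rule sd_span_sym_diff) (use insert in auto)
  moreover have "sym_diff {d} Z = insert d Z" using insert(2) by blast
  ultimately show ?case by simp
qed

lemma sd_span_sum:
  assumes "finite S" "\<And>R. R \<in> S \<Longrightarrow> {c \<in> C. B c R} \<in> F"
  shows "{c \<in> C. odd (card {R \<in> S. B c R})} \<in> sd_span F"
  using assms
proof (induction S)
  case empty
  then show ?case by (simp add: sd_span.empty)
next
  case (insert R S)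
  have "odd (card {R' \<in> insert R S. B c R'}) \<longleftrightarrow> B c R \<noteq> odd (card {R' \<in> S. B c R'})" for c
  proof (cases "B c R")
    case True
    then have "{R' \<in> insert R S. B c R'} = insert R {R' \<in> S. B c R'}" by auto
    then show ?thesis using insert(1,2) True by simp
  next
    case False
    then have "{R' \<in> insert R S. B c R'} = {R' \<in> S. B c R'}" by auto
    then show ?thesis using False by simp
  qed
  then have "{c \<in> C. odd (card {R' \<in> insert R S. B c R'})} =
      sym_diff {c \<in> C. B c R} {c \<in> C. odd (card {R' \<in> S. B c R'})}" by auto
  moreover have "sym_diff {c \<in> C. B c R} {c \<in> C. odd (card {R' \<in> S. B c R'})} \<in> sd_span F"
    by (rule sd_span.step) (use insert in auto)
  ultimately show ?case by simp
qed

lemma even_card_sym_diff: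
  assumes "finite A" "finite B"
  shows "even (card (sym_diff A B)) \<longleftrightarrow> (even (card A) \<longleftrightarrow> even (card B))"
proof -
  have "card (sym_diff A B) = card (A - B) + card (B - A)"
    by (rule card_Un_disjoint) (use assms in auto)
  moreover have "card A = card (A - B) + card (A \<inter> B)" "card B = card (B - A) + card (A \<inter> B)"
    using card_Int_Diff[OF assms(1), of B] card_Int_Diff[OF assms(2), of A] by (simp_all add: Int_commute)
  ultimately show ?thesis by auto
qed

section \<open>Crossing changes as symmetric differences\<close>

lemma crossing_change_simps [simp]:
  "num_components (crossing_change D S) = num_components D"
  "curve (crossing_change D S) = curve D"
  by (simp_all add: crossing_change_def)

lemma crossing_change_invariants [simp]:
  "projection (crossing_change D S) = projection D"
  "fibre (crossing_change D S) = fibre D"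
  "crossings (crossing_change D S) = crossings D"
  "regions (crossing_change D S) = regions D"
  "other_strand (crossing_change D S) = other_strand D"
proof -
  have p: "params (crossing_change D S) = params D" "point_at (crossing_change D S) = point_at D"
    by (auto simp: params_def point_at_def)
  show 1: "projection (crossing_change D S) = projection D" "fibre (crossing_change D S) = fibre D"
    unfolding projection_def fibre_def p by (rule refl)+
  show "crossings (crossing_change D S) = crossings D" "regions (crossing_change D S) = regions D"
    "other_strand (crossing_change D S) = other_strand D"
    unfolding crossings_def regions_def other_strand_def 1 by (rule refl)+
qed

lemma crossing_change_empty: "crossing_change D {} = D"
  by (simp add: crossing_change_def)

context diagram
begin

lemma fibre_pair:
  assumes "c \<in> C"
  obtains p q where "p \<noteq> q" "fibre D c = {p, q}"
  using assms diagram unfolding link_diagram_def transverse_double_point_def by blast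

lemma other_strand_involution:
  assumes c: "c \<in> C" and p: "p \<in> fibre D c"
  shows "other_strand D c p \<noteq> p" "other_strand D c (other_strand D c p) = p"
proof -
  obtain a b where ab: "a \<noteq> b" "fibre D c = {a, b}" by (rule fibre_pair[OF c])
  have "other_strand D c a = b" "other_strand D c b = a"
    unfolding other_strand_def ab(2) using ab(1) by (auto intro!: the_equality)
  then show "other_strand D c p \<noteq> p" "other_strand D c (other_strand D c p) = p" using p ab by auto
qed

lemma over_fibre: "c \<in> C \<Longrightarrow> over D c \<in> fibre D c"
  using diagram by (simp add: link_diagram_def)

text \<open>Swapping the strands is an involution, so a crossing changed twice is restored. This
  turns sequences of changes into sums modulo 2.\<close>

lemma crossing_change_compose:
  "crossing_change (crossing_change D S) T = crossing_change D (sym_diff S T)"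
proof -
  have "over (crossing_change (crossing_change D S) T) = over (crossing_change D (sym_diff S T))"
  proof
    fix c
    show "over (crossing_change (crossing_change D S) T) c = over (crossing_change D (sym_diff S T)) c"
    proof (cases "c \<in> C")
      case True
      have "over (crossing_change D S) c = (if c \<in> S then other_strand D c (over D c) else over D c)" for S
        using True by (simp add: crossing_change_def)
      moreover have "over (crossing_change (crossing_change D S) T) c =
          (if c \<in> T then other_strand D c (over (crossing_change D S) c) else over (crossing_change D S) c)"
        using True by (subst crossing_change_def) simp
      ultimately show ?thesis
        using other_strand_involution(2)[OF True over_fibre[OF True]] by auto
    next
      case False
      then show ?thesis by (simp add: crossing_change_def[of "crossing_change D S"]) (simp add: crossing_change_def)
    qed
  qed
  then show ?thesis by (simp add: crossing_change_def)
qed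

text \<open>A changed crossing has a different over-strand, so the set can be recovered from the
  resulting diagram.\<close>

lemma crossing_change_inj:
  assumes "S \<subseteq> C" "T \<subseteq> C" "crossing_change D S = crossing_change D T"
  shows "S = T"
proof -
  have mem: "c \<in> S \<longleftrightarrow> over (crossing_change D S) c \<noteq> over D c" if "c \<in> C" for S c
    using that other_strand_involution(1)[OF that over_fibre[OF that]] by (simp add: crossing_change_def)
  have "c \<in> S \<longleftrightarrow> c \<in> T" if "c \<in> C" for c
    unfolding mem[OF that] assms(3) by (rule refl)
  then show ?thesis using assms(1,2) by blast
qed

definition boundaries :: "complex set set" where
  "boundaries = {{c \<in> C. c \<in> frontier R} |R. R \<in> regions D}"

lemma boundary_mem: "R \<in> regions D \<Longrightarrow> {c \<in> C. c \<in> frontier R} \<in> boundaries"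
  unfolding boundaries_def by blast

lemma region_crossing_change_compose:
  "region_crossing_change (crossing_change D S) R = crossing_change D (sym_diff {c \<in> C. c \<in> frontier R} S)"
proof -
  have "sym_diff S (C \<inter> frontier R) = sym_diff {c \<in> C. c \<in> frontier R} S" by auto
  then show ?thesis unfolding region_crossing_change_def by (simp add: crossing_change_compose)
qed

lemma span_sub: "S \<in> sd_span boundaries \<Longrightarrow> S \<subseteq> C"
  by (induction rule: sd_span.induct) (auto simp: boundaries_def)

text \<open>Crossings and regions are invariant under crossing changes, so every diagram that is
  reached is \<open>crossing_change D S\<close> with \<open>S\<close> a sum of boundary sets;
  \<open>crossing_change_inj\<close> then identifies \<open>S\<close> with \<open>Q\<close>.\<close>

lemma admissible_iff_span:
  assumes Q: "Q \<subseteq> C"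
  shows "rcc_admissible D Q \<longleftrightarrow> Q \<in> sd_span boundaries"
proof
  assume "rcc_admissible D Q"
  then have reach: "rcc_step\<^sup>*\<^sup>* D (crossing_change D Q)" by (simp add: rcc_admissible_def)
  have "\<exists>S\<in>sd_span boundaries. D' = crossing_change D S" if "rcc_step\<^sup>*\<^sup>* D D'" for D'
    using that
  proof (induction rule: rtranclp_induct)
    case base
    show ?case using sd_span.empty crossing_change_empty by metis
  next
    case (step D1 D2)
    then obtain S where S: "S \<in> sd_span boundaries" "D1 = crossing_change D S" by blast
    obtain R where R: "R \<in> regions D" "D2 = region_crossing_change D1 R"
      using step(2) S(2) unfolding rcc_step_def by auto
    have "D2 = crossing_change D (sym_diff {c \<in> C. c \<in> frontier R} S)"
      using R(2) S(2) region_crossing_change_compose by simp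
    then show ?case using sd_span.step[OF boundary_mem[OF R(1)] S(1)] by blast
  qed
  then obtain S where S: "S \<in> sd_span boundaries" "crossing_change D Q = crossing_change D S"
    using reach by blast
  then show "Q \<in> sd_span boundaries" using crossing_change_inj[OF Q span_sub] by blast
next
  assume "Q \<in> sd_span boundaries"
  then have "rcc_step\<^sup>*\<^sup>* D (crossing_change D Q)"
  proof induction
    case empty
    then show ?case by (simp add: crossing_change_empty)
  next
    case (step A S)
    then obtain R where R: "R \<in> regions D" "A = {c \<in> C. c \<in> frontier R}" unfolding boundaries_def by blast
    have "rcc_step (crossing_change D S) (crossing_change D (sym_diff A S))"
      unfolding rcc_step_def R(2) region_crossing_change_compose[symmetric] using R(1) by auto
    then show ?case using step(3) by (rule rtranclp.rtrancl_into_rtrancl[rotated])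
  qed
  then show "rcc_admissible D Q" by (simp add: rcc_admissible_def)
qed

section \<open>Passages of a component through crossings, and valencies\<close>

abbreviation params_over :: "nat \<Rightarrow> complex set \<Rightarrow> complex set" where
  "params_over i Q \<equiv> {z \<in> sphere 0 1. curve D i z \<in> Q}"

abbreviation mixed :: "nat \<Rightarrow> complex \<Rightarrow> bool" where
  "mixed i c \<equiv> i \<in> components_through D c \<and> (\<exists>j. j \<noteq> i \<and> j \<in> components_through D c)"

text \<open>A component passes a mixed crossing of its own once, and any other crossing twice or not
  at all.\<close>

lemma params_over_crossing:
  assumes i: "i < n"
  shows "finite (params_over i {c})"
    "c \<in> C \<Longrightarrow> odd (card (params_over i {c})) \<longleftrightarrow> mixed i c"
proof -
  have eq: "params_over i {c} = snd ` {p \<in> fibre D c. fst p = i}"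
    using i unfolding fibre_def params_def point_at_def by force
  then show "finite (params_over i {c})" using finite_fibre by simp
  assume c: "c \<in> C"
  obtain p q where pq: "p \<noteq> q" "fibre D c = {p, q}" by (rule fibre_pair[OF c])
  have "inj_on snd {p \<in> fibre D c. fst p = i}" by (auto simp: inj_on_def prod_eq_iff)
  then have "card (params_over i {c}) = card {p \<in> fibre D c. fst p = i}" unfolding eq by (rule card_image)
  also have "{p \<in> fibre D c. fst p = i} =
      (if fst p = i then {p} else {}) \<union> (if fst q = i then {q} else {})" unfolding pq(2) by auto
  also have "odd (card \<dots>) \<longleftrightarrow> ((fst p = i) \<noteq> (fst q = i))" using pq(1) by auto
  also have "\<dots> \<longleftrightarrow> mixed i c"
    unfolding components_through_def pq(2) by auto
  finally show "odd (card (params_over i {c})) \<longleftrightarrow>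
    mixed i c" .
qed

lemma even_params_over:
  assumes i: "i < n" and Q: "Q \<subseteq> C"
  shows "even (card (params_over i Q)) \<longleftrightarrow>
    even (card {c \<in> Q. mixed i c})"
proof -
  have fin: "finite Q" using Q finite_C by (rule finite_subset)
  have "params_over i Q = (\<Union>c\<in>Q. params_over i {c})" by auto
  then have "card (params_over i Q) = (\<Sum>c\<in>Q. card (params_over i {c}))"
    using card_UN_disjoint[OF fin, of "\<lambda>c. params_over i {c}"] params_over_crossing(1)[OF i] by auto
  then have "even (card (params_over i Q)) \<longleftrightarrow> even (card {c \<in> Q. odd (card (params_over i {c}))})"
    using even_sum_iff[OF fin] by simp
  moreover have "{c \<in> Q. odd (card (params_over i {c}))} =
      {c \<in> Q. mixed i c}"
    using params_over_crossing(2)[OF i] Q by blast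
  ultimately show ?thesis by simp
qed

lemma finite_params_over:
  assumes i: "i < n" and Q: "Q \<subseteq> C"
  shows "finite (params_over i Q)"
proof -
  have "params_over i Q = (\<Union>c\<in>Q. params_over i {c})" by auto
  then show ?thesis using params_over_crossing(1)[OF i] finite_subset[OF Q finite_C] by simp
qed

text \<open>Edges join distinct vertices, so there are no loops and the valency counts mixed
  crossings; self-crossings contribute two passages each.\<close>

lemma even_valency_iff:
  assumes i: "i < n" and Q: "Q \<subseteq> C"
  shows "even (valency (crossing_graph D Q) i) \<longleftrightarrow> even (card (params_over i Q))"
proof -
  have two: "\<exists>a b. components_through D c = {a, b}" if c: "c \<in> C" for c
  proof -
    obtain p q where "fibre D c = {p, q}" by (rule fibre_pair[OF c])
    then have "components_through D c = {fst p, fst q}" unfolding components_through_def by simp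
    then show ?thesis by blast
  qed
  have nonself: "(\<exists>a b. a \<noteq> b \<and> components_through D c = {a, b}) \<and> i \<in> components_through D c \<longleftrightarrow>
      mixed i c" if c: "c \<in> Q" for c
  proof -
    have "c \<in> C" using c Q by blast
    then obtain a b where ab: "components_through D c = {a, b}" using two by blast
    show ?thesis
    proof
      assume "(\<exists>a b. a \<noteq> b \<and> components_through D c = {a, b}) \<and> i \<in> components_through D c"
      then show "mixed i c"
        by (metis insertI1 insertI2)
    next
      assume "mixed i c"
      then have "a \<noteq> b" "i \<in> components_through D c" unfolding ab by auto
      then show "(\<exists>a b. a \<noteq> b \<and> components_through D c = {a, b}) \<and> i \<in> components_through D c"
        using ab by blast
    qed
  qed
  have "{e \<in> medges (crossing_graph D Q). mends (crossing_graph D Q) e = {i}} = {}"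
    unfolding crossing_graph_def by auto
  moreover have "{e \<in> medges (crossing_graph D Q). i \<in> mends (crossing_graph D Q) e} =
      {c \<in> Q. (\<exists>a b. a \<noteq> b \<and> components_through D c = {a, b}) \<and> i \<in> components_through D c}"
    unfolding crossing_graph_def by auto
  moreover have "{c \<in> Q. (\<exists>a b. a \<noteq> b \<and> components_through D c = {a, b}) \<and> i \<in> components_through D c} =
      {c \<in> Q. mixed i c}"
    by (intro Collect_cong) (rule conj_cong[OF refl], rule nonself)
  ultimately have "valency (crossing_graph D Q) i =
      card {c \<in> Q. mixed i c}"
    by (simp only: valency_def card.empty add_0_right)
  then show ?thesis using even_params_over[OF i Q] by simp
qed

lemma strand_ray:
  assumes "strand k e i t" "b > 0"
  obtains s where "0 < s" "s < b" "\<exists>r. G i r = k (of_real s * e)" "\<exists>r. G i r = k (of_real s * - e)"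
proof -
  obtain d where d: "d > 0" "\<And>s. 0 < s \<Longrightarrow> s < d \<Longrightarrow> reached k e i t 1 s"
    using assms(1) unfolding strand_def by (metis zero_less_one)
  define s where "s = min d b / 2"
  have s: "0 < s" "s < d" "s < b" using d(1) assms(2) by (auto simp: s_def)
  have "reached k e i t 1 s" using d(2) s by simp
  then have "\<exists>r. G i r = k (of_real s * e)" "\<exists>r. G i r = k (of_real s * - e)"
    unfolding reached_def by auto
  then show ?thesis using s by (intro that)
qed

lemma ray_off_C:
  assumes "c \<in> C" "0 < s" "s < \<rho> c"
  shows "\<kappa> c (of_real s * \<i> ^ j) \<notin> C"
  by (rule isolated[OF assms(1)]) (use assms(2,3) in \<open>auto simp: norm_mult norm_power\<close>)

lemma ray_on_P:
  assumes "c \<in> C" "0 < s" "s < \<rho> c"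
  shows "\<kappa> c (of_real s * \<i> ^ j) \<in> P"
proof -
  have "of_real s * \<i> ^ j \<in> ball 0 (\<rho> c)" using assms by (simp add: norm_mult norm_power)
  moreover have "Re (of_real s * \<i> ^ j) = 0 \<or> Im (of_real s * \<i> ^ j) = 0"
    using i_power_axes[of "of_real s" j] by simp
  ultimately show ?thesis using crosses[OF assms(1)] unfolding cross_chart_def by blast
qed

section \<open>Checkerboard colouring and separation of corners\<close>

lemma switches_const: "switches_at (\<lambda>_. b) {}"
  unfolding switches_at_def switch_def by (auto intro: exI[of _ 1])

lemma corner_add_4: "corner c (Suc j + 3) = corner c j"
  using corner_mod[of c j] by (simp add: numeral_eq_Suc)

text \<open>All arcs are marked, so all four rays at a crossing are, and the cycle condition is
  automatic.\<close>

lemma ex_checkerboard: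
  "\<exists>f. (\<forall>w. w \<notin> P \<longrightarrow> const_near P f w) \<and> (\<forall>c\<in>C. \<forall>j. f (corner c (Suc j)) \<noteq> f (corner c j))"
proof -
  have "\<exists>f. (\<forall>w. w \<notin> P \<longrightarrow> const_near P f w) \<and>
    (\<forall>i t. i < n \<longrightarrow> G i t \<notin> C \<longrightarrow> (const_near P f (G i t) \<longleftrightarrow> \<not> True))"
    by (rule ex_potential[where Q = "{}"]) (auto simp: switches_const intro: exI[of _ 1])
  then obtain f where f: "\<And>w. w \<notin> P \<Longrightarrow> const_near P f w"
    and fx: "\<And>i t. i < n \<Longrightarrow> G i t \<notin> C \<Longrightarrow> \<not> const_near P f (G i t)" by blast
  have "f (corner c (Suc j)) \<noteq> f (corner c j)" if c: "c \<in> C" for c j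
  proof -
    define s where "s = \<rho> c / 2"
    have s: "0 < s" "s < \<rho> c" using \<rho>_pos[OF c] by (auto simp: s_def)
    let ?m = "\<kappa> c (of_real s * \<i> ^ Suc j)"
    obtain i t where "i < n" "?m = G i t" by (rule P_cases[OF ray_on_P[OF c s]])
    then have "\<not> const_near P f ?m" using fx ray_off_C[OF c s] by metis
    then show ?thesis using const_near_ray[OF c f s, of "Suc j"] unfolding corner_add_4 by blast
  qed
  then show ?thesis using f by blast
qed

text \<open>Only the arcs of one of the two components through \<open>c\<close> are marked. Between
  opposite corners one crosses one ray of each strand, hence exactly one marked ray.\<close>

lemma ex_opposite_separation:
  assumes c: "c \<in> C" and ij: "\<exists>a b. a \<noteq> b \<and> a \<in> components_through D c \<and> b \<in> components_through D c"
  shows "\<exists>f. (\<forall>w. w \<notin> P \<longrightarrow> const_near P f w) \<and> f (corner c 2) \<noteq> f (corner c 0) \<and> f (corner c 3) \<noteq> f (corner c 1)"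
proof -
  obtain i t j u e e' where ch: "crossing_chart c (\<rho> c) (\<kappa> c) i t j u e e'"
    using crossing_chart_chosen[OF c] by blast
  then have n: "i < n" "j < n" and fib: "fibre D c = {(i, cis t), (j, cis u)}"
    and ee: "e \<in> {1, -1}" "e' \<in> {\<i>, -\<i>}" and st: "strand (\<kappa> c) e i t" "strand (\<kappa> c) e' j u"
    unfolding crossing_chart_def by auto
  have "i \<noteq> j" using ij unfolding components_through_def fib by auto
  have "\<exists>f. (\<forall>w. w \<notin> P \<longrightarrow> const_near P f w) \<and>
    (\<forall>l s. l < n \<longrightarrow> G l s \<notin> C \<longrightarrow> (const_near P f (G l s) \<longleftrightarrow> \<not> l = i))"
    by (rule ex_potential[where Q = "{}"]) (auto simp: switches_const intro: exI[of _ 1])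
  then obtain f where f: "\<And>w. w \<notin> P \<Longrightarrow> const_near P f w"
    and fx: "\<And>l s. l < n \<Longrightarrow> G l s \<notin> C \<Longrightarrow> (const_near P f (G l s) \<longleftrightarrow> l \<noteq> i)" by blast
  have ray: "f (corner c m) = f (corner c (m + 3)) \<longleftrightarrow> l \<noteq> i"
    if l: "l < n" and s: "0 < s" "s < \<rho> c" "\<exists>r. G l r = \<kappa> c (of_real s * \<i> ^ m)" for l s m
  proof -
    obtain r where r: "G l r = \<kappa> c (of_real s * \<i> ^ m)" using s(3) by blast
    then have "G l r \<notin> C" using ray_off_C[OF c s(1,2)] by simp
    then show ?thesis using fx[OF l] const_near_ray[OF c f s(1,2), of m] r by metis
  qed
  obtain s where s: "0 < s" "s < \<rho> c" "\<exists>r. G i r = \<kappa> c (of_real s * e)" "\<exists>r. G i r = \<kappa> c (of_real s * - e)"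
    using strand_ray[OF st(1) \<rho>_pos[OF c]] by metis
  obtain s' where s': "0 < s'" "s' < \<rho> c" "\<exists>r. G j r = \<kappa> c (of_real s' * e')" "\<exists>r. G j r = \<kappa> c (of_real s' * - e')"
    using strand_ray[OF st(2) \<rho>_pos[OF c]] by metis
  have "\<exists>r. G i r = \<kappa> c (of_real s * \<i> ^ 0)" "\<exists>r. G i r = \<kappa> c (of_real s * \<i> ^ 2)"
    using s(3,4) ee(1) by auto
  \<comment> \<open>Ray \<open>m\<close> separates the corners \<open>m\<close> and
    \<open>m + 3\<close>. The rays 0 and 2 belong to component \<open>i\<close>, the rays 1 and 3 to
    component \<open>j\<close>.\<close>
  then have even: "f (corner c 0) \<noteq> f (corner c 3)" "f (corner c 2) \<noteq> f (corner c 5)"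
    using ray[OF n(1) s(1,2), of 0] ray[OF n(1) s(1,2), of 2] by simp_all
  have "\<exists>r. G j r = \<kappa> c (of_real s' * \<i> ^ 1)" "\<exists>r. G j r = \<kappa> c (of_real s' * \<i> ^ 3)"
    using s'(3,4) ee(2) by (auto simp: numeral_3_eq_3)
  then have odd: "f (corner c 1) = f (corner c 4)" "f (corner c 3) = f (corner c 6)"
    using ray[OF n(2) s'(1,2), of 1] ray[OF n(2) s'(1,2), of 3] \<open>i \<noteq> j\<close> by simp_all
  have "corner c 4 = corner c 0" "corner c 5 = corner c 1" "corner c 6 = corner c 2"
    using corner_mod[of c 0] corner_mod[of c 1] corner_mod[of c 2] by simp_all
  then have "f (corner c 2) \<noteq> f (corner c 0)" "f (corner c 3) \<noteq> f (corner c 1)" using even odd by metis+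
  then show ?thesis using f by blast
qed

text \<open>At such a crossing a region contains at most one corner: neighbouring corners are
  separated by the checkerboard colouring, opposite ones by
  \<open>ex_opposite_separation\<close>.\<close>

lemma corner_sum_region:
  assumes c: "c \<in> C" and ij: "\<exists>a b. a \<noteq> b \<and> a \<in> components_through D c \<and> b \<in> components_through D c"
    and R: "R \<in> regions D"
  shows "corner_sum (\<lambda>z. z \<in> R) c \<longleftrightarrow> c \<in> frontier R"
proof -
  have R': "R \<in> components (- P)" using R by (simp add: regions_def)
  obtain f where f: "\<And>w. w \<notin> P \<Longrightarrow> const_near P f w" "\<And>j. f (corner c (Suc j)) \<noteq> f (corner c j)"
    using ex_checkerboard c by blast
  obtain g where g: "\<And>w. w \<notin> P \<Longrightarrow> const_near P g w" "g (corner c 2) \<noteq> g (corner c 0)" "g (corner c 3) \<noteq> g (corner c 1)"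
    using ex_opposite_separation[OF c ij] by blast
  have sep: "\<not> (x \<in> R \<and> y \<in> R)" if "h x \<noteq> h y" "\<And>w. w \<notin> P \<Longrightarrow> const_near P h w" for h x y
    using const_on_region[OF that(2) R'] that(1) by blast
  have "f (corner c 1) \<noteq> f (corner c 0)" "f (corner c 2) \<noteq> f (corner c 1)" "f (corner c 3) \<noteq> f (corner c 2)"
    using f(2)[of 0] f(2)[of 1] f(2)[of 2] by (simp_all add: numeral_eq_Suc)
  moreover from this have "f (corner c 3) \<noteq> f (corner c 0)" by blast
  ultimately have "\<not> (corner c 1 \<in> R \<and> corner c 0 \<in> R)" "\<not> (corner c 2 \<in> R \<and> corner c 1 \<in> R)"
    "\<not> (corner c 3 \<in> R \<and> corner c 2 \<in> R)" "\<not> (corner c 3 \<in> R \<and> corner c 0 \<in> R)"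
    "\<not> (corner c 2 \<in> R \<and> corner c 0 \<in> R)" "\<not> (corner c 3 \<in> R \<and> corner c 1 \<in> R)"
    using sep[of f, OF _ f(1)] sep[of g, OF g(2) g(1)] sep[of g, OF g(3) g(1)] by blast+
  moreover have "(\<exists>j<4. corner c j \<in> R) \<longleftrightarrow> corner c 0 \<in> R \<or> corner c 1 \<in> R \<or> corner c 2 \<in> R \<or> corner c 3 \<in> R"
    by (simp add: numeral_eq_Suc less_Suc_eq ex_disj_distrib conj_disj_distribR)
  ultimately show ?thesis
    unfolding corner_sum_def frontier_crossing_iff[OF c R'] by blast
qed

text \<open>The boundary set of a region and the set of its odd corner sums agree at crossings of
  distinct components, which alone decide the parity of the passages; for the second set this parity
  is even by \<open>even_corner_sum\<close>.\<close>

lemma span_even: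
  assumes i: "i < n" and Q: "Q \<in> sd_span boundaries"
  shows "even (card (params_over i Q))"
  using Q
proof induction
  case empty
  show ?case by simp
next
  case (step A S)
  obtain R where R: "R \<in> regions D" "A = {c \<in> C. c \<in> frontier R}" using step(1) unfolding boundaries_def by blast
  have R': "R \<in> components (- P)" using R(1) by (simp add: regions_def)
  have AC: "A \<subseteq> C" "S \<subseteq> C" using R(2) span_sub[OF step(2)] by auto
  let ?T = "{c \<in> C. corner_sum (\<lambda>z. z \<in> R) c}"
  have "{c \<in> A. mixed i c} =
      {c \<in> ?T. mixed i c}"
    unfolding R(2) using corner_sum_region[OF _ _ R(1)] by blast
  moreover have "even (card (params_over i ?T))"
    by (rule even_corner_sum[OF i const_near_region[OF R']])
  moreover have "?T \<subseteq> C" by blast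
  ultimately have "even (card (params_over i A))"
    using even_params_over[OF i AC(1)] even_params_over[OF i, of ?T] by simp
  moreover have "params_over i (sym_diff A S) = sym_diff (params_over i A) (params_over i S)" by blast
  ultimately show ?case
    using even_card_sym_diff[OF finite_params_over[OF i AC(1)] finite_params_over[OF i AC(2)]] step(3) by simp
qed

section \<open>Regions at the corners and sums of boundary sets\<close>

definition corner_region :: "complex \<Rightarrow> nat \<Rightarrow> complex set" where
  "corner_region c j = connected_component_set (- P) (corner c j)"

lemma corner_region:
  assumes "c \<in> C"
  shows "corner_region c j \<in> regions D" "corner c j \<in> corner_region c j"
  using corner_off[OF assms, of j] unfolding corner_region_def regions_def components_def by auto

lemma corner_region_unique:
  assumes "c \<in> C" "R \<in> regions D" "corner c j \<in> R"
  shows "R = corner_region c j"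
  using corner_region[OF assms(1), of j] assms(2,3) components_eq[of R "- P" "corner_region c j"]
  unfolding regions_def by blast

lemma frontier_corner_region:
  assumes "c \<in> C" "R \<in> regions D"
  shows "c \<in> frontier R \<longleftrightarrow> (\<exists>j<4. R = corner_region c j)"
  using frontier_crossing_iff[OF assms(1), of R] assms corner_region[OF assms(1)] corner_region_unique[OF assms]
  unfolding regions_def by blast

lemma corner_mod4: "corner c j = corner c (j mod 4)"
proof (induction j rule: less_induct)
  case (less j)
  show ?case
  proof (cases "j < 4")
    case False
    then obtain l where l: "j = l + 4" using le_Suc_ex[of 4 j] by (auto simp: add.commute)
    then show ?thesis using less[of l] corner_mod[of c l] by simp
  qed simp
qed

lemma closure_corner_region:
  assumes c: "c \<in> C"
  shows "c \<in> closure (corner_region c j)"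
proof -
  have "corner_region c j = corner_region c (j mod 4)" unfolding corner_region_def using corner_mod4 by metis
  moreover have "j mod 4 < 4" by simp
  ultimately have "c \<in> frontier (corner_region c j)"
    using frontier_corner_region[OF c corner_region(1)[OF c]] by blast
  then show ?thesis unfolding frontier_def by blast
qed

text \<open>Each crossing has at most four regions around it. The remaining regions have empty
  boundary sets, so a sum over regions can be taken over this finite family.\<close>

lemma finite_touching: "finite {W \<in> regions D. A W \<and> (\<exists>d\<in>C. d \<in> frontier W)}"
proof (rule finite_subset)
  show "finite ((\<lambda>(d, j). corner_region d j) ` (C \<times> {..<4::nat}))" using finite_C by simp
  show "{W \<in> regions D. A W \<and> (\<exists>d\<in>C. d \<in> frontier W)} \<subseteq> (\<lambda>(d, j). corner_region d j) ` (C \<times> {..<4::nat})"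
  proof
    fix W assume "W \<in> {W \<in> regions D. A W \<and> (\<exists>d\<in>C. d \<in> frontier W)}"
    then obtain d where d: "W \<in> regions D" "d \<in> C" "d \<in> frontier W" by blast
    then obtain j where "j < 4" "W = corner_region d j" using frontier_corner_region by blast
    then show "W \<in> (\<lambda>(d, j). corner_region d j) ` (C \<times> {..<4::nat})"
      using d(2) by (intro image_eqI[of _ _ "(d, j)"]) auto
  qed
qed

lemma touching_sum_span:
  "{c \<in> C. odd (card {W \<in> regions D. A W \<and> c \<in> frontier W})} \<in> sd_span boundaries"
proof -
  let ?S = "{W \<in> regions D. A W \<and> (\<exists>d\<in>C. d \<in> frontier W)}"
  have "{c \<in> C. odd (card {W \<in> ?S. c \<in> frontier W})} \<in> sd_span boundaries"
    by (rule sd_span_sum[OF finite_touching]) (use boundary_mem in blast)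
  moreover have "{W \<in> ?S. c \<in> frontier W} = {W \<in> regions D. A W \<and> c \<in> frontier W}" if "c \<in> C" for c
    using that by blast
  then have "{c \<in> C. odd (card {W \<in> ?S. c \<in> frontier W})} =
      {c \<in> C. odd (card {W \<in> regions D. A W \<and> c \<in> frontier W})}"
    by (intro Collect_cong conj_cong refl) simp
  ultimately show ?thesis by simp
qed

lemma checkerboard_corners:
  assumes f: "\<And>j. f (corner c (Suc j)) \<noteq> (f (corner c j) :: bool)"
  shows "f (corner c (j + 1)) \<noteq> f (corner c j)" "f (corner c (j + 2)) = f (corner c j)"
    "f (corner c (j + 3)) \<noteq> f (corner c j)"
  using f[of j] f[of "Suc j"] f[of "Suc (Suc j)"] by (auto simp: numeral_eq_Suc)

text \<open>The checkerboard colouring keeps the region out of the neighbouring corners, as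
  \<open>double_region_curve\<close> demands.\<close>

lemma ex_separating_curve:
  assumes c: "c \<in> C" and R: "R \<in> regions D" "corner c j \<in> R" "corner c (j + 2) \<in> R"
  shows "\<exists>\<gamma>. separating_curve c R j \<gamma>"
proof -
  have R': "R \<in> components (- P)" using R(1) by (simp add: regions_def)
  obtain f where f: "\<And>w. w \<notin> P \<Longrightarrow> const_near P f w" "\<And>j. f (corner c (Suc j)) \<noteq> f (corner c j)"
    using ex_checkerboard c by blast
  have "corner c (j + 1) \<notin> R" "corner c (j + 3) \<notin> R"
    using checkerboard_corners[of f, OF f(2), of j] const_on_region[OF f(1) R' _ R(2)] by blast+
  then show ?thesis by (rule double_region_curve[OF c R' R(2,3)])
qed

text \<open>Of the two corners at \<open>c\<close> of the other colour exactly one is enclosed, so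
  the sum contains \<open>c\<close>. Any other crossing has both its corners of that colour enclosed
  or neither, so it remains in the sum only if one region fills both; it is then reducible, with a
  curve that encloses fewer crossings.\<close>

lemma reducible_in_span:
  assumes "c \<in> C" "R \<in> regions D" "corner c j \<in> R" "corner c (j + 2) \<in> R" "separating_curve c R j \<gamma>"
  shows "{c} \<in> sd_span boundaries"
  using assms
proof (induction "card (C \<inter> inside (path_image \<gamma>))" arbitrary: c R j \<gamma> rule: less_induct)
  case less
  note c = less.prems(1) and R = less.prems(2-4)
  have \<gamma>: "simple_path \<gamma>" "pathfinish \<gamma> = pathstart \<gamma>" "path_image \<gamma> \<subseteq> insert c R" "c \<in> path_image \<gamma>"
    using less.prems(5) unfolding separating_curve_def by blast+
  define I where "I = inside (path_image \<gamma>)"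
  define E where "E = outside (path_image \<gamma>)"
  have J: "open I" "open E" "I \<inter> E = {}" "I \<union> E = - path_image \<gamma>"
    unfolding I_def E_def using Jordan_inside_outside[OF \<gamma>(1,2)] by simp_all
  have sides: "corner c (j + 1) \<in> I \<and> corner c (j + 3) \<in> E \<or> corner c (j + 3) \<in> I \<and> corner c (j + 1) \<in> E"
    using less.prems(5) unfolding separating_curve_def I_def E_def by blast
  have RP: "W \<inter> P = {}" if "W \<in> regions D" for W
    using in_components_subset[of W "- P"] that unfolding regions_def by blast
  obtain f where f: "\<And>w. w \<notin> P \<Longrightarrow> const_near P f w"
    and fc: "\<And>d j. d \<in> C \<Longrightarrow> f (corner d (Suc j)) \<noteq> f (corner d j)" using ex_checkerboard by blast
  have freg: "f x = f y" if "W \<in> regions D" "x \<in> W" "y \<in> W" for W x y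
    using const_on_region[OF f, of W] that unfolding regions_def by blast
  define b where "b \<longleftrightarrow> f (corner c j)"
  define A where "A W \<longleftrightarrow> W \<subseteq> I \<and> (\<forall>x\<in>W. f x \<noteq> b)" for W
  \<comment> \<open>A region of the other colour is not \<open>R\<close>, so it misses the curve,
    which lies in \<open>R\<close> apart from \<open>c\<close>.\<close>
  have one_side: "W \<subseteq> I \<or> W \<subseteq> E" if W: "W \<in> regions D" "x \<in> W" "f x \<noteq> b" for W x
    unfolding I_def E_def
  proof (rule connected_inside_or_outside)
    show "connected W" using W(1) unfolding regions_def by (rule in_components_connected)
    have "W \<noteq> R" using freg[OF R(1) R(2), of x] W(2,3) unfolding b_def by blast
    then have "W \<inter> R = {}" using components_nonoverlap[of W "- P" R] W(1) R(1) unfolding regions_def by blast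
    moreover have "c \<notin> W" using RP[OF W(1)] c C_sub_P by blast
    ultimately show "W \<inter> path_image \<gamma> = {}" using \<gamma>(3) by blast
  qed
  have A_corner: "A (corner_region d m) \<longleftrightarrow> f (corner d m) \<noteq> b \<and> corner d m \<in> I" if d: "d \<in> C" for d m
  proof
    assume "A (corner_region d m)"
    then show "f (corner d m) \<noteq> b \<and> corner d m \<in> I" using corner_region(2)[OF d] unfolding A_def by blast
  next
    assume fm: "f (corner d m) \<noteq> b \<and> corner d m \<in> I"
    then have "corner_region d m \<subseteq> I"
      using one_side[OF corner_region[OF d]] corner_region(2)[OF d] J(3) by blast
    moreover have "\<forall>x\<in>corner_region d m. f x \<noteq> b"
      using freg[OF corner_region(1)[OF d] corner_region(2)[OF d]] fm by metis
    ultimately show "A (corner_region d m)" unfolding A_def by blast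
  qed
  let ?N = "\<lambda>d. {W \<in> regions D. A W \<and> d \<in> frontier W}"
  have N: "?N d = corner_region d ` {m. m < 4 \<and> f (corner d m) \<noteq> b \<and> corner d m \<in> I}" if d: "d \<in> C" for d
  proof -
    have "W \<in> ?N d \<longleftrightarrow> (\<exists>m<4. W = corner_region d m \<and> f (corner d m) \<noteq> b \<and> corner d m \<in> I)" for W
      using frontier_corner_region[OF d, of W] A_corner[OF d] corner_region(1)[OF d] by blast
    then show ?thesis by blast
  qed
  have Nc: "odd (card (?N c))"
  proof -
    have "\<exists>m0<4. ?N c = {corner_region c m0}"
    proof -
      obtain l where l: "l \<in> {1, 3}" "corner c (j + l) \<in> I"
        and off: "\<And>l'. l' \<in> {1, 3} \<Longrightarrow> l' \<noteq> l \<Longrightarrow> corner c (j + l') \<in> E"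
        using sides by (metis insert_iff singletonD)
      have fl: "f (corner c (j + l)) \<noteq> b"
        using l(1) checkerboard_corners[of f c, OF fc[OF c], of j] unfolding b_def by auto
      have only: "corner c m = corner c (j + l)" if m: "m < 4" "f (corner c m) \<noteq> b" "corner c m \<in> I" for m
      proof -
        \<comment> \<open>The position of \<open>m\<close> relative to \<open>j\<close>:
          \<open>3 * j\<close> stands for \<open>- j\<close> modulo 4.\<close>
        define l' where "l' = (m + 3 * j) mod 4"
        have "(j + l') mod 4 = m mod 4" unfolding l'_def by (simp add: mod_simps)
        then have eq: "corner c m = corner c (j + l')" using corner_mod4[of c m] corner_mod4[of c "j + l'"] by simp
        have "l' = 0 \<or> l' = 1 \<or> l' = 2 \<or> l' = 3" unfolding l'_def by presburger
        moreover have "f (corner c (j + 2)) = b"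
          using checkerboard_corners(2)[of f c, OF fc[OF c], of j] unfolding b_def .
        then have "l' \<noteq> 0" "l' \<noteq> 2" using m(2) unfolding eq b_def by (metis add_0_right)+
        ultimately have "l' \<in> {1, 3}" by blast
        then have "l' = l" using off[of l'] m(3) eq J(3) by auto
        then show ?thesis using eq by simp
      qed
      define m0 where "m0 = (j + l) mod 4"
      have m0: "m0 < 4" "corner c m0 = corner c (j + l)"
        unfolding m0_def using corner_mod4[of c "j + l"] by simp_all
      have "?N c = {corner_region c m0}"
      proof
        show "?N c \<subseteq> {corner_region c m0}"
        proof
          fix W assume "W \<in> ?N c"
          then obtain m where m: "W = corner_region c m" "m < 4" "f (corner c m) \<noteq> b" "corner c m \<in> I"
            unfolding N[OF c] by blast
          have "corner c m = corner c m0" using only[OF m(2-4)] m0(2) by simp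
          then show "W \<in> {corner_region c m0}" unfolding m(1) corner_region_def by simp
        qed
        have "m0 < 4 \<and> f (corner c m0) \<noteq> b \<and> corner c m0 \<in> I" using m0 fl l(2) by simp
        then show "{corner_region c m0} \<subseteq> ?N c" unfolding N[OF c] by blast
      qed
      then show ?thesis using m0(1) by blast
    qed
    then obtain m0 where "?N c = {corner_region c m0}" by blast
    then show ?thesis by simp
  qed
  have IH: "{d} \<in> sd_span boundaries" if d: "d \<in> C" "d \<noteq> c" and odd: "odd (card (?N d))" for d
  proof -
    have "d \<notin> path_image \<gamma>" using \<gamma>(3) d RP[OF R(1)] C_sub_P by blast
    have "?N d \<noteq> {}" using odd by (metis card.empty even_zero)
    then obtain m where m: "f (corner d m) \<noteq> b" "corner d m \<in> I" unfolding N[OF d(1)] by blast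
    \<comment> \<open>Otherwise an enclosed region would have a point of the open outside in its
      closure.\<close>
    have dI: "d \<in> I"
    proof (rule ccontr)
      assume "d \<notin> I"
      then have "d \<in> E" using J(4) \<open>d \<notin> path_image \<gamma>\<close> by blast
      then have "corner_region d m \<inter> E \<noteq> {}"
        using J(2) closure_corner_region[OF d(1)] closure_iff_nhds_not_empty by blast
      moreover have "corner_region d m \<subseteq> I" using A_corner[OF d(1), of m] m unfolding A_def by blast
      ultimately show False using J(3) by blast
    qed
    have inI: "corner d l \<in> I" if l: "f (corner d l) \<noteq> b" for l
    proof -
      have "corner_region d l \<inter> I \<noteq> {}"
        using J(1) dI closure_corner_region[OF d(1)] closure_iff_nhds_not_empty by blast
      then show ?thesis
        using one_side[OF corner_region[OF d(1)] l] J(3) corner_region(2)[OF d(1)] by blast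
    qed
    \<comment> \<open>Colours alternate around \<open>d\<close>, so the corners of the other colour
      are 0 and 2, or 1 and 3.\<close>
    obtain a where a: "a \<in> {0, 1}" "f (corner d a) \<noteq> b" "f (corner d (a + 2)) \<noteq> b" "f (corner d (a + 1)) = b" "f (corner d (a + 3)) = b"
    proof (cases "f (corner d 0) = b")
      case True
      then show ?thesis using that[of 1] fc[OF d(1), of 0] fc[OF d(1), of 1] fc[OF d(1), of 2] fc[OF d(1), of 3]
        by (simp add: numeral_eq_Suc)
    next
      case False
      then show ?thesis using that[of 0] fc[OF d(1), of 0] fc[OF d(1), of 1] fc[OF d(1), of 2]
        by (simp add: numeral_eq_Suc)
    qed
    have Nd: "?N d = {corner_region d a, corner_region d (a + 2)}"
    proof -
      have c4: "corner d 4 = corner d 0" using corner_mod[of d 0] by simp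
      have ms: "{m. m < 4 \<and> f (corner d m) \<noteq> b \<and> corner d m \<in> I} = {a, a + 2}"
      proof -
        have "m < 4 \<and> f (corner d m) \<noteq> b \<and> corner d m \<in> I \<longleftrightarrow> m = a \<or> m = a + 2" for m
        proof
          assume m: "m < 4 \<and> f (corner d m) \<noteq> b \<and> corner d m \<in> I"
          then have "m = 0 \<or> m = 1 \<or> m = 2 \<or> m = 3" by linarith
          then show "m = a \<or> m = a + 2" using m a c4 by (auto simp: numeral_eq_Suc)
        next
          assume "m = a \<or> m = a + 2"
          then show "m < 4 \<and> f (corner d m) \<noteq> b \<and> corner d m \<in> I" using a inI by auto
        qed
        then show ?thesis by blast
      qed
      show ?thesis unfolding N[OF d(1)] ms by simp
    qed
    have same: "corner_region d a = corner_region d (a + 2)"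
    proof (rule ccontr)
      assume "corner_region d a \<noteq> corner_region d (a + 2)"
      then have "card (?N d) = 2" unfolding Nd by simp
      then show False using odd by simp
    qed
    let ?W = "corner_region d a"
    have W: "?W \<in> regions D" "corner d a \<in> ?W" "corner d (a + 2) \<in> ?W"
      using corner_region[OF d(1)] same by metis+
    obtain \<delta> where \<delta>: "separating_curve d ?W a \<delta>" using ex_separating_curve[OF d(1) W] by blast
    then have \<delta>': "simple_path \<delta>" "path_image \<delta> \<subseteq> insert d ?W" "d \<in> path_image \<delta>"
      unfolding separating_curve_def by blast+
    have "?W \<subseteq> I" using A_corner[OF d(1), of a] a(2) inI unfolding A_def by blast
    then have "path_image \<delta> \<subseteq> I" using \<delta>'(2) dI by blast
    then have nest: "inside (path_image \<delta>) \<subseteq> I"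
      unfolding I_def by (rule nested_inside[OF \<gamma>(1) \<delta>'(1)])
    \<comment> \<open>The old curve encloses \<open>d\<close> while the new one runs through it, so
      the induction measure drops.\<close>
    have "d \<notin> inside (path_image \<delta>)" using \<delta>'(3) inside_no_overlap[of "path_image \<delta>"] by blast
    then have "C \<inter> inside (path_image \<delta>) \<subset> C \<inter> inside (path_image \<gamma>)"
      using nest dI d(1) unfolding I_def by blast
    then have "card (C \<inter> inside (path_image \<delta>)) < card (C \<inter> inside (path_image \<gamma>))"
      using finite_C by (intro psubset_card_mono) auto
    then show ?thesis by (rule less.hyps[OF _ d(1) W \<delta>])
  qed
  \<comment> \<open>The regions of the other colour inside the curve add up to \<open>c\<close> and the crossings covered by \<open>IH\<close>.\<close>
  let ?Q = "{d \<in> C. odd (card (?N d))}"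
  have "?Q \<in> sd_span boundaries" by (rule touching_sum_span)
  moreover have "?Q - {c} \<in> sd_span boundaries"
    by (rule sd_span_singletons) (use finite_C IH in auto)
  ultimately have "sym_diff ?Q (?Q - {c}) \<in> sd_span boundaries" by (rule sd_span_sym_diff)
  moreover have "sym_diff ?Q (?Q - {c}) = {c}" using c Nc by blast
  ultimately show ?case by simp
qed

text \<open>Add up the boundaries of the regions on which a function with corner sums
  \<open>Q\<close> holds. At a crossing with four different corner regions this gives the corner
  sum. At any other crossing two opposite corners share a region, so an error there is corrected by
  \<open>reducible_in_span\<close>.\<close>

lemma even_in_span:
  assumes Q: "Q \<subseteq> C" and ev: "\<And>i. i < n \<Longrightarrow> even (card (params_over i Q))"
  shows "Q \<in> sd_span boundaries"
proof -
  obtain f where f: "\<And>w. w \<notin> P \<Longrightarrow> const_near P f w" and fQ: "\<And>c. c \<in> C \<Longrightarrow> corner_sum f c \<longleftrightarrow> c \<in> Q"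
    using ex_corner_sum[OF Q ev] by blast
  obtain g where g: "\<And>w. w \<notin> P \<Longrightarrow> const_near P g w"
    and gc: "\<And>d j. d \<in> C \<Longrightarrow> g (corner d (Suc j)) \<noteq> g (corner d j)" using ex_checkerboard by blast
  define A where "A W \<longleftrightarrow> (\<forall>x\<in>W. f x)" for W
  let ?N = "\<lambda>d. {W \<in> regions D. A W \<and> d \<in> frontier W}"
  let ?Q = "{d \<in> C. odd (card (?N d))}"
  have A_corner: "A (corner_region d m) \<longleftrightarrow> f (corner d m)" if d: "d \<in> C" for d m
  proof -
    have "corner_region d m \<in> components (- P)" using corner_region(1)[OF d] by (simp add: regions_def)
    then have "f x = f (corner d m)" if "x \<in> corner_region d m" for x
      using const_on_region[OF f _ that corner_region(2)[OF d]] by blast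
    then show ?thesis unfolding A_def using corner_region(2)[OF d] by metis
  qed
  have N: "?N d = corner_region d ` {m. m < 4 \<and> f (corner d m)}" if d: "d \<in> C" for d
    using frontier_corner_region[OF d] A_corner[OF d] corner_region(1)[OF d] by blast
  have red: "{d} \<in> sd_span boundaries" if d: "d \<in> sym_diff ?Q Q" for d
  proof -
    have dC: "d \<in> C" using d Q by blast
    have "corner_region d 0 = corner_region d 2 \<or> corner_region d 1 = corner_region d 3"
    proof (rule ccontr)
      assume neq: "\<not> ?thesis"
      have adj: "corner_region d m \<noteq> corner_region d l" if "g (corner d m) \<noteq> g (corner d l)" for m l
      proof
        assume eq: "corner_region d m = corner_region d l"
        have "corner_region d m \<in> components (- P)" using corner_region(1)[OF dC] by (simp add: regions_def)
        then have "g (corner d m) = g (corner d l)"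
          using const_on_region[OF g, of "corner_region d m"] corner_region(2)[OF dC] eq by metis
        then show False using that by blast
      qed
      have g4: "g (corner d 1) \<noteq> g (corner d 0)" "g (corner d 2) = g (corner d 0)" "g (corner d 3) \<noteq> g (corner d 0)"
        using checkerboard_corners[of g d, OF gc[OF dC], of 0] by (simp_all add: numeral_2_eq_2)
      have "inj_on (corner_region d) {m. m < 4}"
      proof (rule inj_onI)
        fix m l assume ml: "m \<in> {m. m < 4}" "l \<in> {m. m < 4}" "corner_region d m = corner_region d l"
        then have "m = 0 \<or> m = 1 \<or> m = 2 \<or> m = 3" "l = 0 \<or> l = 1 \<or> l = 2 \<or> l = 3" by auto
        then show "m = l" using ml(3) neq adj[of m l] g4 by (elim disjE) simp_all
      qed
      then have "inj_on (corner_region d) {m. m < 4 \<and> f (corner d m)}" by (rule inj_on_subset) blast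
      then have "card (?N d) = card {m. m < 4 \<and> f (corner d m)}" unfolding N[OF dC] by (rule card_image)
      also have "\<dots> = (\<Sum>m<4. if f (corner d m) then 1 else 0)"
        by (simp add: sum.If_cases lessThan_def Collect_conj_eq)
      also have "\<dots> = of_bool (f (corner d 0)) + of_bool (f (corner d 1)) +
          of_bool (f (corner d 2)) + of_bool (f (corner d 3))"
        by (simp add: numeral_eq_Suc of_bool_def)
      also have "odd \<dots> \<longleftrightarrow> corner_sum f d"
        unfolding corner_sum_def
        by (cases "f (corner d 0)"; cases "f (corner d 1)"; cases "f (corner d 2)"; cases "f (corner d 3)") simp_all
      finally have "d \<in> ?Q \<longleftrightarrow> d \<in> Q" using fQ[OF dC] dC by blast
      then show False using d by blast
    qed
    then obtain a where a: "corner_region d a = corner_region d (a + 2)"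
      by (metis add_0 one_plus_numeral semiring_norm(3))
    have W: "corner_region d a \<in> regions D" "corner d a \<in> corner_region d a" "corner d (a + 2) \<in> corner_region d a"
      using corner_region[OF dC] a by metis+
    obtain \<delta> where "separating_curve d (corner_region d a) a \<delta>" using ex_separating_curve[OF dC W] by blast
    then show ?thesis by (rule reducible_in_span[OF dC W])
  qed
  have "?Q \<in> sd_span boundaries" by (rule touching_sum_span)
  \<comment> \<open>The error set is a finite set of reducible crossings, each of which is in the
    span on its own.\<close>
  moreover have "sym_diff ?Q Q \<in> sd_span boundaries"
  proof (rule sd_span_singletons[OF _ red])
    have "sym_diff ?Q Q \<subseteq> C" using Q by blast
    then show "finite (sym_diff ?Q Q)" using finite_C by (rule finite_subset)
  qed
  ultimately have "sym_diff ?Q (sym_diff ?Q Q) \<in> sd_span boundaries" by (rule sd_span_sym_diff)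
  moreover have "sym_diff ?Q (sym_diff ?Q Q) = Q" by blast
  ultimately show ?thesis by simp
qed

end

theorem mainTheorem2:
  fixes n :: nat and L :: diagram_data and Q :: "complex set"
  assumes "n \<ge> 1"
    and "link_diagram L" and "num_components L = n" and "non_split L"
    and "Q \<subseteq> crossings L"
  shows "rcc_admissible L Q \<longleftrightarrow>
    (\<forall>v\<in>mverts (crossing_graph L Q). even (valency (crossing_graph L Q) v))"
proof -
  interpret diagram L by (rule diagram.intro) fact
  have "rcc_admissible L Q \<longleftrightarrow> (\<forall>i<n. even (card (params_over i Q)))"
    unfolding admissible_iff_span[OF assms(5)]
    using span_even even_in_span[OF assms(5)] assms(3) by blast
  also have "\<dots> \<longleftrightarrow> (\<forall>i<n. even (valency (crossing_graph L Q) i))"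
    using even_valency_iff[OF _ assms(5)] assms(3) by simp
  also have "\<dots> \<longleftrightarrow> (\<forall>v\<in>mverts (crossing_graph L Q). even (valency (crossing_graph L Q) v))"
  proof -
    have "mverts (crossing_graph L Q) = {..<n}" using assms(3) by (simp add: crossing_graph_def)
    then show ?thesis by (simp only: Ball_def lessThan_iff)
  qed
  finally show ?thesis .
qed

end
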